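(* Assume $b\in(0,1/2)$ and let $\eta=(\sigma^2,\vartheta_2,\kappa)$ lie in the interior of $H$ for some compact set $H\subset(0,\infty)^2\times\mathbb R$. If there exist values $v\in\mathbb N$ with $v\eqsim\max(1,N/M^2)$ and $w\in\mathbb N$ with $w\eqsim\max(1,M/\sqrt N)$ such that $r:=w\delta/\sqrt{v\Delta}$ is constant, then the estimator $$\hat\eta_{v,w}=\operatorname*{arg\,min}_{\tilde\eta\in H}\big(\mathcal K^1_{N,M}(\tilde\eta)+\mathcal K^2_{N,M}(\tilde\eta)\big)$$ satisfies $$\|\hat\eta_{v,w}-\eta\|=\mathcal O_P\Big(\frac{1}{\sqrt{M^3\wedge N^{3/2}}}\Big),\qquad M,N\to\infty .$$
   Context: Let $\sigma^2>0$, $\vartheta_2>0$, $\vartheta_1,\vartheta_0\in\mathbb R$, and put $\kappa=\vartheta_1/\vartheta_2$, $\Gamma=\frac{\vartheta_1^2}{4\vartheta_2^2}-\frac{\vartheta_0}{\vartheta_2}$; it is assumed that $\Gamma+\pi^2>0$. For $\ell\ge1$, $y\in[0,1]$ let $e_\ell(y)=\sqrt2\sin(\pi\ell y)\mathrm{e}^{-\kappa y/2}$ and $\lambda_\ell=\vartheta_2(\pi^2\ell^2+\Gamma)$. $X$ is the stationary solution of the SPDE $dX_t(x)=(\vartheta_2\partial_x^2X_t(x)+\vartheta_1\partial_xX_t(x)+\vartheta_0X_t(x))\,dt+\sigma\,dW_t(x)$ on $[0,1]$ with Dirichlet boundary conditions and $W$ a cylindrical Brownian motion, i.e. $X_t(x)=\sum_{\ell\ge1}u_\ell(t)e_\ell(x)$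 with independent processes $du_\ell(t)=-\lambda_\ell u_\ell(t)\,dt+\sigma\,d\beta_\ell(t)$, $u_\ell(0)\sim\mathcal N(0,\sigma^2/(2\lambda_\ell))$, $\{\beta_\ell,u_\ell(0):\ell\ge1\}$ an independent family, $\beta_\ell$ standard Brownian motions. Equivalently, $X$ is the (continuous version of the) centered Gaussian field with $\mathrm{Cov}(X_s(x),X_t(y))=\sigma^2\sum_{\ell\ge1}\frac{\mathrm{e}^{-\lambda_\ell|t-s|}}{2\lambda_\ell}e_\ell(x)e_\ell(y)$. Observation grid: for fixed $T>0$ and fixed $b$, $t_i=i\Delta$, $\Delta=T/N$, $0\le i\le N$; $y_k=b+k\delta$, $\delta=(1-2b)/M$, $0\le k\le M$. $M,N\to\infty$ means $\min(M,N)\to\infty$. For sequences, $a_n\eqsim b_n$ means $a_n\le c\,b_n$ and $b_n\le c\,a_n$ for some constant $c>0$ and all $n$; $v,w$ may depend on $(M,N)$. Let $D_{v,w}(i,k)=X_{t_{i+v}}(y_{k+w})-X_{t_i}(y_{k+w})-X_{t_{i+v}}(y_k)+X_{t_i}(y_k)$, $$\psi_{\vartheta_2}(r)=\frac{2}{\sqrt{\pi\vartheta_2}}\Big(1-\mathrm{e}^{-\frac{r^2}{4\vartheta_2}}+\frac{r}{\sqrt{\vartheta_2}}\int_{r/(2\sqrt{\vartheta_2})}^\infty\mathrm{e}^{-z^2}\,dz\Big),$$ and, for $\eta=(\sigma^2,\vartheta_2,\kappa)$, $\nu=1,2$ and $r=w\delta/\sqrt{v\Delta}$, $f^\nu_\eta(z)=\sigma^2\psi_{\vartheta_2}(r/\sqrt\nu)\mathrm{e}^{-\kappa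 z}$. Then $$\mathcal K^\nu_{N,M}(\tilde\eta)=\frac{1}{M-w+1}\sum_{k=0}^{M-w}\bigg(\frac{1}{(N-\nu v+1)\sqrt{\nu v\Delta}}\sum_{i=0}^{N-\nu v}D^2_{\nu v,w}(i,k)-f^\nu_{\tilde\eta}\Big(\frac{y_k+y_{k+w}}{2}\Big)\bigg)^2 .$$ *)

theory Defs
  imports "HOL-Probability.Probability"
begin

definition eqsim :: "(nat \<Rightarrow> real) \<Rightarrow> (nat \<Rightarrow> real) \<Rightarrow> bool" where
  "eqsim a b \<longleftrightarrow> (\<exists>c>0. \<forall>n. a n \<le> c * b n \<and> b n \<le> c * a n)"

definition bigO_prob :: "'a measure \<Rightarrow> (nat \<Rightarrow> 'a \<Rightarrow> real) \<Rightarrow> (nat \<Rightarrow> real) \<Rightarrow> bool" where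
  "bigO_prob P Y a \<longleftrightarrow>
     (\<forall>\<epsilon>>0. \<exists>C>0. \<forall>\<^sub>F n in sequentially.
        measure P {\<omega> \<in> space P. \<bar>Y n \<omega>\<bar> > C * \<bar>a n\<bar>} \<le> \<epsilon>)"

text \<open>
  Gaussian variables may be degenerate: the field below vanishes at the boundary points.
\<close>

definition gaussian_rv :: "'a measure \<Rightarrow> ('a \<Rightarrow> real) \<Rightarrow> bool" where
  "gaussian_rv P Y \<longleftrightarrow> Y \<in> borel_measurable P \<and>
     ((\<exists>\<mu> s. s > 0 \<and> distributed P lborel Y (\<lambda>x. ennreal (normal_density \<mu> s x))) \<or>
      (\<exists>\<mu>. AE \<omega> in P. Y \<omega> = \<mu>))"

definition gaussian_field :: "'a measure \<Rightarrow> 'i set \<Rightarrow> ('i \<Rightarrow> 'a \<Rightarrow> real) \<Rightarrow> bool" where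
  "gaussian_field P S Z \<longleftrightarrow>
     (\<forall>F c. finite F \<and> F \<subseteq> S \<longrightarrow> gaussian_rv P (\<lambda>\<omega>. \<Sum>p\<in>F. c p * Z p \<omega>))"

definition covar :: "'a measure \<Rightarrow> ('a \<Rightarrow> real) \<Rightarrow> ('a \<Rightarrow> real) \<Rightarrow> real" where
  "covar P Y Z =
     (\<integral>\<omega>. (Y \<omega> - (\<integral>\<omega>'. Y \<omega>' \<partial>P)) * (Z \<omega> - (\<integral>\<omega>'. Z \<omega>' \<partial>P)) \<partial>P)"

definition Gam :: "real \<Rightarrow> real \<Rightarrow> real \<Rightarrow> real" where
  "Gam \<theta>2 \<theta>1 \<theta>0 = \<theta>1\<^sup>2 / (4 * \<theta>2\<^sup>2) - \<theta>0 / \<theta>2"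

definition eigval :: "real \<Rightarrow> real \<Rightarrow> real \<Rightarrow> nat \<Rightarrow> real" where
  "eigval \<theta>2 \<theta>1 \<theta>0 l = \<theta>2 * (pi\<^sup>2 * (real l)\<^sup>2 + Gam \<theta>2 \<theta>1 \<theta>0)"

definition eigfun :: "real \<Rightarrow> nat \<Rightarrow> real \<Rightarrow> real" where
  "eigfun \<kappa> l y = sqrt 2 * sin (pi * real l * y) * exp (- \<kappa> * y / 2)"

text \<open>
  The modes are numbered from 1, so the series runs over \<open>Suc l\<close>.
\<close>

definition spde_cov ::
  "real \<Rightarrow> real \<Rightarrow> real \<Rightarrow> real \<Rightarrow> real \<Rightarrow> real \<Rightarrow> real \<Rightarrow> real \<Rightarrow> real" where
  "spde_cov \<sigma> \<theta>2 \<theta>1 \<theta>0 s x t y =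
     \<sigma>\<^sup>2 * (\<Sum>l. exp (- eigval \<theta>2 \<theta>1 \<theta>0 (Suc l) * \<bar>t - s\<bar>) / (2 * eigval \<theta>2 \<theta>1 \<theta>0 (Suc l))
              * eigfun (\<theta>1 / \<theta>2) (Suc l) x * eigfun (\<theta>1 / \<theta>2) (Suc l) y)"

text \<open>
  \<open>X t x \<omega>\<close> is the stationary solution on \<open>[0, \<infinity>) \<times> [0, 1]\<close> of
  \<open>dX = (\<theta>2 X'' + \<theta>1 X' + \<theta>0 X) dt + \<sigma> dW\<close> with Dirichlet boundary conditions,
  characterised as the continuous centred Gaussian field with covariance \<open>spde_cov\<close>.
\<close>

definition stationary_solution ::
  "'a measure \<Rightarrow> real \<Rightarrow> real \<Rightarrow> real \<Rightarrow> real \<Rightarrow> (real \<Rightarrow> real \<Rightarrow> 'a \<Rightarrow> real) \<Rightarrow> bool" where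
  "stationary_solution P \<sigma> \<theta>2 \<theta>1 \<theta>0 X \<longleftrightarrow>
     gaussian_field P ({0..} \<times> {0..1}) (\<lambda>(t, x). X t x) \<and>
     (\<forall>t\<ge>0. \<forall>x\<in>{0..1}. (\<integral>\<omega>. X t x \<omega> \<partial>P) = 0) \<and>
     (\<forall>s\<ge>0. \<forall>t\<ge>0. \<forall>x\<in>{0..1}. \<forall>y\<in>{0..1}.
        covar P (X s x) (X t y) = spde_cov \<sigma> \<theta>2 \<theta>1 \<theta>0 s x t y) \<and>
     (AE \<omega> in P. continuous_on ({0..} \<times> {0..1}) (\<lambda>(t, x). X t x \<omega>))"

definition tstep :: "real \<Rightarrow> nat \<Rightarrow> real" where
  "tstep T N = T / real N"

definition ystep :: "real \<Rightarrow> nat \<Rightarrow> real" where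
  "ystep b M = (1 - 2 * b) / real M"

definition tgrid :: "real \<Rightarrow> nat \<Rightarrow> nat \<Rightarrow> real" where
  "tgrid T N i = real i * tstep T N"

definition ygrid :: "real \<Rightarrow> nat \<Rightarrow> nat \<Rightarrow> real" where
  "ygrid b M k = b + real k * ystep b M"

definition dincr ::
  "(real \<Rightarrow> real \<Rightarrow> 'a \<Rightarrow> real) \<Rightarrow> real \<Rightarrow> real \<Rightarrow> nat \<Rightarrow> nat \<Rightarrow> nat \<Rightarrow> nat \<Rightarrow> nat \<Rightarrow> nat \<Rightarrow> 'a \<Rightarrow> real"
  where
  "dincr X T b M N v w i k \<omega> =
     X (tgrid T N (i + v)) (ygrid b M (k + w)) \<omega> - X (tgrid T N i) (ygrid b M (k + w)) \<omega>
     - X (tgrid T N (i + v)) (ygrid b M k) \<omega> + X (tgrid T N i) (ygrid b M k) \<omega>"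

definition psi :: "real \<Rightarrow> real \<Rightarrow> real" where
  "psi \<theta>2 r = 2 / sqrt (pi * \<theta>2) *
     (1 - exp (- (r\<^sup>2 / (4 * \<theta>2)))
        + r / sqrt \<theta>2 * (LBINT z:{r / (2 * sqrt \<theta>2)..}. exp (- (z\<^sup>2))))"

definition mesh_ratio :: "real \<Rightarrow> real \<Rightarrow> nat \<Rightarrow> nat \<Rightarrow> nat \<Rightarrow> nat \<Rightarrow> real" where
  "mesh_ratio T b M N v w = real w * ystep b M / sqrt (real v * tstep T N)"

text \<open>
  In \<open>fmean\<close> and \<open>contrast\<close> the candidate parameter is the triple \<open>(\<sigma>\<^sup>2, \<theta>2, \<kappa>)\<close>: its first
  component is the squared volatility.
\<close>

fun fmean :: "real \<Rightarrow> nat \<Rightarrow> real \<times> real \<times> real \<Rightarrow> real \<Rightarrow> real" where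
  "fmean r \<nu> (s2, \<theta>2, \<kappa>) z = s2 * psi \<theta>2 (r / sqrt (real \<nu>)) * exp (- \<kappa> * z)"

text \<open>
  The truncated subtractions in the summation ranges are harmless when
  \<open>\<nu> * v \<le> N\<close> and \<open>w \<le> M\<close>, the only case in which the contrast is meaningful.
\<close>

definition contrast ::
  "(real \<Rightarrow> real \<Rightarrow> 'a \<Rightarrow> real) \<Rightarrow> real \<Rightarrow> real \<Rightarrow> nat \<Rightarrow> nat \<Rightarrow> nat \<Rightarrow> nat \<Rightarrow> nat \<Rightarrow> 'a \<Rightarrow>
   real \<times> real \<times> real \<Rightarrow> real" where
  "contrast X T b M N v w \<nu> \<omega> \<eta>' =
     1 / (real M - real w + 1) *
     (\<Sum>k = 0..M - w.
        (1 / ((real N - real (\<nu> * v) + 1) * sqrt (real (\<nu> * v) * tstep T N))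
           * (\<Sum>i = 0..N - \<nu> * v. (dincr X T b M N (\<nu> * v) w i k \<omega>)\<^sup>2)
         - fmean (mesh_ratio T b M N v w) \<nu> \<eta>' ((ygrid b M k + ygrid b M (k + w)) / 2))\<^sup>2)"

end

theory Submission
  imports Defs "HOL-Real_Asymp.Real_Asymp"
begin

text \<open>
  Let \<open>h = sqrt (v * tstep T N)\<close> be the time scale of the increments. A constant mesh ratio \<open>r\<close> makes the
  spatial lag equal to \<open>r * h\<close>, and the growth conditions on \<open>v\<close> and \<open>w\<close> make \<open>h\<close> of the order of
  \<open>max (1/M) (1/sqrt N)\<close>. So the claimed rate is \<open>h powr (3/2)\<close>. This is the standard deviation of an
  average over \<open>1/h^3\<close> independent blocks: the field decorrelates over times \<open>h^2\<close> and distances \<open>h\<close>.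

  For a fixed \<open>k\<close> the normalised quadratic variation \<open>Z k\<close> deviates from its limit \<open>f k\<close> by the larger amount
  \<open>h\<close>. The sharper rate appears only after averaging over \<open>k\<close>, and the argument must exploit this averaging. If a
  candidate \<open>\<eta>'\<close> with mean function \<open>f'\<close> has a contrast not exceeding that of the truth, then expanding the
  squares gives \<open>|f' - f|^2 \<le> 2 * <Z - f, f' - f>\<close>. The residuals now appear only in inner products with
  the smooth function \<open>f' - f\<close>, and summation by parts bounds these by the partial sums of \<open>Z - f\<close>, which
  do have the size \<open>M * h powr (3/2)\<close>. In the coordinates \<open>\<alpha>1, \<alpha>2\<close> (logarithms of the gains at the two lags)
  and \<open>\<beta> = \<kappa>' - \<kappa>\<close> one has \<open>f' = f * exp (\<alpha> - \<beta> * z)\<close>. Hence the left hand side is at least a constant times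
  \<open>M\<close> times the squared coordinates, the right hand side is at most a constant times the coordinates times the
  partial sums, and dividing gives \<open>least_squares_bound\<close>. These coordinates determine the parameter with
  Lipschitz constants (\<open>log_coordinates\<close>) because the ratio of \<open>psi \<theta> r\<close> and \<open>psi \<theta> (r / sqrt 2)\<close> is
  strictly monotone in \<open>\<theta>\<close>; this is where the second contrast is used.

  It remains to bound the second moments of the partial sums (\<open>quadratic_variation_concentration\<close>), that is,
  their variances and their means.

  Variance. For Gaussian variables it is twice a sum of squared covariances. Each covariance is a
  series over the modes in which time and space factorise. In time, the covariances of the increments of one
  mode are summable (\<open>sum_incr_corr_dist_le\<close>). In space, the grid vectors of all modes, weighted by the
  variances of their time increments, form an operator whose norm is controlled by duality from the elementary
  estimate \<open>sampling_inequality\<close> for continuously differentiable functions (\<open>sine_sampling_dual\<close>).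

  Mean. The second moment of a double increment is a time integral over \<open>[0, h^2]\<close> of a combination of
  five heat sums. Those at positions away from the boundary are \<open>-1/2\<close> up to a small error, by
  two summations by parts (\<open>heat_sum_off_diagonal\<close>). The remaining two are compared with Gaussian integrals by the
  trapezoid rule (\<open>heat_sum_trapezoid\<close>), and integrating these over time produces exactly \<open>h * psi \<theta>2 r\<close>
  (\<open>has_integral_psi\<close>). The bias is of relative order \<open>h^2\<close> and hence negligible.
\<close>

section \<open>Gaussian variables and the fourth moment formula\<close>

lemma gaussian_rv_moments:
  assumes P: "prob_space P" and g: "gaussian_rv P Y" and m0: "(\<integral>\<omega>. Y \<omega> \<partial>P) = 0"
  shows "integrable P (\<lambda>\<omega>. Y \<omega> ^ n)"
    and "(\<integral>\<omega>. Y \<omega> ^ 4 \<partial>P) = 3 * (\<integral>\<omega>. (Y \<omega>)\<^sup>2 \<partial>P)\<^sup>2"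
proof -
  interpret prob_space P by (rule P)
  have Ym[measurable]: "Y \<in> borel_measurable P" using g by (simp add: gaussian_rv_def)
  consider (n) \<mu> s where "s > 0" "distributed P lborel Y (\<lambda>x. ennreal (normal_density \<mu> s x))"
    | (c) \<mu> where "AE \<omega> in P. Y \<omega> = \<mu>"
    using g by (auto simp: gaussian_rv_def)
  then have "integrable P (\<lambda>\<omega>. Y \<omega> ^ n) \<and>
      (\<integral>\<omega>. Y \<omega> ^ 4 \<partial>P) = 3 * (\<integral>\<omega>. (Y \<omega>)\<^sup>2 \<partial>P)\<^sup>2"
  proof cases
    case n
    have "\<mu> = 0" using normal_distributed_expectation[OF n(1,2)] m0 by simp
    then have D: "distributed P lborel Y (\<lambda>x. ennreal (normal_density 0 s x))" using n by simp
    have int: "integrable P (\<lambda>\<omega>. Y \<omega> ^ k)" for k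
      using distributed_integrable[OF D, of "\<lambda>x. x ^ k"] integrable_normal_moment[OF n(1), of 0 k] by simp
    have mom: "(\<integral>\<omega>. Y \<omega> ^ k \<partial>P) = (\<integral>x. normal_density 0 s x * x ^ k \<partial>lborel)" for k
      using distributed_integral[OF D, of "\<lambda>x. x ^ k"] by simp
    have "(\<integral>\<omega>. Y \<omega> ^ 4 \<partial>P) = 3 * s ^ 4"
      using integral_normal_moment_even[OF n(1), of 0 2] n(1) mom[of 4]
      by (simp add: fact_numeral power_divide field_simps eval_nat_numeral)
    moreover have "(\<integral>\<omega>. (Y \<omega>)\<^sup>2 \<partial>P) = s\<^sup>2"
      using integral_normal_moment_even[OF n(1), of 0 1] n(1) mom[of 2]
      by (simp add: fact_numeral power_divide)
    ultimately show ?thesis using int by simp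
  next
    case c
    have "(\<integral>\<omega>. Y \<omega> \<partial>P) = (\<integral>\<omega>. \<mu> \<partial>P)" by (rule integral_cong_AE) (use c in auto)
    then have "\<mu> = 0" using m0 by (simp add: prob_space)
    then have z: "AE \<omega> in P. Y \<omega> = 0" using c by simp
    have "integrable P (\<lambda>\<omega>. Y \<omega> ^ k)" for k
      by (subst integrable_cong_AE[where g = "\<lambda>_. 0 ^ k"]) (use z in auto)
    moreover have "(\<integral>\<omega>. Y \<omega> ^ 4 \<partial>P) = (\<integral>\<omega>. 0 \<partial>P)" by (rule integral_cong_AE) (use z in auto)
    moreover have "(\<integral>\<omega>. (Y \<omega>)\<^sup>2 \<partial>P) = (\<integral>\<omega>. 0 \<partial>P)" by (rule integral_cong_AE) (use z in auto)
    ultimately show ?thesis by simp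
  qed
  then show "integrable P (\<lambda>\<omega>. Y \<omega> ^ n)"
    and "(\<integral>\<omega>. Y \<omega> ^ 4 \<partial>P) = 3 * (\<integral>\<omega>. (Y \<omega>)\<^sup>2 \<partial>P)\<^sup>2" by auto
qed

text \<open>
  The increments of a Gaussian field, and the sums and differences of increments that polarisation
  requires, lie in this span.
\<close>

definition linear_span :: "'i set \<Rightarrow> ('i \<Rightarrow> 'a \<Rightarrow> real) \<Rightarrow> ('a \<Rightarrow> real) set" where
  "linear_span S Z = {Y. \<exists>F c. finite F \<and> F \<subseteq> S \<and> Y = (\<lambda>\<omega>. \<Sum>p\<in>F. c p * Z p \<omega>)}"

lemma linear_span_base: "p \<in> S \<Longrightarrow> Z p \<in> linear_span S Z"
  unfolding linear_span_def by (intro CollectI exI[of _ "{p}"] exI[of _ "\<lambda>_. 1"]) auto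

lemma linear_span_scale: "Y \<in> linear_span S Z \<Longrightarrow> (\<lambda>\<omega>. a * Y \<omega>) \<in> linear_span S Z"
  unfolding linear_span_def
  apply (elim CollectE exE conjE)
  subgoal for F c
    by (intro CollectI exI[of _ F] exI[of _ "\<lambda>p. a * c p"]) (auto simp: sum_distrib_left mult.assoc)
  done

lemma linear_span_add:
  assumes "Y \<in> linear_span S Z" "Y' \<in> linear_span S Z"
  shows "(\<lambda>\<omega>. Y \<omega> + Y' \<omega>) \<in> linear_span S Z"
proof -
  obtain F c where F: "finite F" "F \<subseteq> S" "Y = (\<lambda>\<omega>. \<Sum>p\<in>F. c p * Z p \<omega>)"
    using assms(1) by (auto simp: linear_span_def)
  obtain F' c' where F': "finite F'" "F' \<subseteq> S" "Y' = (\<lambda>\<omega>. \<Sum>p\<in>F'. c' p * Z p \<omega>)"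
    using assms(2) by (auto simp: linear_span_def)
  let ?c = "\<lambda>p. (if p \<in> F then c p else 0) + (if p \<in> F' then c' p else 0)"
  have "(\<Sum>p\<in>F \<union> F'. ?c p * Z p \<omega>) = Y \<omega> + Y' \<omega>" for \<omega>
  proof -
    have "(\<Sum>p\<in>F \<union> F'. ?c p * Z p \<omega>) =
       (\<Sum>p\<in>F \<union> F'. if p \<in> F then c p * Z p \<omega> else 0) + (\<Sum>p\<in>F \<union> F'. if p \<in> F' then c' p * Z p \<omega> else 0)"
      by (subst sum.distrib[symmetric]) (intro sum.cong, auto simp: algebra_simps)
    also have "\<dots> = Y \<omega> + Y' \<omega>"
      using F(1) F'(1)
      by (simp add: F(3) F'(3) sum.inter_restrict[symmetric] Int_absorb1 Int_commute Un_Int_distrib)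
    finally show ?thesis .
  qed
  then show ?thesis using F F' unfolding linear_span_def
    by (intro CollectI exI[of _ "F \<union> F'"] exI[of _ ?c]) auto
qed

lemma linear_span_diff:
  assumes "Y \<in> linear_span S Z" "Y' \<in> linear_span S Z"
  shows "(\<lambda>\<omega>. Y \<omega> - Y' \<omega>) \<in> linear_span S Z"
  using linear_span_add[OF assms(1) linear_span_scale[OF assms(2), of "-1"]] by simp

locale centred_gaussian_field = prob_space P for P :: "'a measure" +
  fixes S :: "'i set" and Z :: "'i \<Rightarrow> 'a \<Rightarrow> real"
  assumes gauss: "gaussian_field P S Z"
    and centred: "\<And>p. p \<in> S \<Longrightarrow> (\<integral>\<omega>. Z p \<omega> \<partial>P) = 0"
begin

abbreviation "V \<equiv> linear_span S Z"

lemma span_gaussian: "Y \<in> V \<Longrightarrow> gaussian_rv P Y"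
  using gauss unfolding linear_span_def gaussian_field_def by auto

lemma base_integrable: "p \<in> S \<Longrightarrow> integrable P (Z p)"
  using gaussian_rv_moments(1)[OF prob_space_axioms span_gaussian[OF linear_span_base] centred, of p 1]
  by simp

lemma span_centred: assumes "Y \<in> V" shows "(\<integral>\<omega>. Y \<omega> \<partial>P) = 0"
proof -
  obtain F c where F: "finite F" "F \<subseteq> S" "Y = (\<lambda>\<omega>. \<Sum>p\<in>F. c p * Z p \<omega>)"
    using assms by (auto simp: linear_span_def)
  have "(\<integral>\<omega>. Y \<omega> \<partial>P) = (\<Sum>p\<in>F. c p * (\<integral>\<omega>. Z p \<omega> \<partial>P))"
    unfolding F(3) using F(2) base_integrable by (subst Bochner_Integration.integral_sum) auto
  also have "\<dots> = 0" using F(2) centred by (intro sum.neutral) auto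
  finally show ?thesis .
qed

lemma span_measurable: "Y \<in> V \<Longrightarrow> Y \<in> borel_measurable P"
  using span_gaussian by (auto simp: gaussian_rv_def)

lemma span_power_integrable: "Y \<in> V \<Longrightarrow> integrable P (\<lambda>\<omega>. Y \<omega> ^ n)"
  using gaussian_rv_moments(1)[OF prob_space_axioms span_gaussian span_centred] by blast

lemma span_fourth: "Y \<in> V \<Longrightarrow> (\<integral>\<omega>. Y \<omega> ^ 4 \<partial>P) = 3 * (\<integral>\<omega>. (Y \<omega>)\<^sup>2 \<partial>P)\<^sup>2"
  using gaussian_rv_moments(2)[OF prob_space_axioms span_gaussian span_centred] by blast

lemma span_mult_integrable:
  assumes "Y \<in> V" "Y' \<in> V" shows "integrable P (\<lambda>\<omega>. Y \<omega> * Y' \<omega>)"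
proof -
  have eq: "(\<lambda>\<omega>. Y \<omega> * Y' \<omega>) = (\<lambda>\<omega>. ((Y \<omega> + Y' \<omega>)\<^sup>2 - (Y \<omega> - Y' \<omega>)\<^sup>2) / 4)"
    by (auto simp: power2_eq_square algebra_simps)
  show ?thesis unfolding eq
    using span_power_integrable[OF linear_span_add[OF assms], of 2]
      span_power_integrable[OF linear_span_diff[OF assms], of 2] by auto
qed

text \<open>
  Polarisation: \<open>12 a^2 b^2 = (a + b)^4 + (a - b)^4 - 2 a^4 - 2 b^4\<close>. Every fourth power on the right is that of
  a centred Gaussian variable, hence has expectation three times the squared variance.
\<close>

lemma isserlis_squares:
  assumes Y: "Y \<in> V" and Y': "Y' \<in> V"
  shows "integrable P (\<lambda>\<omega>. (Y \<omega>)\<^sup>2 * (Y' \<omega>)\<^sup>2)"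
    and "(\<integral>\<omega>. (Y \<omega>)\<^sup>2 * (Y' \<omega>)\<^sup>2 \<partial>P) =
       (\<integral>\<omega>. (Y \<omega>)\<^sup>2 \<partial>P) * (\<integral>\<omega>. (Y' \<omega>)\<^sup>2 \<partial>P) + 2 * (\<integral>\<omega>. Y \<omega> * Y' \<omega> \<partial>P)\<^sup>2"
proof -
  let ?p = "\<lambda>\<omega>. Y \<omega> + Y' \<omega>" and ?m = "\<lambda>\<omega>. Y \<omega> - Y' \<omega>"
  have p: "?p \<in> V" and m: "?m \<in> V" using linear_span_add[OF assms] linear_span_diff[OF assms] by auto
  have eq: "(\<lambda>\<omega>. (Y \<omega>)\<^sup>2 * (Y' \<omega>)\<^sup>2) =
     (\<lambda>\<omega>. (?p \<omega> ^ 4 + ?m \<omega> ^ 4 - 2 * Y \<omega> ^ 4 - 2 * Y' \<omega> ^ 4) / 12)"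
    by (rule ext) (simp add: eval_nat_numeral algebra_simps)
  note i = span_power_integrable[OF p, of 4] span_power_integrable[OF m, of 4]
    span_power_integrable[OF Y, of 4] span_power_integrable[OF Y', of 4]
    span_power_integrable[OF Y, of 2] span_power_integrable[OF Y', of 2] span_mult_integrable[OF assms]
  show "integrable P (\<lambda>\<omega>. (Y \<omega>)\<^sup>2 * (Y' \<omega>)\<^sup>2)" unfolding eq using i by auto
  let ?a = "\<integral>\<omega>. (Y \<omega>)\<^sup>2 \<partial>P" and ?b = "\<integral>\<omega>. (Y' \<omega>)\<^sup>2 \<partial>P" and ?c = "\<integral>\<omega>. Y \<omega> * Y' \<omega> \<partial>P"
  have p2: "(\<integral>\<omega>. (?p \<omega>)\<^sup>2 \<partial>P) = ?a + ?b + 2 * ?c"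
  proof -
    have "(\<lambda>\<omega>. (?p \<omega>)\<^sup>2) = (\<lambda>\<omega>. (Y \<omega>)\<^sup>2 + (Y' \<omega>)\<^sup>2 + 2 * (Y \<omega> * Y' \<omega>))"
      by (simp add: power2_sum mult.assoc)
    then show ?thesis using i by simp
  qed
  have m2: "(\<integral>\<omega>. (?m \<omega>)\<^sup>2 \<partial>P) = ?a + ?b - 2 * ?c"
  proof -
    have "(\<lambda>\<omega>. (?m \<omega>)\<^sup>2) = (\<lambda>\<omega>. (Y \<omega>)\<^sup>2 + (Y' \<omega>)\<^sup>2 - 2 * (Y \<omega> * Y' \<omega>))"
      by (simp add: power2_diff mult.assoc)
    then show ?thesis using i by simp
  qed
  have "(\<integral>\<omega>. (Y \<omega>)\<^sup>2 * (Y' \<omega>)\<^sup>2 \<partial>P) =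
     (3 * (?a + ?b + 2 * ?c)\<^sup>2 + 3 * (?a + ?b - 2 * ?c)\<^sup>2 - 2 * (3 * ?a\<^sup>2) - 2 * (3 * ?b\<^sup>2)) / 12"
    unfolding eq using i span_fourth[OF p] span_fourth[OF m] span_fourth[OF Y] span_fourth[OF Y']
    by (simp add: p2 m2)
  also have "\<dots> = ?a * ?b + 2 * ?c\<^sup>2" by (simp add: power2_eq_square algebra_simps)
  finally show "(\<integral>\<omega>. (Y \<omega>)\<^sup>2 * (Y' \<omega>)\<^sup>2 \<partial>P) = ?a * ?b + 2 * ?c\<^sup>2" .
qed

text \<open>
  Splitting into variance and squared bias around an arbitrary centre \<open>c\<close>.
\<close>

lemma second_moment_square_sum:
  assumes V: "\<And>p. p \<in> F \<Longrightarrow> D p \<in> V" and F: "finite F"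
  shows "integrable P (\<lambda>\<omega>. ((\<Sum>p\<in>F. (D p \<omega>)\<^sup>2) - c)\<^sup>2)"
    and "(\<integral>\<omega>. ((\<Sum>p\<in>F. (D p \<omega>)\<^sup>2) - c)\<^sup>2 \<partial>P) =
       2 * (\<Sum>p\<in>F. \<Sum>q\<in>F. (\<integral>\<omega>. D p \<omega> * D q \<omega> \<partial>P)\<^sup>2) + ((\<Sum>p\<in>F. \<integral>\<omega>. (D p \<omega>)\<^sup>2 \<partial>P) - c)\<^sup>2"
proof -
  have eq: "(\<lambda>\<omega>. ((\<Sum>p\<in>F. (D p \<omega>)\<^sup>2) - c)\<^sup>2) =
    (\<lambda>\<omega>. (\<Sum>p\<in>F. \<Sum>q\<in>F. (D p \<omega>)\<^sup>2 * (D q \<omega>)\<^sup>2) - 2 * c * (\<Sum>p\<in>F. (D p \<omega>)\<^sup>2) + c\<^sup>2)"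
    by (rule ext) (simp add: power2_diff sum_product[symmetric], simp add: power2_eq_square)
  have i: "integrable P (\<lambda>\<omega>. (D p \<omega>)\<^sup>2 * (D q \<omega>)\<^sup>2)" "integrable P (\<lambda>\<omega>. (D p \<omega>)\<^sup>2)" if "p \<in> F" "q \<in> F" for p q
    using isserlis_squares(1)[OF V V] span_power_integrable[OF V] that by auto
  have i1: "integrable P (\<lambda>\<omega>. \<Sum>p\<in>F. \<Sum>q\<in>F. (D p \<omega>)\<^sup>2 * (D q \<omega>)\<^sup>2)"
    by (intro Bochner_Integration.integrable_sum i)
  have i2: "integrable P (\<lambda>\<omega>. \<Sum>p\<in>F. (D p \<omega>)\<^sup>2)"
    by (intro Bochner_Integration.integrable_sum i) 
  show "integrable P (\<lambda>\<omega>. ((\<Sum>p\<in>F. (D p \<omega>)\<^sup>2) - c)\<^sup>2)" unfolding eq using i1 i2 by auto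
  let ?m = "\<lambda>p. \<integral>\<omega>. (D p \<omega>)\<^sup>2 \<partial>P" and ?c = "\<lambda>p q. \<integral>\<omega>. D p \<omega> * D q \<omega> \<partial>P"
  have "(\<integral>\<omega>. (\<Sum>p\<in>F. \<Sum>q\<in>F. (D p \<omega>)\<^sup>2 * (D q \<omega>)\<^sup>2) \<partial>P) = (\<Sum>p\<in>F. \<Sum>q\<in>F. ?m p * ?m q + 2 * (?c p q)\<^sup>2)"
    using i by (simp add: Bochner_Integration.integral_sum isserlis_squares(2) V)
  also have "\<dots> = (\<Sum>p\<in>F. ?m p)\<^sup>2 + 2 * (\<Sum>p\<in>F. \<Sum>q\<in>F. (?c p q)\<^sup>2)"
    by (simp add: sum.distrib sum_distrib_left[symmetric] sum_product power2_eq_square[of "sum _ _"])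
  finally have e1: "(\<integral>\<omega>. (\<Sum>p\<in>F. \<Sum>q\<in>F. (D p \<omega>)\<^sup>2 * (D q \<omega>)\<^sup>2) \<partial>P) = \<dots>" .
  have e2: "(\<integral>\<omega>. (\<Sum>p\<in>F. (D p \<omega>)\<^sup>2) \<partial>P) = (\<Sum>p\<in>F. ?m p)"
    using i by (simp add: Bochner_Integration.integral_sum)
  show "(\<integral>\<omega>. ((\<Sum>p\<in>F. (D p \<omega>)\<^sup>2) - c)\<^sup>2 \<partial>P) =
       2 * (\<Sum>p\<in>F. \<Sum>q\<in>F. (?c p q)\<^sup>2) + ((\<Sum>p\<in>F. ?m p) - c)\<^sup>2"
    unfolding eq using i1 i2 e1 e2 by (simp add: prob_space power2_diff)
qed

end

section \<open>Sampling of sine polynomials\<close>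

lemma abs_exp_minus_one_le: "\<bar>exp u - 1\<bar> \<le> \<bar>u\<bar> * exp \<bar>u :: real\<bar>"
proof (cases "u \<ge> 0")
  case True
  have "1 - u \<le> exp (- u)" using exp_ge_add_one_self[of "- u"] by simp
  then have "(1 - u) * exp u \<le> exp (- u) * exp u" by (intro mult_right_mono) auto
  then show ?thesis using True by (simp add: algebra_simps flip: exp_add)
next
  case False
  have "1 - exp u \<le> \<bar>u\<bar> * 1" using exp_ge_add_one_self[of u] False by linarith
  also have "\<dots> \<le> \<bar>u\<bar> * exp \<bar>u\<bar>" by (intro mult_left_mono) auto
  finally show ?thesis using False by simp
qed

lemma abs_exp_minus_one_ge: "\<bar>x\<bar> * exp (- \<bar>x\<bar>) \<le> \<bar>exp x - 1 :: real\<bar>"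
proof (cases "x \<ge> 0")
  case True
  have "x * exp (- x) \<le> x * 1" using True by (intro mult_left_mono) auto
  also have "\<dots> \<le> exp x - 1" using exp_ge_add_one_self[of x] by linarith
  finally show ?thesis using True by simp
next
  case False
  have "(- x) * exp x \<le> (exp (- x) - 1) * exp x" using exp_ge_add_one_self[of "- x"] by (intro mult_right_mono) auto
  also have "\<dots> = 1 - exp x" by (simp add: left_diff_distrib flip: exp_add)
  finally show ?thesis using False by simp
qed

text \<open>
  The exponential tilt \<open>exp (- \<kappa> * z)\<close> of the eigenfunctions and of the mean functions is harmless on the unit interval.
\<close>

lemma exp_tilt_bounds:
  fixes \<kappa> z :: real
  assumes "0 \<le> z" "z \<le> 1"
  shows "exp (- \<kappa> * z) \<le> exp \<bar>\<kappa>\<bar>" "exp (- \<bar>\<kappa>\<bar>) \<le> exp (- \<kappa> * z)"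
proof -
  have "\<bar>\<kappa> * z\<bar> \<le> \<bar>\<kappa>\<bar> * 1" unfolding abs_mult using assms by (intro mult_left_mono) auto
  then show "exp (- \<kappa> * z) \<le> exp \<bar>\<kappa>\<bar>" "exp (- \<bar>\<kappa>\<bar>) \<le> exp (- \<kappa> * z)" by (auto simp: abs_le_iff)
qed

text \<open>
  The terms are at most \<open>2 / (1 + \<alpha> * l)^2\<close>, and these are dominated by a telescoping series.
\<close>

lemma sum_inverse_square_le:
  fixes \<alpha> :: real
  assumes "\<alpha> > 0"
  shows "(\<Sum>l<L. 1 / (1 + \<alpha>\<^sup>2 * (real (Suc l))\<^sup>2)) \<le> 2 / \<alpha>"
proof -
  have "(\<Sum>l<L. 1 / (1 + \<alpha>\<^sup>2 * (real (Suc l))\<^sup>2)) \<le>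
      (\<Sum>l<L. 2 / \<alpha> * (1 / (1 + \<alpha> * real l) - 1 / (1 + \<alpha> * real (Suc l))))"
  proof (rule sum_mono)
    fix l
    have p: "1 + \<alpha> * real l > 0" "1 + \<alpha> * real (Suc l) > 0"
      using assms by (auto intro!: add_pos_nonneg)
    have "2 / \<alpha> * (1 / (1 + \<alpha> * real l) - 1 / (1 + \<alpha> * real (Suc l)))
       = 2 / ((1 + \<alpha> * real l) * (1 + \<alpha> * real (Suc l)))"
      using p assms by (simp add: field_simps)
    also have "\<dots> \<ge> 2 / ((1 + \<alpha> * real (Suc l)) * (1 + \<alpha> * real (Suc l)))"
      using p assms by (intro divide_left_mono mult_right_mono) auto
    also have "2 / ((1 + \<alpha> * real (Suc l)) * (1 + \<alpha> * real (Suc l)))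
        \<ge> 2 / (2 * (1 + \<alpha>\<^sup>2 * (real (Suc l))\<^sup>2))"
    proof (intro divide_left_mono)
      have "0 \<le> (1 - \<alpha> * real (Suc l))\<^sup>2" by simp
      then show "(1 + \<alpha> * real (Suc l)) * (1 + \<alpha> * real (Suc l)) \<le> 2 * (1 + \<alpha>\<^sup>2 * (real (Suc l))\<^sup>2)"
        by (simp add: power2_eq_square algebra_simps)
      have "0 < 1 + \<alpha>\<^sup>2 * (real (Suc l))\<^sup>2" by (intro add_pos_nonneg) auto
      then show "0 < (2 * (1 + \<alpha>\<^sup>2 * (real (Suc l))\<^sup>2)) * ((1 + \<alpha> * real (Suc l)) * (1 + \<alpha> * real (Suc l)))"
        using p by (intro mult_pos_pos) auto
    qed auto
    also have "2 / (2 * (1 + \<alpha>\<^sup>2 * (real (Suc l))\<^sup>2)) = 1 / (1 + \<alpha>\<^sup>2 * (real (Suc l))\<^sup>2)"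
      by (rule mult_divide_mult_cancel_left[of 2 1, simplified mult_1_right]) simp
    finally show "1 / (1 + \<alpha>\<^sup>2 * (real (Suc l))\<^sup>2)
      \<le> 2 / \<alpha> * (1 / (1 + \<alpha> * real l) - 1 / (1 + \<alpha> * real (Suc l)))" .
  qed
  also have "\<dots> = 2 / \<alpha> * (1 - 1 / (1 + \<alpha> * real L))"
    unfolding sum_distrib_left[symmetric] by (subst sum_lessThan_telescope') simp
  also have "\<dots> \<le> 2 / \<alpha> * 1"
    using assms by (intro mult_left_mono) auto
  finally show ?thesis by simp
qed

text \<open>
  About \<open>1 / h\<close> modes have weight \<open>h^2\<close>; beyond them the weights decay quadratically.
\<close>

lemma sum_min_square_le:
  fixes h \<mu> :: real
  assumes h: "h > 0" and l0: "\<mu> > 0"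
    and c: "\<And>l. c l \<le> h\<^sup>2" "\<And>l. \<mu> * (real (Suc l))\<^sup>2 * c l \<le> 1"
  shows "(\<Sum>l<L. c l) \<le> 4 * h / sqrt \<mu>"
proof -
  define \<alpha> where "\<alpha> = h * sqrt \<mu>"
  have \<alpha>: "\<alpha> > 0" "\<alpha>\<^sup>2 = h\<^sup>2 * \<mu>" using h l0 by (auto simp: \<alpha>_def power_mult_distrib)
  have "(\<Sum>l<L. c l) \<le> (\<Sum>l<L. 2 * h\<^sup>2 * (1 / (1 + \<alpha>\<^sup>2 * (real (Suc l))\<^sup>2)))"
  proof (rule sum_mono)
    fix l
    have "0 < 1 + \<alpha>\<^sup>2 * (real (Suc l))\<^sup>2" by (intro add_pos_nonneg) auto
    moreover have "c l * (1 + \<alpha>\<^sup>2 * (real (Suc l))\<^sup>2) \<le> 2 * h\<^sup>2"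
    proof -
      have "h\<^sup>2 * (\<mu> * (real (Suc l))\<^sup>2 * c l) \<le> h\<^sup>2 * 1" using c(2)[of l] by (intro mult_left_mono) auto
      then show ?thesis using c(1)[of l] unfolding \<alpha>(2) by (simp add: algebra_simps)
    qed
    ultimately show "c l \<le> 2 * h\<^sup>2 * (1 / (1 + \<alpha>\<^sup>2 * (real (Suc l))\<^sup>2))" by (simp add: pos_le_divide_eq)
  qed
  also have "\<dots> \<le> 2 * h\<^sup>2 * (2 / \<alpha>)"
    unfolding sum_distrib_left[symmetric] by (intro mult_left_mono sum_inverse_square_le \<alpha>) auto
  also have "\<dots> = 4 * h / sqrt \<mu>" using h by (simp add: \<alpha>_def field_simps power2_eq_square)
  finally show ?thesis .
qed

text \<open>
  A matrix and its transpose have the same operator norm.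
\<close>

lemma duality_principle:
  fixes s :: "nat \<Rightarrow> nat \<Rightarrow> real"
  assumes B: "B \<ge> 0"
    and le: "\<And>b. (\<Sum>k<m. (\<Sum>l<L. b l * s l k)\<^sup>2) \<le> B * (\<Sum>l<L. (b l)\<^sup>2)"
  shows "(\<Sum>l<L. (\<Sum>k<m. a k * s l k)\<^sup>2) \<le> B * (\<Sum>k<m. (a k)\<^sup>2)"
proof -
  define b where "b l = (\<Sum>k<m. a k * s l k)" for l
  define X where "X = (\<Sum>l<L. (b l)\<^sup>2)"
  define A where "A = (\<Sum>k<m. (a k)\<^sup>2)"
  have X0: "X \<ge> 0" and A0: "A \<ge> 0" by (auto simp: X_def A_def sum_nonneg)
  have "X = (\<Sum>l<L. \<Sum>k<m. b l * (a k * s l k))"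
    by (simp add: X_def power2_eq_square b_def sum_distrib_left)
  also have "\<dots> = (\<Sum>k<m. \<Sum>l<L. b l * (a k * s l k))" by (rule sum.swap)
  also have "\<dots> = (\<Sum>k<m. a k * (\<Sum>l<L. b l * s l k))"
    by (simp add: sum_distrib_left algebra_simps)
  finally have X: "X = \<dots>" .
  \<comment> \<open>The hypothesis is applied to the coefficients \<open>b\<close> produced by \<open>a\<close> itself.\<close>
  have "X\<^sup>2 \<le> A * (\<Sum>k<m. (\<Sum>l<L. b l * s l k)\<^sup>2)"
    unfolding X A_def by (rule Cauchy_Schwarz_ineq_sum)
  also have "\<dots> \<le> A * (B * X)" unfolding X_def by (intro mult_left_mono le A0)
  finally have "X * X \<le> (B * A) * X" by (simp add: power2_eq_square algebra_simps)
  then have "X \<le> B * A" using X0 B A0 by (cases "X = 0") auto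
  then show ?thesis by (simp add: X_def A_def b_def)
qed

lemma has_integral_antiderivative:
  assumes "a \<le> b" "\<And>x. (F has_real_derivative f x) (at x)"
  shows "(f has_integral (F b - F a)) {a..b}"
  by (rule fundamental_theorem_of_calculus[OF assms(1)])
    (meson assms(2) has_real_derivative_iff_has_vector_derivative has_vector_derivative_at_within)

text \<open>
  Point values are controlled by the energies of \<open>f\<close> and \<open>f'\<close> on one cell: integrate the derivative of
  \<open>(1 - (x - a) / \<delta>) * (f x)^2\<close>, which vanishes at the right end of the cell, and split the product
  \<open>2 * f * f'\<close> by the inequality between arithmetic and geometric mean.
\<close>

lemma sampling_inequality:
  fixes f f' :: "real \<Rightarrow> real"
  assumes d: "\<delta> > 0"
    and f: "\<And>x. (f has_real_derivative f' x) (at x)" and f': "continuous_on UNIV f'"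
  shows "(f a)\<^sup>2 \<le> integral {a..a+\<delta>} (\<lambda>x. 2 / \<delta> * (f x)\<^sup>2 + \<delta> * (f' x)\<^sup>2)"
proof -
  have fc: "continuous_on S f" for S
    using f by (meson DERIV_isCont continuous_at_imp_continuous_on)
  have f'c: "continuous_on S f'" for S using f' continuous_on_subset by blast
  define u where "u x = - (1 - (x - a) / \<delta>) * (f x)\<^sup>2" for x
  define u' where "u' x = (f x)\<^sup>2 / \<delta> - (1 - (x - a) / \<delta>) * (2 * f x * f' x)" for x
  have "(u' has_integral (u (a + \<delta>) - u a)) {a..a+\<delta>}"
  proof (rule has_integral_antiderivative)
    show "(u has_real_derivative u' x) (at x)" for x
      unfolding u_def u'_def using d by (auto intro!: derivative_eq_intros f simp: power2_eq_square field_simps)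
  qed (use d in auto)
  then have i1: "(u' has_integral (f a)\<^sup>2) {a..a+\<delta>}" using d by (simp add: u_def)
  have i2: "((\<lambda>x. 2 / \<delta> * (f x)\<^sup>2 + \<delta> * (f' x)\<^sup>2) has_integral
      integral {a..a+\<delta>} (\<lambda>x. 2 / \<delta> * (f x)\<^sup>2 + \<delta> * (f' x)\<^sup>2)) {a..a+\<delta>}"
    by (intro integrable_integral integrable_continuous_real continuous_intros fc f'c)
  show ?thesis
  proof (rule has_integral_le[OF i1 i2])
    fix x assume x: "x \<in> {a..a+\<delta>}"
    let ?t = "1 - (x - a) / \<delta>"
    have t: "0 \<le> ?t" "?t \<le> 1" using x d by (auto simp: field_simps)
    have "- ?t * (2 * f x * f' x) \<le> \<bar>?t\<bar> * \<bar>2 * f x * f' x\<bar>"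
      by (metis abs_ge_self abs_minus_cancel abs_mult)
    also have "\<dots> \<le> 1 * \<bar>2 * f x * f' x\<bar>" using t by (intro mult_right_mono) auto
    also have "\<dots> \<le> (f x)\<^sup>2 / \<delta> + \<delta> * (f' x)\<^sup>2"
    proof -
      have "0 \<le> (\<bar>f x\<bar> - \<delta> * \<bar>f' x\<bar>)\<^sup>2 / \<delta>" using d by simp
      also have "\<dots> = (f x)\<^sup>2 / \<delta> + \<delta> * (f' x)\<^sup>2 - \<bar>2 * f x * f' x\<bar>"
        using d by (simp add: power2_diff power_mult_distrib abs_mult field_simps) (simp add: power2_eq_square algebra_simps)
      finally show ?thesis by simp
    qed
    finally have "- ?t * (2 * f x * f' x) \<le> (f x)\<^sup>2 / \<delta> + \<delta> * (f' x)\<^sup>2" .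
    then have "u' x \<le> (f x)\<^sup>2 / \<delta> + ((f x)\<^sup>2 / \<delta> + \<delta> * (f' x)\<^sup>2)"
      unfolding u'_def by (simp only: diff_conv_add_uminus mult_minus_left add_left_mono)
    then show "u' x \<le> 2 / \<delta> * (f x)\<^sup>2 + \<delta> * (f' x)\<^sup>2" by simp
  qed
qed

lemma has_integral_cos_period:
  "((\<lambda>x. cos (pi * of_int k * x)) has_integral (if k = 0 then 2 else 0)) {0..2::real}"
proof (cases "k = 0")
  case True
  then show ?thesis using has_integral_const_real[of "1::real" 0 2] by simp
next
  case False
  have "((\<lambda>x. cos (pi * of_int k * x)) has_integral
      (sin (pi * of_int k * 2) / (pi * of_int k) - sin (pi * of_int k * 0) / (pi * of_int k))) {0..2::real}"
    using False by (intro has_integral_antiderivative) (auto intro!: derivative_eq_intros)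
  moreover have "sin (pi * of_int k * 2) = 0"
    using sin_integer_2pi[of "of_int k"] by (simp add: mult_ac)
  ultimately show ?thesis using False by simp
qed

lemma has_integral_sin_sin:
  "((\<lambda>x. sin (pi * real (Suc l) * x) * sin (pi * real (Suc m) * x)) has_integral (if l = m then 1 else 0)) {0..2}"
proof -
  have "((\<lambda>x. (cos (pi * of_int (int l - int m) * x) - cos (pi * of_int (int l + int m + 2) * x)) / 2) has_integral
     (((if int l - int m = 0 then 2 else 0) - (if int l + int m + 2 = 0 then 2 else 0)) / 2)) {0..2::real}"
    by (intro has_integral_divide has_integral_diff has_integral_cos_period)
  moreover have "((if int l - int m = 0 then 2 else 0) - (if int l + int m + 2 = 0 then 2 else 0)) / 2 = (if l = m then 1 else (0::real))"
    by auto
  ultimately show ?thesis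
    by (simp add: sin_times_sin algebra_simps)
qed

lemma has_integral_cos_cos:
  "((\<lambda>x. cos (pi * real (Suc l) * x) * cos (pi * real (Suc m) * x)) has_integral (if l = m then 1 else 0)) {0..2}"
proof -
  have "((\<lambda>x. (cos (pi * of_int (int l - int m) * x) + cos (pi * of_int (int l + int m + 2) * x)) / 2) has_integral
     (((if int l - int m = 0 then 2 else 0) + (if int l + int m + 2 = 0 then 2 else 0)) / 2)) {0..2::real}"
    by (intro has_integral_divide has_integral_add has_integral_cos_period)
  moreover have "((if int l - int m = 0 then 2 else 0) + (if int l + int m + 2 = 0 then 2 else 0)) / 2 = (if l = m then 1 else (0::real))"
    by auto
  ultimately show ?thesis
    by (simp add: cos_times_cos algebra_simps)
qed

lemma has_integral_square_orthonormal:
  fixes \<phi> :: "nat \<Rightarrow> real \<Rightarrow> real"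
  assumes "\<And>l m. ((\<lambda>x. \<phi> l x * \<phi> m x) has_integral (if l = m then 1 else 0)) I"
  shows "((\<lambda>x. (\<Sum>l<L. b l * \<phi> l x)\<^sup>2) has_integral (\<Sum>l<L. (b l)\<^sup>2)) I"
proof -
  have "((\<lambda>x. \<Sum>l<L. \<Sum>m<L. (b l * b m) * (\<phi> l x * \<phi> m x)) has_integral
      (\<Sum>l<L. \<Sum>m<L. (b l * b m) * (if l = m then 1 else 0))) I"
    by (intro has_integral_sum has_integral_mult_right assms) auto
  moreover have "(\<Sum>l<L. \<Sum>m<L. (b l * b m) * (if l = m then 1 else 0)) = (\<Sum>l<L. (b l)\<^sup>2)"
    by (intro sum.cong refl) (simp add: power2_eq_square if_distrib[of "\<lambda>z. _ * z"] cong: if_cong)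
  moreover have "(\<lambda>x. \<Sum>l<L. \<Sum>m<L. (b l * b m) * (\<phi> l x * \<phi> m x)) = (\<lambda>x. (\<Sum>l<L. b l * \<phi> l x)\<^sup>2)"
    by (rule ext) (simp add: power2_eq_square sum_product algebra_simps)
  ultimately show ?thesis by simp
qed

lemma sum_integral_adjacent:
  fixes g :: "real \<Rightarrow> real"
  assumes g: "continuous_on UNIV g" and d: "\<delta> \<ge> 0"
  shows "(\<Sum>k<m. integral {a + real k * \<delta>..a + real k * \<delta> + \<delta>} g) = integral {a..a + real m * \<delta>} g"
proof (induction m)
  case (Suc m)
  have "integral {a..a + real m * \<delta>} g + integral {a + real m * \<delta>..a + real (Suc m) * \<delta>} g
      = integral {a..a + real (Suc m) * \<delta>} g"
    using d by (intro Henstock_Kurzweil_Integration.integral_combine integrable_continuous_real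
        continuous_on_subset[OF g]) (auto simp: algebra_simps)
  then show ?case using Suc by (simp add: algebra_simps)
qed simp

text \<open>
  The cells of the grid are disjoint, so the sampling inequalities add up to energies over the whole period
  \<open>[0, 2]\<close>, where sines and cosines are orthonormal. A full period is used because the last cell
  may leave the unit interval. The weights enter through bounds \<open>A\<close> and \<open>A'\<close> for the two energies.
\<close>

lemma sine_sampling:
  fixes c b :: "nat \<Rightarrow> real"
  assumes d: "\<delta> > 0" and a: "0 \<le> a" "a + real m * \<delta> \<le> 2"
    and c: "\<And>l. 0 \<le> c l" "\<And>l. c l \<le> A" "\<And>l. (real (Suc l))\<^sup>2 * c l \<le> A'"
  shows "(\<Sum>k<m. (\<Sum>l<L. b l * (sqrt (c l) * sin (pi * real (Suc l) * (a + real k * \<delta>))))\<^sup>2)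
     \<le> (2 / \<delta> * A + \<delta> * pi\<^sup>2 * A') * (\<Sum>l<L. (b l)\<^sup>2)"
proof -
  define f where "f x = (\<Sum>l<L. (b l * sqrt (c l)) * sin (pi * real (Suc l) * x))" for x
  define f' where "f' x = (\<Sum>l<L. (b l * sqrt (c l) * (pi * real (Suc l))) * cos (pi * real (Suc l) * x))" for x
  have df: "(f has_real_derivative f' x) (at x)" for x
  proof -
    have "((\<lambda>x. (b l * sqrt (c l)) * sin (pi * real (Suc l) * x)) has_real_derivative
        (b l * sqrt (c l) * (pi * real (Suc l))) * cos (pi * real (Suc l) * x)) (at x)" for l
      by (auto intro!: derivative_eq_intros)
    then show ?thesis unfolding f_def f'_def by (intro DERIV_sum) auto
  qed
  have cf': "continuous_on UNIV f'" unfolding f'_def by (intro continuous_intros)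
  have cf: "continuous_on UNIV f" unfolding f_def by (intro continuous_intros)
  define g where "g x = 2 / \<delta> * (f x)\<^sup>2 + \<delta> * (f' x)\<^sup>2" for x
  have cg: "continuous_on UNIV g" unfolding g_def by (intro continuous_intros cf cf')
  have g0: "g x \<ge> 0" for x using d by (simp add: g_def)
  have "(\<Sum>k<m. (f (a + real k * \<delta>))\<^sup>2) \<le> (\<Sum>k<m. integral {a + real k * \<delta>..a + real k * \<delta> + \<delta>} g)"
    unfolding g_def by (intro sum_mono sampling_inequality[OF d df cf'])
  also have "\<dots> = integral {a..a + real m * \<delta>} g" using d by (intro sum_integral_adjacent cg) auto
  also have "\<dots> \<le> integral {0..2} g"
    using a d g0 by (intro integral_subset_le integrable_continuous_real continuous_on_subset[OF cg]) auto
  also have "\<dots> = 2 / \<delta> * (\<Sum>l<L. (b l * sqrt (c l))\<^sup>2) + \<delta> * (\<Sum>l<L. (b l * sqrt (c l) * (pi * real (Suc l)))\<^sup>2)"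
    unfolding g_def f_def f'_def
    by (intro integral_unique has_integral_add has_integral_mult_right has_integral_square_orthonormal
        has_integral_sin_sin has_integral_cos_cos)
  also have "\<dots> = (\<Sum>l<L. (b l)\<^sup>2 * (2 / \<delta> * c l + \<delta> * pi\<^sup>2 * ((real (Suc l))\<^sup>2 * c l)))"
    using c(1) by (simp add: sum_distrib_left sum.distrib[symmetric] power_mult_distrib algebra_simps del: of_nat_Suc)
  also have "\<dots> \<le> (\<Sum>l<L. (b l)\<^sup>2 * (2 / \<delta> * A + \<delta> * pi\<^sup>2 * A'))"
    using d c by (intro sum_mono mult_left_mono add_mono) (auto simp: mult_left_mono)
  also have "\<dots> = (2 / \<delta> * A + \<delta> * pi\<^sup>2 * A') * (\<Sum>l<L. (b l)\<^sup>2)"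
    by (simp only: sum_distrib_right mult.commute)
  finally show ?thesis by (simp add: f_def mult.assoc)
qed

text \<open>
  With \<open>A = h^2\<close>, \<open>A'\<close> constant and \<open>\<delta>\<close> at most a multiple of \<open>h\<close>, the constant on the right is of
  the order \<open>h^2 / \<delta>\<close>.
\<close>

lemma sine_sampling_dual:
  fixes c a' :: "nat \<Rightarrow> real"
  assumes d: "\<delta> > 0" and a: "0 \<le> a" "a + real m * \<delta> \<le> 2"
    and c: "\<And>l. 0 \<le> c l" "\<And>l. c l \<le> A" "\<And>l. (real (Suc l))\<^sup>2 * c l \<le> A'"
  shows "(\<Sum>l<L. c l * (\<Sum>k<m. a' k * sin (pi * real (Suc l) * (a + real k * \<delta>)))\<^sup>2)
     \<le> (2 / \<delta> * A + \<delta> * pi\<^sup>2 * A') * (\<Sum>k<m. (a' k)\<^sup>2)"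
proof -
  have "A \<ge> 0" using c(1)[of 0] c(2)[of 0] by linarith
  moreover have "A' \<ge> 0" using c(1)[of 0] c(3)[of 0] by simp
  ultimately have B: "2 / \<delta> * A + \<delta> * pi\<^sup>2 * A' \<ge> 0" using d by auto
  have "(\<Sum>l<L. (\<Sum>k<m. a' k * (sqrt (c l) * sin (pi * real (Suc l) * (a + real k * \<delta>))))\<^sup>2)
     \<le> (2 / \<delta> * A + \<delta> * pi\<^sup>2 * A') * (\<Sum>k<m. (a' k)\<^sup>2)"
    by (rule duality_principle[OF B sine_sampling[OF d a c]])
  moreover have "(\<Sum>k<m. a' k * (sqrt (c l) * sin (pi * real (Suc l) * (a + real k * \<delta>))))\<^sup>2
    = c l * (\<Sum>k<m. a' k * sin (pi * real (Suc l) * (a + real k * \<delta>)))\<^sup>2" for l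
  proof -
    have "(\<Sum>k<m. a' k * (sqrt (c l) * sin (pi * real (Suc l) * (a + real k * \<delta>)))) =
       sqrt (c l) * (\<Sum>k<m. a' k * sin (pi * real (Suc l) * (a + real k * \<delta>)))"
      by (simp add: sum_distrib_left mult_ac)
    then show ?thesis using c(1)[of l] by (simp add: power_mult_distrib)
  qed
  ultimately show ?thesis by simp
qed

section \<open>Correlation of time increments\<close>

definition nat_dist :: "nat \<Rightarrow> nat \<Rightarrow> nat" where
  "nat_dist i j = (i - j) + (j - i)"

text \<open>
  For a stationary Ornstein-Uhlenbeck process with correlation \<open>q ^ J\<close> at lag \<open>J\<close>, this is the covariance of two
  increments over \<open>v\<close> steps that start \<open>J\<close> steps apart, divided by the variance of the process.
\<close>

definition incr_corr :: "real \<Rightarrow> nat \<Rightarrow> nat \<Rightarrow> real" where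
  "incr_corr q v J = 2 * q ^ J - q ^ (J + v) - q ^ nat_dist J v"

text \<open>
  Increments over disjoint intervals are negatively correlated, and the covariance decays geometrically
  in the gap. For overlapping increments the bound is the variance of a single increment.
\<close>

lemma incr_corr_le:
  assumes q: "0 \<le> q" "q \<le> 1"
  shows "\<bar>incr_corr q v J\<bar> \<le> 2 * (1 - q ^ v)"
    and "v \<le> J \<Longrightarrow> \<bar>incr_corr q v J\<bar> = q ^ (J - v) * (1 - q ^ v)\<^sup>2"
proof -
  have qv: "0 \<le> q ^ v" "q ^ v \<le> 1" using q by (auto intro: power_le_one)
  have far: "incr_corr q v J = - (q ^ (J - v) * (1 - q ^ v)\<^sup>2)" if "v \<le> J"
  proof -
    have "q ^ J = q ^ (J - v) * q ^ v" using that by (simp flip: power_add)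
    then show ?thesis using that
      by (simp add: incr_corr_def nat_dist_def power_add power2_eq_square algebra_simps)
  qed
  then show "v \<le> J \<Longrightarrow> \<bar>incr_corr q v J\<bar> = q ^ (J - v) * (1 - q ^ v)\<^sup>2"
    using q by (simp add: abs_mult)
  show "\<bar>incr_corr q v J\<bar> \<le> 2 * (1 - q ^ v)"
  proof (cases "v \<le> J")
    case True
    have "q ^ (J - v) * (1 - q ^ v)\<^sup>2 \<le> 1 * ((1 - q ^ v) * 1)"
      unfolding power2_eq_square using q qv by (intro mult_mono power_le_one) auto
    then show ?thesis using far[OF True] q qv by (simp add: abs_mult)
  next
    case False
    then have "incr_corr q v J = q ^ J * (1 - q ^ v) + (q ^ J - q ^ (v - J))"
      by (simp add: incr_corr_def nat_dist_def power_add algebra_simps)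
    moreover have "0 \<le> q ^ J * (1 - q ^ v)" "q ^ J * (1 - q ^ v) \<le> 1 * (1 - q ^ v)"
      using q qv power_le_one[of q J] mult_right_mono[of "q ^ J" 1 "1 - q ^ v"] by auto
    moreover have "q ^ J \<le> 1" "q ^ (v - J) \<le> 1" using q by (auto intro: power_le_one)
    moreover have "q ^ v \<le> q ^ J" "q ^ v \<le> q ^ (v - J)" using q False by (auto intro!: power_decreasing)
    ultimately show ?thesis by (simp add: abs_le_iff)
  qed
qed

lemma one_minus_power_le:
  fixes q :: real assumes q: "0 \<le> q" "q \<le> 1"
  shows "1 - q ^ v \<le> real v * (1 - q)"
proof -
  have "1 + real v * (q - 1) \<le> (1 + (q - 1)) ^ v" by (rule Bernoulli_inequality) (use q in auto)
  then show ?thesis by (simp add: algebra_simps)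
qed

text \<open>
  The \<open>v\<close> overlapping lags contribute \<open>2 * (1 - q ^ v)\<close> each. The disjoint lags form a geometric series with value
  at most \<open>(1 - q ^ v)^2 / (1 - q)\<close>, and Bernoulli's inequality removes the denominator at the price of a factor \<open>v\<close>.
\<close>

lemma sum_incr_corr_le:
  assumes q: "0 \<le> q" "q < 1"
  shows "(\<Sum>J<n. \<bar>incr_corr q v J\<bar>) \<le> 3 * real v * (1 - q ^ v)"
proof -
  have qv: "0 \<le> q ^ v" "q ^ v \<le> 1" using q by (auto intro: power_le_one)
  have "(\<Sum>J<n. \<bar>incr_corr q v J\<bar>) \<le> (\<Sum>J<v+n. \<bar>incr_corr q v J\<bar>)"
    by (rule sum_mono2) auto
  also have "\<dots> = (\<Sum>J<v. \<bar>incr_corr q v J\<bar>) + (\<Sum>J<n. \<bar>incr_corr q v (v + J)\<bar>)"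
    by (induction n) auto
  also have "(\<Sum>J<v. \<bar>incr_corr q v J\<bar>) \<le> (\<Sum>J<v. 2 * (1 - q ^ v))"
    using q by (intro sum_mono incr_corr_le) auto
  also have "(\<Sum>J<n. \<bar>incr_corr q v (v + J)\<bar>) = (\<Sum>J<n. q ^ J) * (1 - q ^ v)\<^sup>2"
    using q by (simp add: incr_corr_le(2) sum_distrib_right)
  also have "\<dots> \<le> real v * (1 - q ^ v)"
  proof -
    have "(\<Sum>J<n. q ^ J) = (1 - q ^ n) / (1 - q)" using q by (simp add: sum_gp_strict)
    also have "\<dots> \<le> 1 / (1 - q)" using q by (intro divide_right_mono) auto
    finally have "(\<Sum>J<n. q ^ J) * (1 - q ^ v) \<le> 1 / (1 - q) * (real v * (1 - q))"
      using q qv one_minus_power_le[of q v] by (intro mult_mono) auto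
    also have "\<dots> = real v" using q by simp
    finally have "((\<Sum>J<n. q ^ J) * (1 - q ^ v)) * (1 - q ^ v) \<le> real v * (1 - q ^ v)"
      using qv by (intro mult_right_mono) auto
    then show ?thesis by (simp add: power2_eq_square mult.assoc)
  qed
  finally show ?thesis by (simp add: algebra_simps)
qed

lemma sum_incr_corr_dist_le:
  assumes q: "0 \<le> q" "q < 1" and i: "i < n"
  shows "(\<Sum>j<n. \<bar>incr_corr q v (nat_dist i j)\<bar>) \<le> 6 * real v * (1 - q ^ v)"
proof -
  let ?g = "\<lambda>J. \<bar>incr_corr q v J\<bar>"
  have "(\<Sum>j<n. ?g (nat_dist i j)) = (\<Sum>j\<in>{..i}. ?g (nat_dist i j)) + (\<Sum>j\<in>{i<..<n}. ?g (nat_dist i j))"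
    using i by (subst sum.union_disjoint[symmetric]) (auto intro!: sum.cong)
  also have "(\<Sum>j\<in>{..i}. ?g (nat_dist i j)) = (\<Sum>J\<in>{..i}. ?g J)"
    by (rule sum.reindex_bij_witness[of _ "\<lambda>J. i - J" "\<lambda>j. i - j"]) (auto simp: nat_dist_def)
  also have "\<dots> \<le> (\<Sum>J<n. ?g J)" using i by (intro sum_mono2) auto
  also have "(\<Sum>j\<in>{i<..<n}. ?g (nat_dist i j)) = (\<Sum>J\<in>{0<..<n-i}. ?g J)"
    by (rule sum.reindex_bij_witness[of _ "\<lambda>J. i + J" "\<lambda>j. j - i"]) (auto simp: nat_dist_def)
  also have "\<dots> \<le> (\<Sum>J<n. ?g J)" by (intro sum_mono2) auto
  finally show ?thesis using sum_incr_corr_le[OF q, of v n] by simp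
qed

section \<open>The field and its increments on a grid\<close>

text \<open>
  The constant in a quadratic lower bound for the eigenvalues that is valid for either sign of \<open>Gam\<close>.
\<close>

definition spec_floor :: "real \<Rightarrow> real \<Rightarrow> real \<Rightarrow> real" where
  "spec_floor \<theta>2 \<theta>1 \<theta>0 = \<theta>2 * min (pi\<^sup>2) (pi\<^sup>2 + Gam \<theta>2 \<theta>1 \<theta>0)"

lemma eigval_ge:
  assumes "\<theta>2 > 0"
  shows "spec_floor \<theta>2 \<theta>1 \<theta>0 * (real (Suc l))\<^sup>2 \<le> eigval \<theta>2 \<theta>1 \<theta>0 (Suc l)"
proof -
  let ?G = "Gam \<theta>2 \<theta>1 \<theta>0" and ?n = "(real (Suc l))\<^sup>2"
  have n: "1 \<le> ?n" by simp
  have "min (pi\<^sup>2) (pi\<^sup>2 + ?G) * ?n \<le> pi\<^sup>2 * ?n + ?G"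
  proof (cases "?G \<ge> 0")
    case True then show ?thesis by simp
  next
    case False
    then have "?G * ?n \<le> ?G * 1" using n by (intro mult_left_mono_neg) auto
    then show ?thesis using False by (simp add: algebra_simps min_def)
  qed
  then show ?thesis using assms unfolding spec_floor_def eigval_def
    by (simp add: mult.assoc del: of_nat_Suc)
qed

lemma spec_floor_pos:
  assumes "\<theta>2 > 0" "Gam \<theta>2 \<theta>1 \<theta>0 + pi\<^sup>2 > 0"
  shows "spec_floor \<theta>2 \<theta>1 \<theta>0 > 0"
  using assms by (simp add: spec_floor_def add.commute)

lemma eigfun_abs_le:
  assumes "0 \<le> y" "y \<le> 1"
  shows "\<bar>eigfun \<kappa> l y\<bar> \<le> sqrt 2 * exp (\<bar>\<kappa>\<bar> / 2)"
proof -
  have "exp (- \<kappa> * y / 2) \<le> exp (\<bar>\<kappa>\<bar> / 2)"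
    using exp_tilt_bounds(1)[OF assms, of "\<kappa> / 2"] by simp
  moreover have "\<bar>sin (pi * real l * y)\<bar> \<le> 1" by simp
  ultimately have "\<bar>sin (pi * real l * y)\<bar> * exp (- \<kappa> * y / 2) \<le> 1 * exp (\<bar>\<kappa>\<bar> / 2)"
    by (intro mult_mono) auto
  then show ?thesis by (simp add: eigfun_def abs_mult mult.assoc)
qed

locale spde =
  fixes P :: "'a measure" and X :: "real \<Rightarrow> real \<Rightarrow> 'a \<Rightarrow> real" and \<sigma> \<theta>2 \<theta>1 \<theta>0 :: real
  assumes P: "prob_space P" and \<sigma>: "\<sigma>\<^sup>2 > 0" and \<theta>2: "\<theta>2 > 0" and \<Gamma>: "Gam \<theta>2 \<theta>1 \<theta>0 + pi\<^sup>2 > 0"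
    and X: "stationary_solution P \<sigma> \<theta>2 \<theta>1 \<theta>0 X"
begin

abbreviation "\<kappa> \<equiv> \<theta>1 / \<theta>2"
abbreviation "lam l \<equiv> eigval \<theta>2 \<theta>1 \<theta>0 (Suc l)"
abbreviation "\<mu> \<equiv> spec_floor \<theta>2 \<theta>1 \<theta>0"
abbreviation "e l y \<equiv> eigfun \<kappa> (Suc l) y"

lemma \<mu>_pos: "\<mu> > 0" using spec_floor_pos \<theta>2 \<Gamma> .

lemma lam_ge: "\<mu> * (real (Suc l))\<^sup>2 \<le> lam l" using eigval_ge \<theta>2 .

lemma lam_pos: "lam l > 0"
proof -
  have "0 < \<mu> * (real (Suc l))\<^sup>2" using \<mu>_pos by simp
  then show ?thesis using lam_ge[of l] by linarith
qed

sublocale centred_gaussian_field P "{0..} \<times> {0..1}" "\<lambda>(t, x). X t x"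
proof -
  interpret prob_space P by (rule P)
  show "centred_gaussian_field P ({0..} \<times> {0..1}) (\<lambda>(t, x). X t x)"
    using X by unfold_locales (auto simp: stationary_solution_def)
qed

text \<open>
  The defining series of the covariance converges absolutely, since the eigenvalues grow quadratically; this is
  what allows linear combinations of such series to be formed.
\<close>

lemma covariance_sums:
  assumes "0 \<le> s" "0 \<le> t" "x \<in> {0..1}" "y \<in> {0..1}"
  shows "(\<lambda>l. \<sigma>\<^sup>2 * (exp (- lam l * \<bar>t - s\<bar>) / (2 * lam l) * e l x * e l y)) sums (\<integral>\<omega>. X s x \<omega> * X t y \<omega> \<partial>P)"
proof -
  let ?f = "\<lambda>l. exp (- lam l * \<bar>t - s\<bar>) / (2 * lam l) * e l x * e l y"
  have "summable ?f"
  proof (rule summable_comparison_test)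
    let ?B = "sqrt 2 * exp (\<bar>\<kappa>\<bar> / 2)"
    show "summable (\<lambda>l. (?B * ?B / (2 * \<mu>)) * inverse ((real (Suc l))\<^sup>2))"
      using inverse_power_summable[of 2, where 'a = real]
      by (intro summable_mult) (subst summable_Suc_iff, simp)
    have "norm (?f l) \<le> (?B * ?B / (2 * \<mu>)) * inverse ((real (Suc l))\<^sup>2)" for l
    proof -
      have "exp (- lam l * \<bar>t - s\<bar>) \<le> 1" using lam_pos[of l] by simp
      then have "exp (- lam l * \<bar>t - s\<bar>) / (2 * lam l) \<le> 1 / (2 * (\<mu> * (real (Suc l))\<^sup>2))"
        using lam_ge[of l] lam_pos[of l] \<mu>_pos by (intro frac_le) auto
      then have "exp (- lam l * \<bar>t - s\<bar>) / (2 * lam l) * (\<bar>e l x\<bar> * \<bar>e l y\<bar>)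
          \<le> 1 / (2 * (\<mu> * (real (Suc l))\<^sup>2)) * (?B * ?B)"
        using assms \<mu>_pos eigfun_abs_le[of x \<kappa> "Suc l"] eigfun_abs_le[of y \<kappa> "Suc l"]
        by (intro mult_mono) auto
      then show ?thesis using lam_pos[of l]
        by (simp add: abs_mult mult.assoc divide_simps)
    qed
    then show "\<exists>N. \<forall>n\<ge>N. norm (?f n) \<le> (?B * ?B / (2 * \<mu>)) * inverse ((real (Suc n))\<^sup>2)" by blast
  qed
  then have "(\<lambda>l. \<sigma>\<^sup>2 * ?f l) sums (\<sigma>\<^sup>2 * (\<Sum>l. ?f l))" by (intro sums_mult summable_sums)
  also have "\<sigma>\<^sup>2 * (\<Sum>l. ?f l) = covar P (X s x) (X t y)"
    using X assms unfolding stationary_solution_def spde_cov_def by auto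
  also have "covar P (X s x) (X t y) = (\<integral>\<omega>. X s x \<omega> * X t y \<omega> \<partial>P)"
    using X assms unfolding stationary_solution_def covar_def by auto
  finally show ?thesis .
qed

lemma X_span: "0 \<le> t \<Longrightarrow> x \<in> {0..1} \<Longrightarrow> X t x \<in> V"
  using linear_span_base[of "(t, x)" "{0..} \<times> {0..1}" "\<lambda>(t, x). X t x"] by simp

definition rect :: "real \<Rightarrow> real \<Rightarrow> real \<Rightarrow> real \<Rightarrow> 'a \<Rightarrow> real" where
  "rect s t x y \<omega> = X t y \<omega> - X s y \<omega> - X t x \<omega> + X s x \<omega>"

lemma rect_span:
  assumes "0 \<le> s" "0 \<le> t" "x \<in> {0..1}" "y \<in> {0..1}"
  shows "rect s t x y \<in> V"
  unfolding rect_def[abs_def]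
  by (intro linear_span_add linear_span_diff X_span assms)

lemma sums_rect_left:
  assumes pts: "0 \<le> s" "0 \<le> t" "x \<in> {0..1}" "y \<in> {0..1}" and Y: "Y \<in> V"
    and c: "\<And>u z. 0 \<le> u \<Longrightarrow> z \<in> {0..1} \<Longrightarrow> (\<lambda>l. f u z l) sums (\<integral>\<omega>. X u z \<omega> * Y \<omega> \<partial>P)"
  shows "(\<lambda>l. f t y l - f s y l - f t x l + f s x l) sums (\<integral>\<omega>. rect s t x y \<omega> * Y \<omega> \<partial>P)"
proof -
  have "(\<integral>\<omega>. rect s t x y \<omega> * Y \<omega> \<partial>P) = (\<integral>\<omega>. X t y \<omega> * Y \<omega> \<partial>P) - (\<integral>\<omega>. X s y \<omega> * Y \<omega> \<partial>P)
      - (\<integral>\<omega>. X t x \<omega> * Y \<omega> \<partial>P) + (\<integral>\<omega>. X s x \<omega> * Y \<omega> \<partial>P)"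
    using pts by (simp add: rect_def algebra_simps span_mult_integrable X_span Y)
  then show ?thesis using pts by (simp only:) (intro sums_add sums_diff c; simp)
qed

text \<open>
  The sixteen covariances combine mode by mode into a product of a mixed time difference and two spatial differences.
\<close>

lemma rect_covariance_sums:
  assumes pts: "0 \<le> s" "0 \<le> t" "x \<in> {0..1}" "y \<in> {0..1}"
    and pts': "0 \<le> s'" "0 \<le> t'" "x' \<in> {0..1}" "y' \<in> {0..1}"
  shows "(\<lambda>l. \<sigma>\<^sup>2 * ((exp (- lam l * \<bar>t' - t\<bar>) - exp (- lam l * \<bar>s' - t\<bar>) - exp (- lam l * \<bar>t' - s\<bar>)
       + exp (- lam l * \<bar>s' - s\<bar>)) / (2 * lam l)) * ((e l y - e l x) * (e l y' - e l x')))
     sums (\<integral>\<omega>. rect s t x y \<omega> * rect s' t' x' y' \<omega> \<partial>P)"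
proof -
  define g where "g u z u' z' l = \<sigma>\<^sup>2 * (exp (- lam l * \<bar>u' - u\<bar>) / (2 * lam l) * e l z * e l z')" for u z u' z' l
  have 1: "(\<lambda>l. g u z t' y' l - g u z s' y' l - g u z t' x' l + g u z s' x' l)
      sums (\<integral>\<omega>. X u z \<omega> * rect s' t' x' y' \<omega> \<partial>P)" if "0 \<le> u" "z \<in> {0..1}" for u z
  proof -
    have "(\<lambda>l. g u z u' z' l) sums (\<integral>\<omega>. X u' z' \<omega> * X u z \<omega> \<partial>P)" if "0 \<le> u'" "z' \<in> {0..1}" for u' z'
      using covariance_sums[OF \<open>0 \<le> u\<close> that(1) \<open>z \<in> {0..1}\<close> that(2)] unfolding g_def
      by (simp add: mult.commute)
    from sums_rect_left[OF pts' X_span[OF that], of "g u z", OF this] show ?thesis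
      by (simp add: mult.commute)
  qed
  have 2: "(g t y t' y' l - g t y s' y' l - g t y t' x' l + g t y s' x' l)
     - (g s y t' y' l - g s y s' y' l - g s y t' x' l + g s y s' x' l)
     - (g t x t' y' l - g t x s' y' l - g t x t' x' l + g t x s' x' l)
     + (g s x t' y' l - g s x s' y' l - g s x t' x' l + g s x s' x' l)
    = \<sigma>\<^sup>2 * ((exp (- lam l * \<bar>t' - t\<bar>) - exp (- lam l * \<bar>s' - t\<bar>) - exp (- lam l * \<bar>t' - s\<bar>)
       + exp (- lam l * \<bar>s' - s\<bar>)) / (2 * lam l)) * ((e l y - e l x) * (e l y' - e l x'))" for l
    using lam_pos[of l] unfolding g_def
    by (simp only: add_divide_distrib diff_divide_distrib) (simp add: algebra_simps)
  show ?thesis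
    using sums_rect_left[OF pts rect_span[OF pts'] 1] by (simp only: 2)
qed

end

text \<open>
  A fixed observation grid, with time lag \<open>v\<close> and spatial lag \<open>w\<close>.
\<close>

locale spde_grid = spde P X \<sigma> \<theta>2 \<theta>1 \<theta>0
  for P :: "'a measure" and X :: "real \<Rightarrow> real \<Rightarrow> 'a \<Rightarrow> real" and \<sigma> \<theta>2 \<theta>1 \<theta>0 :: real +
  fixes T b :: real and M N v w :: nat
  assumes T: "T > 0" and b: "0 < b" "b < 1 / 2" and MN: "1 \<le> M" "1 \<le> N"
    and v: "1 \<le> v" and w: "1 \<le> w" "w \<le> M"
begin

abbreviation "\<Delta> \<equiv> tstep T N"
abbreviation "\<delta> \<equiv> ystep b M"
text \<open>
  All second moments below are relative to \<open>\<sigma>^2\<close>: \<open>tvar l\<close> is the variance of the time increments of mode \<open>l\<close>,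
  and \<open>de l k\<close> the increment of its eigenfunction over the spatial lag.
\<close>

definition "h = sqrt (real v * \<Delta>)"
definition "tvar l = (1 - exp (- lam l * h\<^sup>2)) / lam l"
definition "de l k = e l (ygrid b M (k + w)) - e l (ygrid b M k)"
abbreviation "D i k \<equiv> dincr X T b M N v w i k"

lemma \<Delta>_pos: "\<Delta> > 0" using T MN by (simp add: tstep_def)
lemma \<delta>_pos: "\<delta> > 0" using b MN by (simp add: ystep_def)
lemma h_pos: "h > 0" using \<Delta>_pos v by (simp add: h_def)
lemma h_square: "h\<^sup>2 = real v * \<Delta>" using \<Delta>_pos v by (simp add: h_def)

lemma ygrid_bounds: assumes "k \<le> M" shows "b \<le> ygrid b M k" "ygrid b M k \<le> 1 - b" "ygrid b M k \<in> {0..1}"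
proof -
  have "real k * \<delta> \<le> real M * \<delta>" using assms \<delta>_pos by (intro mult_right_mono) auto
  also have "\<dots> = 1 - 2 * b" using MN by (simp add: ystep_def)
  finally show "ygrid b M k \<le> 1 - b" by (simp add: ygrid_def)
  show "b \<le> ygrid b M k" using \<delta>_pos by (simp add: ygrid_def)
  then show "ygrid b M k \<in> {0..1}" using \<open>ygrid b M k \<le> 1 - b\<close> b by simp
qed

lemma tgrid_nonneg: "tgrid T N i \<ge> 0" using \<Delta>_pos by (simp add: tgrid_def)

lemma D_rect: "D i k = rect (tgrid T N i) (tgrid T N (i + v)) (ygrid b M k) (ygrid b M (k + w))"
  by (rule ext) (simp add: dincr_def rect_def)

lemma D_span: assumes "k + w \<le> M" shows "D i k \<in> V"
  unfolding D_rect using assms by (intro rect_span tgrid_nonneg ygrid_bounds(3)) auto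

text \<open>
  The correlation of mode \<open>l\<close> over one time step.
\<close>

definition q where "q l = exp (- lam l * \<Delta>)"

lemma q_bounds: "0 \<le> q l" "q l < 1" using lam_pos[of l] \<Delta>_pos by (auto simp: q_def)

lemma q_power: "q l ^ v = exp (- lam l * h\<^sup>2)"
  by (simp add: q_def h_square flip: exp_of_nat_mult)

lemma exp_grid: "exp (- lam l * \<bar>tgrid T N i - tgrid T N j\<bar>) = q l ^ nat_dist j i"
proof -
  have "\<bar>tgrid T N i - tgrid T N j\<bar> = real (nat_dist j i) * \<Delta>"
    using \<Delta>_pos by (auto simp: tgrid_def nat_dist_def left_diff_distrib[symmetric] abs_mult of_nat_diff
        not_le max_def split: nat_diff_split)
  then show ?thesis by (simp add: q_def flip: exp_of_nat_mult)
qed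

text \<open>
  The covariance of the time increments of mode \<open>l\<close> starting at \<open>t_i\<close> and \<open>t_j\<close>, relative to \<open>\<sigma>^2\<close>.
\<close>

definition "tcov l i j = incr_corr (q l) v (nat_dist i j) / (2 * lam l)"

lemma incr_corr_shift:
  "q' ^ nat_dist (i + v) (j + v) - q' ^ nat_dist (i + v) j - q' ^ nat_dist i (j + v) + q' ^ nat_dist i j
    = incr_corr q' v (nat_dist i j)"
proof (cases "i \<le> j")
  case True
  then have "nat_dist i (j + v) = nat_dist i j + v" "nat_dist (i + v) j = nat_dist (nat_dist i j) v"
    "nat_dist (i + v) (j + v) = nat_dist i j" by (auto simp: nat_dist_def)
  then show ?thesis by (simp add: incr_corr_def)
next
  case False
  then have "nat_dist (i + v) j = nat_dist i j + v" "nat_dist i (j + v) = nat_dist (nat_dist i j) v"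
    "nat_dist (i + v) (j + v) = nat_dist i j" by (auto simp: nat_dist_def)
  then show ?thesis by (simp add: incr_corr_def)
qed

lemma D_covariance_sums:
  assumes "k + w \<le> M" "m + w \<le> M"
  shows "(\<lambda>l. \<sigma>\<^sup>2 * tcov l i j * (de l k * de l m)) sums (\<integral>\<omega>. D i k \<omega> * D j m \<omega> \<partial>P)"
proof -
  have y: "ygrid b M k \<in> {0..1}" "ygrid b M (k + w) \<in> {0..1}" "ygrid b M m \<in> {0..1}" "ygrid b M (m + w) \<in> {0..1}"
    using assms by (auto simp del: atLeastAtMost_iff intro!: ygrid_bounds)
  show ?thesis
    using rect_covariance_sums[OF tgrid_nonneg[of i] tgrid_nonneg[of "i + v"] y(1,2)
        tgrid_nonneg[of j] tgrid_nonneg[of "j + v"] y(3,4)]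
    unfolding D_rect exp_grid incr_corr_shift tcov_def de_def .
qed

lemma tcov_le: "\<bar>tcov l i j\<bar> \<le> tvar l"
  using incr_corr_le(1)[of "q l" v "nat_dist i j"] q_bounds[of l] lam_pos[of l]
  by (simp add: tcov_def tvar_def q_power abs_mult divide_simps mult_ac)

lemma tcov_diag: "tcov l i i = tvar l"
  using lam_pos[of l] by (simp add: tcov_def tvar_def incr_corr_def nat_dist_def q_power field_simps)

lemma sum_tcov_le: assumes "i < n" shows "(\<Sum>j<n. \<bar>tcov l i j\<bar>) \<le> 3 * real v * tvar l"
proof -
  have "(\<Sum>j<n. \<bar>tcov l i j\<bar>) = (\<Sum>j<n. \<bar>incr_corr (q l) v (nat_dist i j)\<bar>) / (2 * lam l)"
    using lam_pos[of l] by (simp add: tcov_def sum_divide_distrib abs_mult)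
  also have "\<dots> \<le> 6 * real v * (1 - q l ^ v) / (2 * lam l)"
    using sum_incr_corr_dist_le[OF q_bounds assms, of l v] lam_pos[of l] by (intro divide_right_mono) auto
  finally show ?thesis by (simp add: tvar_def q_power)
qed

lemma tvar_bounds: "0 \<le> tvar l" "tvar l \<le> h\<^sup>2" "\<mu> * (real (Suc l))\<^sup>2 * tvar l \<le> 1" 
proof -
  show "0 \<le> tvar l" using lam_pos[of l] by (simp add: tvar_def)
  have "1 - exp (- lam l * h\<^sup>2) \<le> lam l * h\<^sup>2" using exp_ge_add_one_self[of "- lam l * h\<^sup>2"] by simp
  then show "tvar l \<le> h\<^sup>2" using lam_pos[of l] by (simp add: tvar_def divide_le_eq mult.commute)
  have "\<mu> * (real (Suc l))\<^sup>2 * tvar l \<le> lam l * tvar l"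
    using lam_ge[of l] \<open>0 \<le> tvar l\<close> by (intro mult_right_mono)
  also have "\<dots> \<le> 1" using lam_pos[of l] by (simp add: tvar_def)
  finally show "\<mu> * (real (Suc l))\<^sup>2 * tvar l \<le> 1" .
qed

lemma sum_tvar_le: "(\<Sum>l<L. tvar l) \<le> 4 * h / sqrt \<mu>"
  by (rule sum_min_square_le[OF h_pos \<mu>_pos tvar_bounds(2,3)])

definition "tilt = exp \<bar>\<kappa>\<bar>"

lemma de_le: assumes "k + w \<le> M" shows "(de l k)\<^sup>2 \<le> 8 * tilt"
proof -
  have "\<bar>de l k\<bar> \<le> 2 * (sqrt 2 * exp (\<bar>\<kappa>\<bar> / 2))"
    using eigfun_abs_le[of "ygrid b M k" \<kappa> "Suc l"] eigfun_abs_le[of "ygrid b M (k + w)" \<kappa> "Suc l"]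
      ygrid_bounds(3)[of k] ygrid_bounds(3)[of "k + w"] assms by (auto simp: de_def)
  then have "\<bar>de l k\<bar>\<^sup>2 \<le> (2 * (sqrt 2 * exp (\<bar>\<kappa>\<bar> / 2)))\<^sup>2" by (intro power_mono) auto
  then have "(de l k)\<^sup>2 \<le> (2 * (sqrt 2 * exp (\<bar>\<kappa>\<bar> / 2)))\<^sup>2" by simp
  also have "\<dots> = 8 * tilt" by (simp add: power_mult_distrib tilt_def flip: exp_double)
  finally show ?thesis .
qed

text \<open>
  The constant of \<open>sine_sampling_dual\<close> for the weights \<open>tvar\<close>.
\<close>

definition "samp = 2 / \<delta> * h\<^sup>2 + \<delta> * pi\<^sup>2 * (1 / \<mu>)"

lemma samp_nonneg: "samp \<ge> 0" using \<delta>_pos \<mu>_pos by (simp add: samp_def)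

text \<open>
  The tilt of the eigenfunctions is absorbed into the coefficients \<open>a\<close>.
\<close>

lemma mode_energy_at:
  assumes "p + m \<le> Suc M"
  shows "(\<Sum>l<L. tvar l * (\<Sum>k<m. a k * e l (ygrid b M (k + p)))\<^sup>2) \<le> 2 * tilt * samp * (\<Sum>k<m. (a k)\<^sup>2)"
proof -
  let ?y = "\<lambda>k. ygrid b M (k + p)"
  let ?a = "\<lambda>k. sqrt 2 * exp (- \<kappa> * ?y k / 2) * a k"
  have 0: "?y k = ygrid b M p + real k * \<delta>" for k by (simp add: ygrid_def algebra_simps)
  have "(\<Sum>l<L. tvar l * (\<Sum>k<m. a k * e l (?y k))\<^sup>2)
     = (\<Sum>l<L. tvar l * (\<Sum>k<m. ?a k * sin (pi * real (Suc l) * (ygrid b M p + real k * \<delta>)))\<^sup>2)"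
    by (simp only: eigfun_def 0[symmetric] mult_ac)
  also have "\<dots> \<le> samp * (\<Sum>k<m. (?a k)\<^sup>2)"
    unfolding samp_def
  proof (rule sine_sampling_dual[OF \<delta>_pos])
    show "0 \<le> ygrid b M p" using \<delta>_pos b by (simp add: ygrid_def)
    have "ygrid b M p + real m * \<delta> = b + real (p + m) * \<delta>" by (simp add: ygrid_def algebra_simps)
    also have "\<dots> \<le> b + real (Suc M) * \<delta>" using assms \<delta>_pos by (intro add_left_mono mult_right_mono) auto
    also have "real (Suc M) * \<delta> \<le> 2 * real M * \<delta>" using MN \<delta>_pos by (intro mult_right_mono) auto
    also have "b + 2 * real M * \<delta> \<le> 2" using MN b by (simp add: ystep_def)
    finally show "ygrid b M p + real m * \<delta> \<le> 2" by simp
    show "(real (Suc l))\<^sup>2 * tvar l \<le> 1 / \<mu>" for l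
      using tvar_bounds(3)[of l] \<mu>_pos by (simp add: pos_le_divide_eq mult_ac)
  qed (use tvar_bounds in auto)
  also have "\<dots> \<le> samp * (\<Sum>k<m. 2 * tilt * (a k)\<^sup>2)"
  proof (intro mult_left_mono sum_mono samp_nonneg)
    fix k assume "k \<in> {..<m}"
    then have y: "?y k \<in> {0..1}" using assms by (intro ygrid_bounds) auto
    have "(exp (- \<kappa> * ?y k / 2))\<^sup>2 = exp (- \<kappa> * ?y k)" by (simp flip: exp_double)
    also have "\<dots> \<le> tilt" unfolding tilt_def using y by (intro exp_tilt_bounds) auto
    finally have "(exp (- \<kappa> * ?y k / 2))\<^sup>2 * (a k)\<^sup>2 \<le> tilt * (a k)\<^sup>2" by (intro mult_right_mono) auto
    then show "(?a k)\<^sup>2 \<le> 2 * tilt * (a k)\<^sup>2" by (simp add: power_mult_distrib mult.assoc)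
  qed
  also have "\<dots> = 2 * tilt * samp * (\<Sum>k<m. (a k)\<^sup>2)" by (simp add: sum_distrib_left mult_ac)
  finally show ?thesis .
qed

text \<open>
  Both end points of the spatial increments run through grid points, so \<open>mode_energy_at\<close> applies to each of them.
\<close>

lemma mode_energy_de:
  assumes "m + w \<le> Suc M"
  shows "(\<Sum>l<L. tvar l * (\<Sum>k<m. a k * de l k)\<^sup>2) \<le> 8 * tilt * samp * (\<Sum>k<m. (a k)\<^sup>2)"
proof -
  have "(\<Sum>l<L. tvar l * (\<Sum>k<m. a k * de l k)\<^sup>2) \<le>
    (\<Sum>l<L. 2 * (tvar l * (\<Sum>k<m. a k * e l (ygrid b M (k + w)))\<^sup>2) + 2 * (tvar l * (\<Sum>k<m. a k * e l (ygrid b M (k + 0)))\<^sup>2))"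
  proof (intro sum_mono)
    fix l
    let ?x = "\<Sum>k<m. a k * e l (ygrid b M (k + w))" and ?y = "\<Sum>k<m. a k * e l (ygrid b M (k + 0))"
    have "(\<Sum>k<m. a k * de l k) = ?x - ?y" by (simp add: de_def right_diff_distrib sum_subtractf)
    moreover have "(?x - ?y)\<^sup>2 \<le> 2 * ?x\<^sup>2 + 2 * ?y\<^sup>2"
      using sum_squares_bound[of ?x "- ?y"] by (simp add: power2_diff)
    ultimately have "tvar l * (\<Sum>k<m. a k * de l k)\<^sup>2 \<le> tvar l * (2 * ?x\<^sup>2 + 2 * ?y\<^sup>2)"
      using tvar_bounds(1)[of l] by (simp add: mult_left_mono)
    then show "tvar l * (\<Sum>k<m. a k * de l k)\<^sup>2 \<le> 2 * (tvar l * ?x\<^sup>2) + 2 * (tvar l * ?y\<^sup>2)" by (simp add: algebra_simps)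
  qed
  also have "\<dots> = 2 * (\<Sum>l<L. tvar l * (\<Sum>k<m. a k * e l (ygrid b M (k + w)))\<^sup>2)
     + 2 * (\<Sum>l<L. tvar l * (\<Sum>k<m. a k * e l (ygrid b M (k + 0)))\<^sup>2)"
    by (simp only: sum.distrib sum_distrib_left)
  also have "\<dots> \<le> 2 * (2 * tilt * samp * (\<Sum>k<m. (a k)\<^sup>2)) + 2 * (2 * tilt * samp * (\<Sum>k<m. (a k)\<^sup>2))"
    by (intro add_mono mult_left_mono mode_energy_at) (use assms in auto)
  finally show ?thesis by simp
qed

text \<open>
  Expanding the square turns the sum into one over pairs of modes in which time and space factorise. In
  time, one factor is bounded pointwise and the other one summed. In space, for fixed
  \<open>l\<close> the sum over \<open>l'\<close> is the mode energy of the grid vector \<open>de l\<close>, so only the sum of \<open>tvar\<close> remains.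
\<close>

lemma truncated_covariance_square_sum:
  assumes "m + w \<le> Suc M"
  shows "(\<Sum>i<n. \<Sum>j<n. \<Sum>k<m. \<Sum>k'<m. (\<Sum>l<L. tcov l i j * (de l k * de l k'))\<^sup>2)
    \<le> 3 * real n * real v * (8 * tilt * samp * (real m * (8 * tilt)) * (4 * h / sqrt \<mu>))"
proof -
  define G where "G l l' = (\<Sum>k<m. de l' k * de l k)" for l l'
  have "(\<Sum>k<m. \<Sum>k'<m. (\<Sum>l<L. tcov l i j * (de l k * de l k'))\<^sup>2) = (\<Sum>l<L. \<Sum>l'<L. (tcov l i j * tcov l' i j) * (G l l')\<^sup>2)" for i j
  proof -
    have "(\<Sum>k<m. \<Sum>k'<m. (\<Sum>l<L. tcov l i j * (de l k * de l k'))\<^sup>2)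
      = (\<Sum>k<m. \<Sum>k'<m. \<Sum>l<L. \<Sum>l'<L. (tcov l i j * tcov l' i j) * ((de l' k * de l k) * (de l' k' * de l k')))"
      by (simp add: power2_eq_square sum_product mult_ac)
    also have "\<dots> = (\<Sum>k<m. \<Sum>l<L. \<Sum>k'<m. \<Sum>l'<L. (tcov l i j * tcov l' i j) * ((de l' k * de l k) * (de l' k' * de l k')))"
      by (intro sum.cong refl sum.swap)
    also have "\<dots> = (\<Sum>l<L. \<Sum>k<m. \<Sum>k'<m. \<Sum>l'<L. (tcov l i j * tcov l' i j) * ((de l' k * de l k) * (de l' k' * de l k')))"
      by (rule sum.swap)
    also have "\<dots> = (\<Sum>l<L. \<Sum>k<m. \<Sum>l'<L. \<Sum>k'<m. (tcov l i j * tcov l' i j) * ((de l' k * de l k) * (de l' k' * de l k')))"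
      by (intro sum.cong refl sum.swap)
    also have "\<dots> = (\<Sum>l<L. \<Sum>l'<L. \<Sum>k<m. \<Sum>k'<m. (tcov l i j * tcov l' i j) * ((de l' k * de l k) * (de l' k' * de l k')))"
      by (intro sum.cong refl sum.swap)
    also have "\<dots> = (\<Sum>l<L. \<Sum>l'<L. (tcov l i j * tcov l' i j) * (G l l')\<^sup>2)"
    proof (intro sum.cong refl)
      fix l l'
      show "(\<Sum>k<m. \<Sum>k'<m. (tcov l i j * tcov l' i j) * ((de l' k * de l k) * (de l' k' * de l k'))) =
         (tcov l i j * tcov l' i j) * (G l l')\<^sup>2"
        unfolding G_def power2_eq_square sum_product by (simp only: sum_distrib_left)
    qed
    finally show ?thesis .
  qed
  then have "(\<Sum>i<n. \<Sum>j<n. \<Sum>k<m. \<Sum>k'<m. (\<Sum>l<L. tcov l i j * (de l k * de l k'))\<^sup>2)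
     = (\<Sum>i<n. \<Sum>j<n. \<Sum>l<L. \<Sum>l'<L. (tcov l i j * tcov l' i j) * (G l l')\<^sup>2)" by simp
  also have "\<dots> \<le> (\<Sum>i<n. \<Sum>j<n. \<Sum>l<L. \<Sum>l'<L. (\<bar>tcov l i j\<bar> * tvar l') * (G l l')\<^sup>2)"
  proof (intro sum_mono mult_right_mono)
    fix i j l l'
    have "tcov l i j * tcov l' i j \<le> \<bar>tcov l i j\<bar> * \<bar>tcov l' i j\<bar>" by (simp flip: abs_mult)
    also have "\<dots> \<le> \<bar>tcov l i j\<bar> * tvar l'" by (intro mult_left_mono tcov_le) auto
    finally show "tcov l i j * tcov l' i j \<le> \<bar>tcov l i j\<bar> * tvar l'" .
  qed auto
  also have "\<dots> = (\<Sum>i<n. \<Sum>l<L. \<Sum>j<n. \<Sum>l'<L. (\<bar>tcov l i j\<bar> * tvar l') * (G l l')\<^sup>2)"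
    by (intro sum.cong refl sum.swap)
  also have "\<dots> = (\<Sum>i<n. \<Sum>l<L. \<Sum>l'<L. \<Sum>j<n. (\<bar>tcov l i j\<bar> * tvar l') * (G l l')\<^sup>2)"
    by (intro sum.cong refl sum.swap)
  also have "\<dots> = (\<Sum>i<n. \<Sum>l<L. \<Sum>l'<L. (\<Sum>j<n. \<bar>tcov l i j\<bar>) * (tvar l' * (G l l')\<^sup>2))"
    by (simp only: sum_distrib_right mult.assoc)
  also have "\<dots> \<le> (\<Sum>i<n. \<Sum>l<L. \<Sum>l'<L. (3 * real v * tvar l) * (tvar l' * (G l l')\<^sup>2))"
    using tvar_bounds(1) by (intro sum_mono mult_right_mono sum_tcov_le) auto
  also have "\<dots> = 3 * real n * real v * (\<Sum>l<L. tvar l * (\<Sum>l'<L. tvar l' * (G l l')\<^sup>2))"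
    by (simp add: sum_distrib_left mult_ac)
  also have "\<dots> \<le> 3 * real n * real v * (\<Sum>l<L. tvar l * (8 * tilt * samp * (real m * (8 * tilt))))"
  proof (intro mult_left_mono sum_mono)
    fix l
    have "(\<Sum>l'<L. tvar l' * (G l l')\<^sup>2) \<le> 8 * tilt * samp * (\<Sum>k<m. (de l k)\<^sup>2)"
      using mode_energy_de[OF assms, of "\<lambda>k. de l k" L] by (simp add: G_def mult.commute)
    also have "(\<Sum>k<m. (de l k)\<^sup>2) \<le> (\<Sum>k<m. 8 * tilt)" using assms by (intro sum_mono de_le) auto
    finally show "(\<Sum>l'<L. tvar l' * (G l l')\<^sup>2) \<le> 8 * tilt * samp * (real m * (8 * tilt))"
      using samp_nonneg by (simp add: tilt_def mult_left_mono)
  qed (use tvar_bounds(1) in auto)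
  also have "\<dots> = 3 * real n * real v * (8 * tilt * samp * (real m * (8 * tilt)) * (\<Sum>l<L. tvar l))"
    by (simp add: sum_distrib_left sum_distrib_right mult_ac)
  also have "\<dots> \<le> 3 * real n * real v * (8 * tilt * samp * (real m * (8 * tilt)) * (4 * h / sqrt \<mu>))"
    using samp_nonneg by (intro mult_left_mono sum_tvar_le) (auto simp: tilt_def)
  finally show ?thesis .
qed

lemma covariance_square_sum:
  assumes m: "m + w \<le> Suc M"
  shows "(\<Sum>i<n. \<Sum>j<n. \<Sum>k<m. \<Sum>k'<m. (\<integral>\<omega>. D i k \<omega> * D j k' \<omega> \<partial>P)\<^sup>2)
    \<le> \<sigma> ^ 4 * (3 * real n * real v * (8 * tilt * samp * (real m * (8 * tilt)) * (4 * h / sqrt \<mu>)))"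
proof (rule LIMSEQ_le_const2)
  show "(\<lambda>L. \<Sum>i<n. \<Sum>j<n. \<Sum>k<m. \<Sum>k'<m. (\<sigma>\<^sup>2 * (\<Sum>l<L. tcov l i j * (de l k * de l k')))\<^sup>2)
     \<longlonglongrightarrow> (\<Sum>i<n. \<Sum>j<n. \<Sum>k<m. \<Sum>k'<m. (\<integral>\<omega>. D i k \<omega> * D j k' \<omega> \<partial>P)\<^sup>2)"
  proof (intro tendsto_sum tendsto_power)
    fix i j k k' assume "k \<in> {..<m}" "k' \<in> {..<m}"
    then have "k + w \<le> M" "k' + w \<le> M" using m by auto
    from D_covariance_sums[OF this, of i j]
    show "(\<lambda>L. \<sigma>\<^sup>2 * (\<Sum>l<L. tcov l i j * (de l k * de l k'))) \<longlonglongrightarrow> (\<integral>\<omega>. D i k \<omega> * D j k' \<omega> \<partial>P)"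
      by (simp add: sums_def sum_distrib_left mult.assoc)
  qed
  have "(\<Sum>i<n. \<Sum>j<n. \<Sum>k<m. \<Sum>k'<m. (\<sigma>\<^sup>2 * (\<Sum>l<L. tcov l i j * (de l k * de l k')))\<^sup>2)
     = \<sigma> ^ 4 * (\<Sum>i<n. \<Sum>j<n. \<Sum>k<m. \<Sum>k'<m. (\<Sum>l<L. tcov l i j * (de l k * de l k'))\<^sup>2)" for L
  proof -
    have "(\<sigma>\<^sup>2 * x)\<^sup>2 = \<sigma> ^ 4 * x\<^sup>2" for x by (simp add: power_mult_distrib)
    then show ?thesis by (simp only: sum_distrib_left[symmetric])
  qed
  then show "\<exists>N. \<forall>L\<ge>N. (\<Sum>i<n. \<Sum>j<n. \<Sum>k<m. \<Sum>k'<m. (\<sigma>\<^sup>2 * (\<Sum>l<L. tcov l i j * (de l k * de l k')))\<^sup>2)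
     \<le> \<sigma> ^ 4 * (3 * real n * real v * (8 * tilt * samp * (real m * (8 * tilt)) * (4 * h / sqrt \<mu>)))"
    using truncated_covariance_square_sum[OF m, of _ n] by (simp only:) (intro exI allI impI mult_left_mono; simp)
qed

lemma D_second_moment_sums:
  assumes "k + w \<le> M"
  shows "(\<lambda>l. \<sigma>\<^sup>2 * (tvar l * (de l k)\<^sup>2)) sums (\<integral>\<omega>. (D i k \<omega>)\<^sup>2 \<partial>P)"
  using D_covariance_sums[OF assms assms, of i i] by (simp add: tcov_diag power2_eq_square mult.assoc)

end

section \<open>The Gaussian tail and the function psi\<close>

definition gtail :: "real \<Rightarrow> real" where
  "gtail a = (LBINT z:{a..}. exp (- (z\<^sup>2)))"

lemma set_integrable_gauss: "S \<in> sets borel \<Longrightarrow> set_integrable lborel S (\<lambda>z::real. exp (- z\<^sup>2))"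
proof -
  have "integrable lborel (\<lambda>z::real. sqrt pi * normal_density 0 (1 / sqrt 2) z)"
    by (intro integrable_mult_right integrable_normal_density) auto
  moreover have "(\<lambda>z::real. sqrt pi * normal_density 0 (1 / sqrt 2) z) = (\<lambda>z. exp (- z\<^sup>2))"
    by (rule ext) (simp add: normal_density_def power_divide)
  ultimately have "set_integrable lborel UNIV (\<lambda>z::real. exp (- z\<^sup>2))"
    by (simp add: set_integrable_def)
  then show "S \<in> sets borel \<Longrightarrow> ?thesis" by (rule set_integrable_subset) auto
qed

lemma gtail_split:
  assumes "x \<le> y"
  shows "gtail x = integral {x..y} (\<lambda>z. exp (- z\<^sup>2)) + gtail y"
proof -
  have "gtail x = (LBINT z:{x..<y} \<union> {y..}. exp (- z\<^sup>2))"
    unfolding gtail_def using assms by (intro arg_cong2[where f = "\<lambda>S. set_lebesgue_integral lborel S"]) auto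
  also have "\<dots> = (LBINT z:{x..<y}. exp (- z\<^sup>2)) + (LBINT z:{y..}. exp (- z\<^sup>2))"
    by (intro set_integral_Un set_integrable_gauss) auto
  also have "(LBINT z:{x..<y}. exp (- z\<^sup>2)) = integral {x..<y} (\<lambda>z. exp (- z\<^sup>2))"
    by (intro set_borel_integral_eq_integral set_integrable_gauss) auto
  also have "\<dots> = integral {x..y} (\<lambda>z. exp (- z\<^sup>2))"
    by (rule integral_subset_negligible) (auto intro: negligible_subset[of "{y}"] negligible_sing)
  finally show ?thesis by (simp add: gtail_def)
qed

lemma DERIV_gtail [derivative_intros]:
  assumes "(f has_real_derivative f') (at x within S)"
  shows "((\<lambda>x. gtail (f x)) has_real_derivative - exp (- (f x)\<^sup>2) * f') (at x within S)"
proof -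
  have "(gtail has_real_derivative - exp (- t\<^sup>2)) (at t)" for t
  proof -
    let ?I = "\<lambda>x. integral {x..t + 1} (\<lambda>z. exp (- z\<^sup>2))"
    have "(?I has_real_derivative - exp (- t\<^sup>2)) (at t within {t - 1..t + 1})"
      by (rule integral_has_real_derivative') (auto intro!: continuous_intros)
    then have "(?I has_real_derivative - exp (- t\<^sup>2)) (at t)"
      by (subst (asm) at_within_Icc_at) auto
    then have "((\<lambda>x. ?I x + gtail (t + 1)) has_real_derivative - exp (- t\<^sup>2)) (at t)"
      by (auto intro!: derivative_eq_intros)
    moreover have ev: "eventually (\<lambda>x. ?I x + gtail (t + 1) = gtail x) (nhds t)"
      by (rule eventually_mono[OF eventually_nhds_in_open[of "{..<t + 1}" t]]) (auto intro!: gtail_split[symmetric])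
    ultimately show ?thesis by (simp only: DERIV_cong_ev[OF refl ev refl])
  qed
  from DERIV_chain2[OF this assms] show ?thesis .
qed

lemma gtail_nonneg: "gtail x \<ge> 0"
  unfolding gtail_def set_lebesgue_integral_def by (intro Bochner_Integration.integral_nonneg) auto

lemma gtail_pos: "gtail x > 0"
proof -
  have "((\<lambda>x. - gtail x) has_real_derivative exp (- t\<^sup>2)) (at t)" for t
    by (auto intro!: derivative_eq_intros)
  then have "- gtail x < - gtail (x + 1)"
    by (intro DERIV_pos_imp_increasing[of x "x + 1" "\<lambda>x. - gtail x"]) (auto intro!: exI exp_gt_zero)
  then show ?thesis using gtail_nonneg[of "x + 1"] by simp
qed

text \<open>
  Beyond \<open>x\<close> the integrand is at most \<open>z / x * exp (- z^2)\<close>, which has an elementary antiderivative.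
\<close>

lemma gtail_mills:
  assumes x: "x > 0" shows "gtail x \<le> exp (- x\<^sup>2) / (2 * x)"
proof -
  let ?F = "\<lambda>z. - exp (- z\<^sup>2) / (2 * x)"
  have n: "(\<integral>\<^sup>+z. ennreal (z / x * exp (- z\<^sup>2)) * indicator {x..} z \<partial>lborel) = ennreal (0 - ?F x)"
  proof (rule nn_integral_FTC_atLeast[where F = ?F and T = 0])
    show "(?F \<longlongrightarrow> 0) at_top" using x by real_asymp
    show "DERIV ?F z :> z / x * exp (- z\<^sup>2)" for z
      using x by (auto intro!: derivative_eq_intros)
  qed (use x in auto)
  have "ennreal (gtail x) = (\<integral>\<^sup>+z. ennreal (indicator {x..} z * exp (- z\<^sup>2)) \<partial>lborel)"
    using set_integrable_gauss[of "{x..}"]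
    by (simp add: gtail_def set_lebesgue_integral_def set_integrable_def nn_integral_eq_integral)
  also have "\<dots> \<le> (\<integral>\<^sup>+z. ennreal (z / x * exp (- z\<^sup>2)) * indicator {x..} z \<partial>lborel)"
    using x by (intro nn_integral_mono) (auto simp: indicator_def divide_simps intro!: ennreal_leI)
  finally show ?thesis unfolding n using x by (simp add: ennreal_le_iff)
qed

lemma has_integral_rsqrt:
  assumes "0 \<le> u"
  shows "((\<lambda>s. 1 / sqrt s) has_integral 2 * sqrt u) {0..u}"
proof -
  have "((\<lambda>s. 1 / sqrt s) has_integral (2 * sqrt u - 2 * sqrt 0)) {0..u}"
  proof (rule fundamental_theorem_of_calculus_interior)
    fix x assume x: "x \<in> {0<..<u}"
    then have "((\<lambda>s. 2 * sqrt s) has_real_derivative 1 / sqrt x) (at x)"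
      by (auto intro!: derivative_eq_intros simp: field_simps)
    then show "((\<lambda>s. 2 * sqrt s) has_vector_derivative 1 / sqrt x) (at x)"
      by (simp add: has_real_derivative_iff_has_vector_derivative)
  qed (use assms in \<open>auto intro!: continuous_intros\<close>)
  then show ?thesis by simp
qed

text \<open>
  The displayed value, as a function of \<open>u\<close>, is an antiderivative; by the tail bound it tends to 0 at 0.
\<close>

lemma has_integral_heat_gap:
  assumes a: "a > 0" and u: "u > 0"
  shows "((\<lambda>s. (1 - exp (- a / s)) / sqrt s) has_integral
     2 * sqrt u * (1 - exp (- a / u)) + 4 * sqrt a * gtail (sqrt a / sqrt u)) {0..u}"
proof -
  define F where "F s = (if s = 0 then 0 else 2 * sqrt s * (1 - exp (- a / s)) + 4 * sqrt a * gtail (sqrt a / sqrt s))" for s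
  have dF: "(F has_real_derivative (1 - exp (- a / s)) / sqrt s) (at s)" if s: "s > 0" for s
  proof -
    have g: "((\<lambda>s. sqrt a / sqrt s) has_real_derivative - (sqrt a / (2 * s * sqrt s))) (at s)"
      using s by (auto intro!: derivative_eq_intros simp: field_simps)
    have ds: "(sqrt has_real_derivative 1 / (2 * sqrt s)) (at s)"
      using s by (auto intro!: derivative_eq_intros simp: field_simps)
    have de: "((\<lambda>s. exp (- a / s)) has_real_derivative exp (- a / s) * (a / s\<^sup>2)) (at s)"
      using s by (auto intro!: derivative_eq_intros simp: power2_eq_square)
    have "((\<lambda>s. 2 * sqrt s * (1 - exp (- a / s)) + 4 * sqrt a * gtail (sqrt a / sqrt s)) has_real_derivative
       (1 / sqrt s) * (1 - exp (- a / s)) - 2 * sqrt s * (exp (- a / s) * (a / s\<^sup>2))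
       + 4 * sqrt a * (- exp (- (sqrt a / sqrt s)\<^sup>2) * - (sqrt a / (2 * s * sqrt s)))) (at s)"
      by (rule DERIV_cong[OF DERIV_add[OF DERIV_mult[OF DERIV_cmult[OF ds, of 2]
            DERIV_diff[OF DERIV_const[of 1] de]] DERIV_cmult[OF DERIV_gtail[OF g], of "4 * sqrt a"]]]) simp
    also have "(1 / sqrt s) * (1 - exp (- a / s)) - 2 * sqrt s * (exp (- a / s) * (a / s\<^sup>2))
       + 4 * sqrt a * (- exp (- (sqrt a / sqrt s)\<^sup>2) * - (sqrt a / (2 * s * sqrt s))) = (1 - exp (- a / s)) / sqrt s"
    proof -
      have 1: "(sqrt a / sqrt s)\<^sup>2 = a / s" using a s by (simp add: power_divide)
      have 2: "2 * sqrt s * (exp (- a / s) * (a / s\<^sup>2)) = 2 * a * exp (- a / s) / (s * sqrt s)"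
        using s by (simp add: power2_eq_square field_simps)
      have 3: "4 * sqrt a * (- exp (- (a / s)) * - (sqrt a / (2 * s * sqrt s))) = 2 * a * exp (- a / s) / (s * sqrt s)"
        using a s by (simp add: field_simps)
      show ?thesis unfolding 1 2 3 by simp
    qed
    finally have "((\<lambda>s. 2 * sqrt s * (1 - exp (- a / s)) + 4 * sqrt a * gtail (sqrt a / sqrt s)) has_real_derivative
       (1 - exp (- a / s)) / sqrt s) (at s)" .
    moreover have ev: "eventually (\<lambda>s. 2 * sqrt s * (1 - exp (- a / s)) + 4 * sqrt a * gtail (sqrt a / sqrt s) = F s) (nhds s)"
      by (rule eventually_mono[OF eventually_nhds_in_open[of "{0<..}" s]]) (use s in \<open>auto simp: F_def\<close>)
    ultimately show ?thesis by (simp only: DERIV_cong_ev[OF refl ev refl])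
  qed
  have "continuous_on {0..u} F"
    unfolding continuous_on_eq_continuous_within
  proof
    fix s assume "s \<in> {0..u}"
    then consider "s > 0" | "s = 0" by fastforce
    then show "continuous (at s within {0..u}) F"
    proof cases
      case 1 then show ?thesis using DERIV_isCont[OF dF] continuous_at_imp_continuous_at_within by blast
    next
      case 2
      have "(F \<longlongrightarrow> 0) (at 0 within {0..u})"
      proof (rule Lim_null_comparison)
        show "((\<lambda>s. 4 * sqrt s) \<longlongrightarrow> 0) (at 0 within {0..u})"
          by (rule tendsto_eq_intros refl | simp)+
        have "norm (F s) \<le> 4 * sqrt s" if "s \<in> {0..u}" "s \<noteq> 0" for s
        proof -
          have s: "s > 0" using that by simp
          have e: "0 < exp (- a / s)" "exp (- a / s) \<le> 1" using a s by auto
          have "gtail (sqrt a / sqrt s) \<le> exp (- (sqrt a / sqrt s)\<^sup>2) / (2 * (sqrt a / sqrt s))"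
            using a s by (intro gtail_mills) auto
          also have "\<dots> \<le> 1 / (2 * (sqrt a / sqrt s))" using a s by (intro divide_right_mono) auto
          finally have "4 * sqrt a * gtail (sqrt a / sqrt s) \<le> 4 * sqrt a * (1 / (2 * (sqrt a / sqrt s)))"
            using a by (intro mult_left_mono) auto
          also have "\<dots> = 2 * sqrt s" using a s by (simp add: field_simps)
          finally have 1: "4 * sqrt a * gtail (sqrt a / sqrt s) \<le> 2 * sqrt s" .
          have 2: "2 * sqrt s * (1 - exp (- a / s)) \<le> 2 * sqrt s * 1" using e s by (intro mult_left_mono) auto
          have 3: "0 \<le> 2 * sqrt s * (1 - exp (- a / s))" "0 \<le> 4 * sqrt a * gtail (sqrt a / sqrt s)"
            using e s a gtail_nonneg by auto
          have "norm (F s) = 2 * sqrt s * (1 - exp (- a / s)) + 4 * sqrt a * gtail (sqrt a / sqrt s)"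
            using 3 s by (simp add: F_def)
          then show ?thesis using 1 2 by linarith
        qed
        then show "eventually (\<lambda>s. norm (F s) \<le> 4 * sqrt s) (at 0 within {0..u})"
          by (auto simp: eventually_at_filter)
      qed
      then show ?thesis using 2 by (simp add: continuous_within F_def)
    qed
  qed
  then have "((\<lambda>s. (1 - exp (- a / s)) / sqrt s) has_integral (F u - F 0)) {0..u}"
    using u dF by (intro fundamental_theorem_of_calculus_interior)
      (auto simp: has_real_derivative_iff_has_vector_derivative[symmetric])
  then show ?thesis using u by (simp add: F_def)
qed

lemma psi_gtail: "psi \<theta> r = 2 / sqrt (pi * \<theta>) *
   (1 - exp (- (r\<^sup>2 / (4 * \<theta>))) + r / sqrt \<theta> * gtail (r / (2 * sqrt \<theta>)))"
  by (simp add: psi_def gtail_def)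

text \<open>
  The integrand is the difference between the heat kernel on the line at distance 0 and at the spatial lag \<open>r * h\<close>, up to
  a factor. Its integral over the time window \<open>[0, h^2]\<close> is where \<open>psi\<close> comes from.
\<close>

lemma has_integral_psi:
  assumes \<theta>: "\<theta> > 0" and h: "h > 0" and r: "r > 0"
  shows "((\<lambda>s. (1 - exp (- ((r * h)\<^sup>2 / (4 * \<theta> * s)))) / sqrt (pi * \<theta> * s)) has_integral h * psi \<theta> r) {0..h\<^sup>2}"
proof -
  let ?a = "(r * h)\<^sup>2 / (4 * \<theta>)"
  have a: "?a > 0" "sqrt ?a = r * h / (2 * sqrt \<theta>)" using assms by (auto simp: real_sqrt_divide real_sqrt_mult)
  have "((\<lambda>s. 1 / sqrt (pi * \<theta>) * ((1 - exp (- ?a / s)) / sqrt s)) has_integral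
     1 / sqrt (pi * \<theta>) * (2 * sqrt (h\<^sup>2) * (1 - exp (- ?a / h\<^sup>2)) + 4 * sqrt ?a * gtail (sqrt ?a / sqrt (h\<^sup>2)))) {0..h\<^sup>2}"
    using h by (intro has_integral_mult_right has_integral_heat_gap a) auto
  moreover have "1 / sqrt (pi * \<theta>) * (2 * sqrt (h\<^sup>2) * (1 - exp (- ?a / h\<^sup>2)) + 4 * sqrt ?a * gtail (sqrt ?a / sqrt (h\<^sup>2)))
    = h * psi \<theta> r"
  proof -
    have 1: "- ?a / h\<^sup>2 = - (r\<^sup>2 / (4 * \<theta>))" using h by (simp add: power_mult_distrib field_simps)
    have 2: "sqrt ?a / h = r / (2 * sqrt \<theta>)" unfolding a(2) using h by simp
    have 3: "4 * sqrt ?a = 2 * h * (r / sqrt \<theta>)" unfolding a(2) by simp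
    have 4: "sqrt (h\<^sup>2) = h" using h by simp
    show ?thesis unfolding 4 1 2 unfolding 3 psi_gtail by (simp add: algebra_simps)
  qed
  moreover have "1 / sqrt (pi * \<theta>) * ((1 - exp (- ?a / s)) / sqrt s)
     = (1 - exp (- ((r * h)\<^sup>2 / (4 * \<theta> * s)))) / sqrt (pi * \<theta> * s)" for s
    by (simp add: real_sqrt_mult mult_ac)
  ultimately show ?thesis by (simp only:)
qed

text \<open>
  Up to the factor \<open>2 / sqrt (pi * \<theta>)\<close>, \<open>psi \<theta> r\<close> depends on \<open>r / sqrt \<theta>\<close> only.
\<close>

definition psi_shape :: "real \<Rightarrow> real" where
  "psi_shape x = 1 - exp (- (x\<^sup>2 / 4)) + x * gtail (x / 2)"

lemma psi_scaling:
  assumes "\<theta> > 0" shows "psi \<theta> r = 2 / sqrt (pi * \<theta>) * psi_shape (r / sqrt \<theta>)"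
  using assms by (simp add: psi_gtail psi_shape_def power_divide mult.commute)

lemma DERIV_psi_shape [derivative_intros]:
  assumes "(f has_real_derivative f') (at x within S)"
  shows "((\<lambda>x. psi_shape (f x)) has_real_derivative gtail (f x / 2) * f') (at x within S)"
proof -
  have "(psi_shape has_real_derivative gtail (x / 2)) (at x)" for x
    unfolding psi_shape_def[abs_def]
    by (auto intro!: derivative_eq_intros simp: power_divide field_simps)
  from DERIV_chain2[OF this assms] show ?thesis .
qed

lemma psi_shape_pos: assumes "x > 0" shows "psi_shape x > 0"
proof -
  have "0 < x * gtail (x / 2)" using assms gtail_pos by simp
  moreover have "exp (- (x\<^sup>2 / 4)) \<le> 1" by simp
  ultimately show ?thesis unfolding psi_shape_def by linarith
qed

lemma psi_pos: "\<theta> > 0 \<Longrightarrow> r > 0 \<Longrightarrow> psi \<theta> r > 0"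
  by (simp add: psi_scaling psi_shape_pos)

text \<open>
  The logarithmic derivative of \<open>psi_shape\<close> with respect to \<open>ln x\<close>.
\<close>

definition psi_elasticity :: "real \<Rightarrow> real" where
  "psi_elasticity x = x * gtail (x / 2) / psi_shape x"

text \<open>
  With \<open>u = x / 2\<close>, \<open>E = gtail u\<close> and \<open>q = exp (- u^2)\<close>, the numerator of the derivative is
  \<open>E * (1 - q - 2 * u^2 * q) - u * q * (1 - q)\<close>. For \<open>2 * u^2 \<ge> 1\<close> it is negative by the tail bound
  \<open>E \<le> q / (2 * u)\<close>; for smaller \<open>u\<close> the first bracket is not positive, since \<open>exp (u^2) \<le> 1 + 2 * u^2\<close>.
\<close>

lemma DERIV_psi_elasticity:
  assumes x: "x > 0"
  shows "\<exists>d<0. (psi_elasticity has_real_derivative d) (at x)"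
proof -
  define u E q where "u = x / 2" and "E = gtail u" and "q = exp (- u\<^sup>2)"
  have u: "u > 0" and E: "E > 0" using x gtail_pos by (auto simp: u_def E_def)
  have q: "0 < q" "q < 1" using u by (auto simp: q_def)
  have sh: "psi_shape x = 1 - q + 2 * u * E" "psi_shape x > 0"
    using psi_shape_pos[OF x] by (auto simp: psi_shape_def q_def E_def u_def power_divide)
  let ?d = "((E - u * q) * psi_shape x - (2 * u * E) * E) / (psi_shape x)\<^sup>2"
  have "(psi_elasticity has_real_derivative ?d) (at x)"
    unfolding psi_elasticity_def[abs_def] using sh(2)
    by (auto intro!: derivative_eq_intros simp: u_def E_def q_def power2_eq_square field_simps)
  moreover have "(E - u * q) * psi_shape x - (2 * u * E) * E < 0"
  proof -
    have Q: "(E - u * q) * psi_shape x - (2 * u * E) * E = E * (1 - q - 2 * u\<^sup>2 * q) - u * q * (1 - q)"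
      unfolding sh(1) by (simp add: algebra_simps power2_eq_square)
    have pos: "0 < u * q * (1 - q)" using u q by simp
    have "E * (1 - q - 2 * u\<^sup>2 * q) < u * q * (1 - q)"
    proof (cases "1 \<le> 2 * u\<^sup>2")
      case True
      have "E * (1 - q - 2 * u\<^sup>2 * q) < E * (1 - q)" using E q u by simp
      also have "\<dots> \<le> q / (2 * u) * (1 - q)"
        using gtail_mills[OF u] q by (intro mult_right_mono) (auto simp: E_def q_def)
      also have "\<dots> \<le> u * q * (1 - q)"
      proof (intro mult_right_mono)
        have "q * 1 \<le> q * (2 * u\<^sup>2)" using True q by (intro mult_left_mono) auto
        then show "q / (2 * u) \<le> u * q" using u by (simp add: divide_le_eq power2_eq_square mult_ac)
      qed (use q in auto)
      finally show ?thesis .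
    next
      case False
      have "exp (u\<^sup>2) \<le> 1 + u\<^sup>2 + (u\<^sup>2)\<^sup>2" using False by (intro exp_bound) auto
      also have "(u\<^sup>2)\<^sup>2 \<le> u\<^sup>2 * 1" unfolding power2_eq_square[of "u\<^sup>2"] using False by (intro mult_left_mono) auto
      finally have "exp (u\<^sup>2) * q \<le> (1 + 2 * u\<^sup>2) * q" using q by (intro mult_right_mono) auto
      moreover have "exp (u\<^sup>2) * q = 1" by (simp add: q_def flip: exp_add)
      ultimately have "1 - q - 2 * u\<^sup>2 * q \<le> 0" by (simp add: algebra_simps)
      then have "E * (1 - q - 2 * u\<^sup>2 * q) \<le> 0" using E by (simp add: mult_nonneg_nonpos)
      then show ?thesis using pos by linarith
    qed
    then show ?thesis using Q by simp
  qed
  ultimately show ?thesis using sh(2) by (intro exI[of _ ?d]) (auto intro!: divide_neg_pos)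
qed

lemma psi_elasticity_strict_antimono:
  assumes "0 < x" "x < y" shows "psi_elasticity y < psi_elasticity x"
  by (rule DERIV_neg_imp_decreasing[OF assms(2)]) (meson assms DERIV_psi_elasticity less_le_trans)

section \<open>Heat sums\<close>

text \<open>
  Two integrations by parts against \<open>(x - a) * (x - a - 1) / 2\<close>, which vanishes at both ends of the cell.
\<close>

lemma trapezoid_cell:
  fixes f f' f'' :: "real \<Rightarrow> real"
  assumes f: "\<And>x. (f has_real_derivative f' x) (at x)"
    and f': "\<And>x. (f' has_real_derivative f'' x) (at x)"
    and f'': "continuous_on UNIV f''"
    and B: "\<And>x. a \<le> x \<Longrightarrow> x \<le> a + 1 \<Longrightarrow> \<bar>f'' x\<bar> \<le> B"
  shows "\<bar>integral {a..a+1} f - (f a + f (a + 1)) / 2\<bar> \<le> B"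
proof -
  have fc: "continuous_on S f" for S
    using f by (meson DERIV_isCont continuous_at_imp_continuous_on)
  have f''c: "continuous_on S f''" for S using f'' continuous_on_subset by blast
  let ?w = "\<lambda>x. (x - a) * (x - a - 1) / 2"
  have "((\<lambda>x. f x - ?w x * f'' x) has_integral
     (((a + 1 - a - 1/2) * f (a + 1) - ?w (a + 1) * f' (a + 1)) - ((a - a - 1/2) * f a - ?w a * f' a))) {a..a+1}"
    by (rule has_integral_antiderivative) (auto intro!: derivative_eq_intros f f' simp: field_simps)
  then have 1: "((\<lambda>x. f x - ?w x * f'' x) has_integral (f a + f (a + 1)) / 2) {a..a+1}"
    by (simp add: add.commute add_divide_distrib)
  have 2: "(f has_integral integral {a..a+1} f) {a..a+1}"
    by (intro integrable_integral integrable_continuous_real fc)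
  have 3: "((\<lambda>x. ?w x * f'' x) has_integral (integral {a..a+1} f - (f a + f (a + 1)) / 2)) {a..a+1}"
    using has_integral_diff[OF 2 1] by simp
  have B0: "B \<ge> 0" using B[of a] by simp
  have "norm (integral {a..a+1} f - (f a + f (a + 1)) / 2) \<le> B * measure lborel (cbox a (a + 1))"
  proof (rule has_integral_bound[OF B0])
    show "((\<lambda>x. ?w x * f'' x) has_integral (integral {a..a+1} f - (f a + f (a + 1)) / 2)) (cbox a (a+1))"
      using 3 by simp
    fix x assume "x \<in> cbox a (a + 1)"
    then have x: "a \<le> x" "x \<le> a + 1" by auto
    have "\<bar>x - a\<bar> * \<bar>x - a - 1\<bar> \<le> 1 * 1" using x by (intro mult_mono) auto
    then have "\<bar>?w x\<bar> \<le> 1" by (simp add: abs_mult)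
    then have "\<bar>?w x\<bar> * \<bar>f'' x\<bar> \<le> 1 * B" using B[OF x] by (intro mult_mono) auto
    then show "norm (?w x * f'' x) \<le> B" by (simp add: abs_mult)
  qed
  then show ?thesis by simp
qed

text \<open>
  The term of a heat sum, as a function of a real frequency.
\<close>

definition wave :: "real \<Rightarrow> real \<Rightarrow> real \<Rightarrow> real" where
  "wave p w x = exp (- (p * x\<^sup>2)) * cos (w * x)"

definition wave'' :: "real \<Rightarrow> real \<Rightarrow> real \<Rightarrow> real" where
  "wave'' p w x = exp (- (p * x\<^sup>2)) * ((4 * p\<^sup>2 * x\<^sup>2 - 2 * p - w\<^sup>2) * cos (w * x) + 4 * p * x * w * sin (w * x))"

lemma wave_second_derivative:
  obtains f' where "\<And>x. (wave p w has_real_derivative f' x) (at x)"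
    and "\<And>x. (f' has_real_derivative wave'' p w x) (at x)"
proof
  let ?f' = "\<lambda>x. exp (- (p * x\<^sup>2)) * (- 2 * p * x * cos (w * x) - w * sin (w * x))"
  show "(wave p w has_real_derivative ?f' x) (at x)" for x
    unfolding wave_def[abs_def] by (auto intro!: derivative_eq_intros simp: algebra_simps)
  show "(?f' has_real_derivative wave'' p w x) (at x)" for x
    unfolding wave''_def by (auto intro!: derivative_eq_intros simp: algebra_simps power2_eq_square)
qed

lemma continuous_wave'': "continuous_on UNIV (wave'' p w)"
  unfolding wave''_def[abs_def] by (intro continuous_intros)

text \<open>
  Half of the exponent absorbs the polynomial factors. The other half is replaced by a rational profile,
  because \<open>sum_inverse_square_le\<close> sums the latter.
\<close>

lemma wave''_le:
  assumes p: "p > 0" and a: "0 \<le> a" "a \<le> \<bar>x\<bar>"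
  shows "\<bar>wave'' p w x\<bar> \<le> (14 * p + 3 * w\<^sup>2) * (1 / (1 + (p / 2) * a\<^sup>2))"
proof -
  let ?t = "p * x\<^sup>2" and ?c = "(4 * p\<^sup>2 * x\<^sup>2 - 2 * p - w\<^sup>2) * cos (w * x) + 4 * p * x * w * sin (w * x)"
  have t: "?t \<ge> 0" using p by simp
  have "\<bar>?c\<bar> \<le> \<bar>(4 * p\<^sup>2 * x\<^sup>2 - 2 * p - w\<^sup>2) * cos (w * x)\<bar> + \<bar>4 * p * x * w * sin (w * x)\<bar>" by (rule abs_triangle_ineq)
  also have "\<bar>(4 * p\<^sup>2 * x\<^sup>2 - 2 * p - w\<^sup>2) * cos (w * x)\<bar> \<le> (4 * p\<^sup>2 * x\<^sup>2 + 2 * p + w\<^sup>2) * 1"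
    unfolding abs_mult using p by (intro mult_mono) (auto simp: abs_le_iff)
  also have "\<bar>4 * p * x * w * sin (w * x)\<bar> \<le> \<bar>4 * p * x * w\<bar> * 1"
    unfolding abs_mult[of "4 * p * x * w"] by (intro mult_left_mono) auto
  also have "\<bar>4 * p * x * w\<bar> \<le> 2 * p\<^sup>2 * x\<^sup>2 + 2 * w\<^sup>2"
  proof -
    have "0 \<le> 2 * (\<bar>p * x\<bar> - \<bar>w\<bar>)\<^sup>2" by simp
    then show ?thesis by (simp add: power2_diff power_mult_distrib abs_mult algebra_simps)
  qed
  finally have "\<bar>?c\<bar> \<le> 6 * p * ?t + 2 * p + 3 * w\<^sup>2" by (simp add: power2_eq_square algebra_simps)
  also have "\<dots> \<le> (14 * p + 3 * w\<^sup>2) * exp (?t / 2)"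
  proof -
    have e: "1 + ?t / 2 \<le> exp (?t / 2)" by (rule exp_ge_add_one_self)
    have "6 * p * ?t + 2 * p + 3 * w\<^sup>2 \<le> (14 * p + 3 * w\<^sup>2) * (1 + ?t / 2)"
    proof -
      have "0 \<le> p * ?t" "0 \<le> w\<^sup>2 * ?t" using p t by auto
      then show ?thesis using p by (simp add: algebra_simps)
    qed
    also have "\<dots> \<le> (14 * p + 3 * w\<^sup>2) * exp (?t / 2)" using e p by (intro mult_left_mono) auto
    finally show ?thesis .
  qed
  finally have "exp (- ?t) * \<bar>?c\<bar> \<le> exp (- ?t) * ((14 * p + 3 * w\<^sup>2) * exp (?t / 2))" by (intro mult_left_mono) auto
  also have "\<dots> = (14 * p + 3 * w\<^sup>2) * exp (- (?t / 2))"
  proof -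
    have "exp (- ?t) * exp (?t / 2) = exp (- (?t / 2))" by (simp flip: exp_add)
    then show ?thesis by (simp add: mult.left_commute)
  qed
  also have "\<dots> \<le> (14 * p + 3 * w\<^sup>2) * (1 / (1 + (p / 2) * a\<^sup>2))"
  proof (intro mult_left_mono)
    have "a\<^sup>2 \<le> x\<^sup>2" using a abs_le_square_iff[of a x] by simp
    then have "1 + (p / 2) * a\<^sup>2 \<le> 1 + ?t / 2" using p by simp
    also have "\<dots> \<le> exp (?t / 2)" by (rule exp_ge_add_one_self)
    finally have "1 / exp (?t / 2) \<le> 1 / (1 + (p / 2) * a\<^sup>2)"
      using p by (intro divide_left_mono) (auto intro!: mult_pos_pos add_pos_nonneg)
    then show "exp (- (?t / 2)) \<le> 1 / (1 + (p / 2) * a\<^sup>2)" by (simp add: exp_minus inverse_eq_divide)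
  qed (use p in auto)
  finally show ?thesis by (simp add: wave''_def abs_mult)
qed

lemma sum_lorentz_le:
  assumes p: "p > 0"
  shows "(\<Sum>l<L. 1 / (1 + (p / 2) * (real l)\<^sup>2)) \<le> 1 + 4 / sqrt p"
proof (cases L)
  case (Suc L')
  have s: "sqrt p > 0" "(sqrt (p / 2))\<^sup>2 = p / 2" using p by auto
  have "(\<Sum>l<L. 1 / (1 + (p / 2) * (real l)\<^sup>2)) = 1 + (\<Sum>l<L'. 1 / (1 + (sqrt (p / 2))\<^sup>2 * (real (Suc l))\<^sup>2))"
    unfolding Suc s(2) by (subst sum.lessThan_Suc_shift) simp
  also have "\<dots> \<le> 1 + 2 / sqrt (p / 2)"
    using p by (intro add_left_mono sum_inverse_square_le) auto
  also have "2 / sqrt (p / 2) \<le> 4 / sqrt p"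
  proof -
    have "sqrt 2 \<le> 2" by (simp add: real_le_lsqrt)
    then show ?thesis using s by (simp add: real_sqrt_divide divide_simps)
  qed
  finally show ?thesis by simp
qed (use p in simp)

text \<open>
  For \<open>p = pi^2 * \<theta> * s\<close> and \<open>w = pi * y\<close> this is the cosine series, without its constant term,
  of the heat kernel with period 2 and diffusivity \<open>\<theta>\<close> at time \<open>s\<close>.
\<close>

definition heat_sum :: "real \<Rightarrow> real \<Rightarrow> real" where
  "heat_sum p w = (\<Sum>l. wave p w (real (Suc l)))"

lemma summable_lorentz:
  assumes p: "p > 0"
  shows "summable (\<lambda>l. 1 / (1 + (p / 2) * (real l)\<^sup>2))"
  by (rule summableI_nonneg_bounded[OF _ sum_lorentz_le[OF p]]) (use p in \<open>auto intro!: divide_nonneg_nonneg\<close>)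

lemma abs_wave_le:
  assumes p: "p > 0" and l: "0 \<le> x"
  shows "\<bar>wave p w x\<bar> \<le> 1 / (1 + (p / 2) * x\<^sup>2)"
proof -
  have "\<bar>wave p w x\<bar> \<le> exp (- (p * x\<^sup>2)) * 1"
    unfolding wave_def abs_mult by (intro mult_mono) auto
  also have "\<dots> \<le> 1 / (1 + (p / 2) * x\<^sup>2)"
  proof -
    have "1 + (p / 2) * x\<^sup>2 \<le> 1 + p * x\<^sup>2" using p by (simp add: mult_right_mono)
    also have "\<dots> \<le> exp (p * x\<^sup>2)" by (rule exp_ge_add_one_self)
    finally have "1 / exp (p * x\<^sup>2) \<le> 1 / (1 + (p / 2) * x\<^sup>2)"
      using p by (intro divide_left_mono) (auto intro!: mult_pos_pos add_pos_nonneg)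
    then show ?thesis by (simp add: exp_minus inverse_eq_divide)
  qed
  finally show ?thesis .
qed

lemma summable_wave: assumes p: "p > 0" shows "summable (\<lambda>l. wave p w (real l))"
  by (rule summable_comparison_test'[OF summable_lorentz[OF p], of 0]) (use abs_wave_le[OF p] in auto)

lemma summable_wave_Suc: assumes p: "p > 0" shows "summable (\<lambda>l. wave p w (real (Suc l)))"
  using summable_wave[OF p, of w] by (subst summable_Suc_iff)

lemma heat_sum_sums: "p > 0 \<Longrightarrow> (\<lambda>l. wave p w (real (Suc l))) sums heat_sum p w"
  unfolding heat_sum_def by (intro summable_sums summable_wave_Suc)

text \<open>
  The real part of the characteristic function of the standard normal distribution.
\<close>

lemma gauss_cos_integral:
  "has_bochner_integral lborel (\<lambda>x. exp (- (x\<^sup>2 / 2)) * cos (t * x)) (sqrt (2 * pi) * exp (- (t\<^sup>2) / 2))"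
proof -
  have i: "integrable lborel (\<lambda>x. std_normal_density x *\<^sub>R iexp (t * x))"
    by (rule Bochner_Integration.integrable_bound[OF integrable_normal_density[of 1 0]]) auto
  have "complex_of_real (exp (- (t^2) / 2)) = char std_normal_distribution t" by (simp add: char_std_normal_distribution)
  also have "\<dots> = (CLINT x|lborel. std_normal_density x *\<^sub>R iexp (t * x))"
    unfolding char_def by (subst integral_density) (auto simp: mult.commute)
  finally have "complex_of_real (exp (- (t^2) / 2)) = \<dots>" .
  then have "exp (- (t^2) / 2) = Re (CLINT x|lborel. std_normal_density x *\<^sub>R iexp (t * x))"
    by (metis Re_complex_of_real)
  also have "\<dots> = (LINT x|lborel. Re (std_normal_density x *\<^sub>R iexp (t * x)))"
    using integral_Re[OF i] by simp
  also have "\<dots> = (LINT x|lborel. std_normal_density x * cos (t * x))"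
    by (simp add: cos_of_real Re_exp)
  finally have e: "(LINT x|lborel. std_normal_density x * cos (t * x)) = exp (- (t^2) / 2)" by simp
  have "integrable lborel (\<lambda>x. std_normal_density x * cos (t * x))"
    by (rule Bochner_Integration.integrable_bound[OF integrable_normal_density[of 1 0]])
       (auto simp: abs_mult intro!: mult_right_le_one_le)
  then have "has_bochner_integral lborel (\<lambda>x. std_normal_density x * cos (t * x)) (exp (- (t^2) / 2))"
    using e by (simp add: has_bochner_integral_iff)
  then have "has_bochner_integral lborel (\<lambda>x. sqrt (2 * pi) * (std_normal_density x * cos (t * x))) (sqrt (2 * pi) * exp (- (t^2) / 2))"
    by (rule has_bochner_integral_mult_right)
  then show ?thesis by (simp add: std_normal_density_def)
qed

lemma wave_integral:
  assumes p: "p > 0"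
  shows "has_bochner_integral lborel (wave p w) (sqrt (pi / p) * exp (- (w\<^sup>2 / (4 * p))))"
proof -
  let ?c = "sqrt (2 * p)"
  have c: "?c > 0" "?c \<noteq> 0" using p by auto
  have "has_bochner_integral lborel (\<lambda>x. exp (- ((0 + ?c * x)\<^sup>2 / 2)) * cos (w / ?c * (0 + ?c * x)))
      ((sqrt (2 * pi) * exp (- ((w / ?c)\<^sup>2) / 2)) /\<^sub>R \<bar>?c\<bar>)"
    by (rule lborel_has_bochner_integral_real_affine_iff[OF c(2), THEN iffD1, OF gauss_cos_integral])
  moreover have "exp (- ((0 + ?c * x)\<^sup>2 / 2)) * cos (w / ?c * (0 + ?c * x)) = wave p w x" for x
    using p c by (simp add: wave_def power_mult_distrib)
  moreover have "(sqrt (2 * pi) * exp (- ((w / ?c)\<^sup>2) / 2)) /\<^sub>R \<bar>?c\<bar> = sqrt (pi / p) * exp (- (w\<^sup>2 / (4 * p)))"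
  proof -
    have "sqrt (2 * pi) / ?c = sqrt (pi / p)" using p by (simp flip: real_sqrt_divide)
    moreover have "- ((w / ?c)\<^sup>2) / 2 = - (w\<^sup>2 / (4 * p))" using p by (simp add: power_divide)
    ultimately show ?thesis using c by (simp add: field_simps)
  qed
  ultimately show ?thesis by (simp only:)
qed

lemma wave_half_line:
  assumes p: "p > 0"
  shows "(\<lambda>L. integral {0..real L} (wave p w)) \<longlonglongrightarrow> sqrt (pi / p) * exp (- (w\<^sup>2 / (4 * p))) / 2"
proof -
  have wc: "continuous_on S (wave p w)" for S unfolding wave_def[abs_def] by (intro continuous_intros)
  have int: "integrable lborel (wave p w)"
    using wave_integral[OF p, of w] by (rule integrable.intros)
  have "(\<lambda>L. LINT x|lborel. indicator {- real L..real L} x *\<^sub>R wave p w x) \<longlonglongrightarrow> (LINT x|lborel. wave p w x)"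
  proof (rule integral_dominated_convergence)
    show "integrable lborel (\<lambda>x. norm (wave p w x))" using int by (rule integrable_norm)
    show "AE x in lborel. (\<lambda>L. indicator {- real L..real L} x *\<^sub>R wave p w x) \<longlonglongrightarrow> wave p w x"
    proof (intro AE_I2 tendsto_eventually)
      fix x :: real
      obtain n where n: "\<bar>x\<bar> \<le> real n" using real_arch_simple by blast
      show "eventually (\<lambda>L. indicator {- real L..real L} x *\<^sub>R wave p w x = wave p w x) sequentially"
        by (rule eventually_mono[OF eventually_ge_at_top[of n]]) (use n in \<open>auto simp: indicator_def\<close>)
    qed
  qed (use int in \<open>auto simp: indicator_def\<close>)
  moreover have "(LINT x|lborel. indicator {- real L..real L} x *\<^sub>R wave p w x) = 2 * integral {0..real L} (wave p w)" for L
  proof -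
    have "set_integrable lborel {- real L..real L} (wave p w)"
      by (intro borel_integrable_atLeastAtMost' wc)
    from set_borel_integral_eq_integral(2)[OF this]
    have "(LINT x|lborel. indicator {- real L..real L} x *\<^sub>R wave p w x) = integral {- real L..real L} (wave p w)"
      by (simp add: set_lebesgue_integral_def)
    also have "\<dots> = integral {- real L..0} (wave p w) + integral {0..real L} (wave p w)"
      by (intro Henstock_Kurzweil_Integration.integral_combine[symmetric] integrable_continuous_real wc) auto
    also have "integral {- real L..0} (wave p w) = integral {0..real L} (wave p w)"
      using Henstock_Kurzweil_Integration.integral_reflect_real[of "real L" 0 "wave p w"] by (simp add: wave_def[abs_def])
    finally show ?thesis by simp
  qed
  moreover have "(LINT x|lborel. wave p w x) = sqrt (pi / p) * exp (- (w\<^sup>2 / (4 * p)))"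
    using wave_integral[OF p, of w] by (rule has_bochner_integral_integral_eq)
  ultimately have "(\<lambda>L. 2 * integral {0..real L} (wave p w)) \<longlonglongrightarrow> sqrt (pi / p) * exp (- (w\<^sup>2 / (4 * p)))" by simp
  from tendsto_divide[OF this tendsto_const, of 2] show ?thesis by simp
qed

text \<open>
  The heat sum is a trapezoid sum with unit step, the summand \<open>1 / 2\<close> being the weight of the end point 0. The
  error involves \<open>w^2\<close>, so this is used for positions \<open>w\<close> of the order of the spatial lag only.
\<close>

lemma heat_sum_trapezoid:
  assumes p: "p > 0"
  shows "\<bar>heat_sum p w + 1 / 2 - sqrt (pi / p) * exp (- (w\<^sup>2 / (4 * p))) / 2\<bar>
    \<le> (14 * p + 3 * w\<^sup>2) * (1 + 4 / sqrt p)"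
proof -
  let ?f = "wave p w" and ?I = "sqrt (pi / p) * exp (- (w\<^sup>2 / (4 * p))) / 2"
  obtain f' where f': "\<And>x. (?f has_real_derivative f' x) (at x)" "\<And>x. (f' has_real_derivative wave'' p w x) (at x)"
    using wave_second_derivative[of p w] by blast
  have wc: "continuous_on S ?f" for S unfolding wave_def[abs_def] by (intro continuous_intros)
  have cell: "\<bar>integral {real l..real l + 1} ?f - (?f (real l) + ?f (real l + 1)) / 2\<bar>
      \<le> (14 * p + 3 * w\<^sup>2) * (1 / (1 + (p / 2) * (real l)\<^sup>2))" for l
    by (rule trapezoid_cell[OF f' continuous_wave'']) (rule wave''_le[OF p]; simp)
  have comb: "integral {0..real L} ?f = (\<Sum>l<L. integral {real l..real l + 1} ?f)" for L
  proof (induction L)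
    case (Suc L)
    have "integral {0..real L} ?f + integral {real L..real (Suc L)} ?f = integral {0..real (Suc L)} ?f"
      by (intro Henstock_Kurzweil_Integration.integral_combine integrable_continuous_real wc) auto
    then show ?case using Suc by (simp add: add.commute)
  qed simp
  have tr: "(\<Sum>l<L. (?f (real l) + ?f (real l + 1)) / 2) = 1 / 2 + (\<Sum>l<L. ?f (real (Suc l))) - ?f (real L) / 2" for L
    by (induction L) (auto simp: wave_def field_simps)
  have le: "\<bar>integral {0..real L} ?f - (1 / 2 + (\<Sum>l<L. ?f (real (Suc l))) - ?f (real L) / 2)\<bar>
      \<le> (14 * p + 3 * w\<^sup>2) * (1 + 4 / sqrt p)" for L
  proof -
    have "\<bar>integral {0..real L} ?f - (1 / 2 + (\<Sum>l<L. ?f (real (Suc l))) - ?f (real L) / 2)\<bar>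
      = \<bar>\<Sum>l<L. integral {real l..real l + 1} ?f - (?f (real l) + ?f (real l + 1)) / 2\<bar>"
      unfolding tr[symmetric] comb sum_subtractf ..
    also have "\<dots> \<le> (\<Sum>l<L. (14 * p + 3 * w\<^sup>2) * (1 / (1 + (p / 2) * (real l)\<^sup>2)))"
      by (rule order_trans[OF sum_abs sum_mono]) (rule cell)
    also have "\<dots> \<le> (14 * p + 3 * w\<^sup>2) * (1 + 4 / sqrt p)"
      unfolding sum_distrib_left[symmetric] using p by (intro mult_left_mono sum_lorentz_le) auto
    finally show ?thesis .
  qed
  have "(\<lambda>L. \<bar>integral {0..real L} ?f - (1 / 2 + (\<Sum>l<L. ?f (real (Suc l))) - ?f (real L) / 2)\<bar>)
     \<longlonglongrightarrow> \<bar>?I - (1 / 2 + heat_sum p w - 0 / 2)\<bar>"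
    using heat_sum_sums[OF p, of w] summable_LIMSEQ_zero[OF summable_wave[OF p, of w]]
    by (intro tendsto_intros wave_half_line[OF p]) (auto simp: sums_def)
  then have "\<bar>?I - (1 / 2 + heat_sum p w - 0 / 2)\<bar> \<le> (14 * p + 3 * w\<^sup>2) * (1 + 4 / sqrt p)"
    by (rule LIMSEQ_le_const2) (use le in auto)
  then show ?thesis by (simp add: abs_minus_commute algebra_simps)
qed

lemma wave_second_difference:
  assumes p: "p > 0"
  shows "\<bar>wave p 0 (real l) - 2 * wave p 0 (real (Suc l)) + wave p 0 (real (Suc (Suc l)))\<bar>
    \<le> 14 * p * (1 / (1 + (p / 2) * (real l)\<^sup>2))"
proof -
  obtain f' where f': "\<And>x. (wave p 0 has_real_derivative f' x) (at x)" "\<And>x. (f' has_real_derivative wave'' p 0 x) (at x)"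
    using wave_second_derivative[of p 0] by blast
  let ?g = "\<lambda>x. wave p 0 (x + 1) - wave p 0 x"
  have "(?g has_real_derivative (f' (x + 1) - f' x)) (at x)" for x
    by (auto intro!: derivative_eq_intros f' DERIV_shift[THEN iffD1])
  then obtain z where z: "real l < z" "z < real l + 1"
    "?g (real l + 1) - ?g (real l) = (real l + 1 - real l) * (f' (z + 1) - f' z)"
    using MVT2[of "real l" "real l + 1" ?g "\<lambda>x. f' (x + 1) - f' x"] by auto
  obtain y where y: "z < y" "y < z + 1" "f' (z + 1) - f' z = (z + 1 - z) * wave'' p 0 y"
    using MVT2[of z "z + 1" f' "wave'' p 0"] f'(2) by auto
  have "wave p 0 (real l) - 2 * wave p 0 (real (Suc l)) + wave p 0 (real (Suc (Suc l))) = wave'' p 0 y"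
    using z(3) y(3) by (simp add: algebra_simps)
  moreover have "\<bar>wave'' p 0 y\<bar> \<le> (14 * p + 3 * 0\<^sup>2) * (1 / (1 + (p / 2) * (real l)\<^sup>2))"
    using z y by (intro wave''_le p) auto
  ultimately show ?thesis by simp
qed

text \<open>
  For \<open>w\<close> away from the multiples of \<open>2 * pi\<close> the oscillation of the cosine beats the Gaussian integral:
  two summations by parts produce the factor \<open>2 - 2 * cos w\<close> on one side and second differences of the
  slowly varying weights on the other.
\<close>

lemma heat_sum_off_diagonal:
  assumes p: "p > 0" and w: "cos w < 1"
  shows "\<bar>heat_sum p w + 1 / 2\<bar> \<le> (15 * p + 56 * sqrt p) / (2 * (1 - cos w))"
proof -
  let ?a = "\<lambda>l. wave p 0 (real l)"
  let ?c = "\<lambda>l. cos (w * real l)"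
  let ?D = "\<lambda>l. ?a l - 2 * ?a (Suc l) + ?a (Suc (Suc l))"
  have wa: "wave p w (real l) = ?a l * ?c l" for l by (simp add: wave_def)
  have parts: "(2 - 2 * cos w) * (1 / 2 + (\<Sum>l<L. ?a (Suc l) * ?c (Suc l)))
      = (1 - ?a 1) - (\<Sum>l<L. ?D l * ?c (Suc l)) + (?a (Suc L) * ?c L - ?a L * ?c (Suc L))" for L
  proof (induction L)
    case (Suc L)
    have "2 * cos w * ?c (Suc L) = ?c (Suc (Suc L)) + ?c L"
    proof -
      have "w * real (Suc (Suc L)) = w * real (Suc L) + w" "w * real L = w * real (Suc L) - w"
        by (simp_all add: algebra_simps)
      then show ?thesis by (simp only: cos_add cos_diff) simp
    qed
    then have "2 * cos w * (?a (Suc L) * ?c (Suc L)) = ?a (Suc L) * (?c (Suc (Suc L)) + ?c L)"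
      by (metis mult.left_commute)
    then show ?case using Suc.IH by (simp add: algebra_simps)
  qed (simp add: wave_def)
  have a1: "0 \<le> 1 - ?a 1" "1 - ?a 1 \<le> p"
    using p exp_ge_add_one_self[of "- p"] by (auto simp: wave_def)
  have le: "\<bar>(2 - 2 * cos w) * (1 / 2 + (\<Sum>l<L. ?a (Suc l) * ?c (Suc l)))\<bar>
     \<le> 15 * p + 56 * sqrt p + (\<bar>?a (Suc L)\<bar> + \<bar>?a L\<bar>)" for L
  proof -
    have "\<bar>\<Sum>l<L. ?D l * ?c (Suc l)\<bar> \<le> (\<Sum>l<L. 14 * p * (1 / (1 + (p / 2) * (real l)\<^sup>2)))"
    proof (rule order_trans[OF sum_abs sum_mono])
      fix l
      have "\<bar>?D l * ?c (Suc l)\<bar> \<le> \<bar>?D l\<bar> * 1" unfolding abs_mult by (intro mult_left_mono) auto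
      also have "\<dots> \<le> 14 * p * (1 / (1 + (p / 2) * (real l)\<^sup>2))" using wave_second_difference[OF p] by simp
      finally show "\<bar>?D l * ?c (Suc l)\<bar> \<le> 14 * p * (1 / (1 + (p / 2) * (real l)\<^sup>2))" .
    qed
    also have "\<dots> \<le> 14 * p * (1 + 4 / sqrt p)"
      unfolding sum_distrib_left[symmetric] using p by (intro mult_left_mono sum_lorentz_le) auto
    also have "\<dots> = 14 * p + 56 * sqrt p"
    proof -
      have "14 * p * (1 + 4 / sqrt p) = 14 * p + 56 * (p / sqrt p)" by (simp add: algebra_simps)
      then show ?thesis using p by (simp add: real_div_sqrt)
    qed
    finally have 1: "\<bar>\<Sum>l<L. ?D l * ?c (Suc l)\<bar> \<le> 14 * p + 56 * sqrt p" .
    have 2: "\<bar>?a (Suc L) * ?c L\<bar> \<le> \<bar>?a (Suc L)\<bar> * 1" "\<bar>?a L * ?c (Suc L)\<bar> \<le> \<bar>?a L\<bar> * 1"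
      unfolding abs_mult by (intro mult_left_mono; simp)+
    show ?thesis unfolding parts using 1 2 a1 by linarith
  qed
  have a0: "(\<lambda>l. ?a l) \<longlonglongrightarrow> 0" by (rule summable_LIMSEQ_zero[OF summable_wave[OF p]])
  have "\<bar>(2 - 2 * cos w) * (1 / 2 + heat_sum p w)\<bar> \<le> 15 * p + 56 * sqrt p + (\<bar>0\<bar> + \<bar>0\<bar>)"
  proof (rule LIMSEQ_le)
    show "(\<lambda>L. \<bar>(2 - 2 * cos w) * (1 / 2 + (\<Sum>l<L. ?a (Suc l) * ?c (Suc l)))\<bar>) \<longlonglongrightarrow> \<bar>(2 - 2 * cos w) * (1 / 2 + heat_sum p w)\<bar>"
      using heat_sum_sums[OF p, of w] by (intro tendsto_intros) (simp only: wa sums_def)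
    show "(\<lambda>L. 15 * p + 56 * sqrt p + (\<bar>?a (Suc L)\<bar> + \<bar>?a L\<bar>)) \<longlonglongrightarrow> 15 * p + 56 * sqrt p + (\<bar>0\<bar> + \<bar>0\<bar>)"
      by (intro tendsto_intros a0 LIMSEQ_Suc[OF a0])
  qed (use le in auto)
  moreover have "\<bar>(2 - 2 * cos w) * (1 / 2 + heat_sum p w)\<bar> = \<bar>heat_sum p w + 1 / 2\<bar> * (2 * (1 - cos w))"
    using w by (subst abs_mult) (simp add: add.commute algebra_simps)
  ultimately show ?thesis using w by (simp add: pos_le_divide_eq)
qed

section \<open>The second moment of a double increment\<close>

text \<open>
  The discrepancy between the tilts at the two end points of a spatial increment is of second order.
\<close>

lemma exp_symmetric_excess:
  "0 \<le> exp x + exp (- x) - 2" "exp x + exp (- x) - 2 \<le> x\<^sup>2 * exp (3 * \<bar>x :: real\<bar>)"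
proof -
  have eq: "exp x + exp (- x) - 2 = exp (- x) * (exp x - 1)\<^sup>2"
    by (simp add: power2_eq_square algebra_simps flip: exp_add)
  then show "0 \<le> exp x + exp (- x) - 2" by simp
  have "\<bar>exp x - 1\<bar>\<^sup>2 \<le> (\<bar>x\<bar> * exp \<bar>x\<bar>)\<^sup>2" by (intro power_mono abs_exp_minus_one_le) auto
  then have "exp (- x) * (exp x - 1)\<^sup>2 \<le> exp \<bar>x\<bar> * (x\<^sup>2 * exp (2 * \<bar>x\<bar>))"
    by (intro mult_mono) (auto simp: power_mult_distrib exp_double)
  also have "\<dots> = x\<^sup>2 * exp (3 * \<bar>x\<bar>)" by (simp add: mult.left_commute flip: exp_add)
  finally show "exp x + exp (- x) - 2 \<le> x\<^sup>2 * exp (3 * \<bar>x\<bar>)" by (simp add: eq)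
qed

lemma cos_interior_le:
  assumes "0 < b" "b < 1 / 2" "b \<le> y" "y \<le> 1 - b"
  shows "cos (2 * pi * y) \<le> cos (2 * pi * b)" "cos (2 * pi * b) < 1"
proof -
  show "cos (2 * pi * b) < 1"
    using cos_monotone_0_pi[of 0 "2 * pi * b"] assms by simp
  show "cos (2 * pi * y) \<le> cos (2 * pi * b)"
  proof (cases "y \<le> 1 / 2")
    case True
    then show ?thesis using assms by (intro cos_monotone_0_pi_le) auto
  next
    case False
    have "cos (2 * pi * y) = cos (2 * pi * (1 - y))"
      by (simp add: cos_diff right_diff_distrib)
    also have "\<dots> \<le> cos (2 * pi * b)" using assms False by (intro cos_monotone_0_pi_le) auto
    finally show ?thesis .
  qed
qed

text \<open>
  Centred at the midpoint \<open>z\<close>, the tilt factors out up to its symmetric part, and the products of sines become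
  cosines at the five positions \<open>0\<close>, \<open>2 * z + d\<close>, \<open>2 * z - d\<close>, \<open>d\<close> and \<open>2 * z\<close> (times \<open>pi\<close>).
\<close>

lemma eigfun_increment_square:
  fixes z d \<kappa> :: real
  shows "(eigfun \<kappa> l (z + d / 2) - eigfun \<kappa> l (z - d / 2))\<^sup>2 = exp (- \<kappa> * z) *
    ((exp (- (\<kappa> * d / 2)) + exp (\<kappa> * d / 2)) * cos (0 * real l)
      - exp (- (\<kappa> * d / 2)) * cos (2 * pi * (z + d / 2) * real l)
      - exp (\<kappa> * d / 2) * cos (2 * pi * (z - d / 2) * real l)
      - 2 * cos (pi * d * real l) + 2 * cos (2 * pi * z * real l))"
proof -
  define s1 s2 q where "s1 = sin (pi * real l * (z - d / 2))" and "s2 = sin (pi * real l * (z + d / 2))"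
    and "q = exp (\<kappa> * d / 4)"
  have e2: "eigfun \<kappa> l (z + d / 2) = sqrt 2 * exp (- (\<kappa> * z / 2)) * (s2 * exp (- (\<kappa> * d / 4)))"
    by (simp add: eigfun_def s2_def algebra_simps add_divide_distrib diff_divide_distrib flip: exp_add)
  have e1: "eigfun \<kappa> l (z - d / 2) = sqrt 2 * exp (- (\<kappa> * z / 2)) * (s1 * exp (\<kappa> * d / 4))"
    by (simp add: eigfun_def s1_def algebra_simps add_divide_distrib diff_divide_distrib flip: exp_add)
  have sq: "(exp (- (\<kappa> * z / 2)))\<^sup>2 = exp (- \<kappa> * z)" "(exp (- (\<kappa> * d / 4)))\<^sup>2 = exp (- (\<kappa> * d / 2))"
    "(exp (\<kappa> * d / 4))\<^sup>2 = exp (\<kappa> * d / 2)" by (simp_all flip: exp_double)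
  have one: "exp (- (\<kappa> * d / 4)) * exp (\<kappa> * d / 4) = 1" by (simp flip: exp_add)
  have "(eigfun \<kappa> l (z + d / 2) - eigfun \<kappa> l (z - d / 2))\<^sup>2
     = 2 * (exp (- (\<kappa> * z / 2)))\<^sup>2 * (s2\<^sup>2 * (exp (- (\<kappa> * d / 4)))\<^sup>2 + s1\<^sup>2 * (exp (\<kappa> * d / 4))\<^sup>2
       - 2 * s2 * s1 * (exp (- (\<kappa> * d / 4)) * exp (\<kappa> * d / 4)))"
    unfolding e1 e2 right_diff_distrib[symmetric] power_mult_distrib by (simp add: power2_diff power_mult_distrib algebra_simps)
  also have "\<dots> = exp (- \<kappa> * z) * ((2 * s2\<^sup>2) * exp (- (\<kappa> * d / 2)) + (2 * s1\<^sup>2) * exp (\<kappa> * d / 2) - 4 * (s2 * s1))"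
    unfolding sq one by (simp add: algebra_simps)
  also have "2 * s2\<^sup>2 = 1 - cos (2 * pi * (z + d / 2) * real l)"
    using cos_double_sin[of "pi * real l * (z + d / 2)"] by (simp add: s2_def mult_ac)
  also have "2 * s1\<^sup>2 = 1 - cos (2 * pi * (z - d / 2) * real l)"
    using cos_double_sin[of "pi * real l * (z - d / 2)"] by (simp add: s1_def mult_ac)
  also have "4 * (s2 * s1) = 2 * (cos (pi * d * real l) - cos (2 * pi * z * real l))"
  proof -
    have "pi * real l * (z + d / 2) - pi * real l * (z - d / 2) = pi * d * real l"
      "pi * real l * (z + d / 2) + pi * real l * (z - d / 2) = 2 * pi * z * real l" by (simp_all add: algebra_simps)
    then show ?thesis unfolding s1_def s2_def sin_times_sin by simp
  qed
  finally show ?thesis by (simp add: algebra_simps)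
qed

text \<open>
  The sum over the modes of the squared increments in \<open>eigfun_increment_square\<close>, with Gaussian weights and the tilt
  at the midpoint removed.
\<close>

definition bracket :: "real \<Rightarrow> real \<Rightarrow> real \<Rightarrow> real \<Rightarrow> real" where
  "bracket \<kappa> p z d =
     (exp (- (\<kappa> * d / 2)) + exp (\<kappa> * d / 2)) * heat_sum p 0
      - exp (- (\<kappa> * d / 2)) * heat_sum p (2 * pi * (z + d / 2))
      - exp (\<kappa> * d / 2) * heat_sum p (2 * pi * (z - d / 2))
      - 2 * heat_sum p (pi * d) + 2 * heat_sum p (2 * pi * z)"

lemma bracket_sums:
  assumes p: "p > 0"
  shows "(\<lambda>l. exp (- (p * (real (Suc l))\<^sup>2)) * (eigfun \<kappa> (Suc l) (z + d / 2) - eigfun \<kappa> (Suc l) (z - d / 2))\<^sup>2)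
     sums (exp (- \<kappa> * z) * bracket \<kappa> p z d)"
proof -
  have "(\<lambda>l. exp (- \<kappa> * z) * (
     (exp (- (\<kappa> * d / 2)) + exp (\<kappa> * d / 2)) * wave p 0 (real (Suc l))
      - exp (- (\<kappa> * d / 2)) * wave p (2 * pi * (z + d / 2)) (real (Suc l))
      - exp (\<kappa> * d / 2) * wave p (2 * pi * (z - d / 2)) (real (Suc l))
      - 2 * wave p (pi * d) (real (Suc l)) + 2 * wave p (2 * pi * z) (real (Suc l))))
     sums (exp (- \<kappa> * z) * bracket \<kappa> p z d)"
    unfolding bracket_def by (intro sums_mult sums_add sums_diff heat_sum_sums p)
  moreover have "exp (- (p * (real (Suc l))\<^sup>2)) * (eigfun \<kappa> (Suc l) (z + d / 2) - eigfun \<kappa> (Suc l) (z - d / 2))\<^sup>2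
    = exp (- \<kappa> * z) * (
     (exp (- (\<kappa> * d / 2)) + exp (\<kappa> * d / 2)) * wave p 0 (real (Suc l))
      - exp (- (\<kappa> * d / 2)) * wave p (2 * pi * (z + d / 2)) (real (Suc l))
      - exp (\<kappa> * d / 2) * wave p (2 * pi * (z - d / 2)) (real (Suc l))
      - 2 * wave p (pi * d) (real (Suc l)) + 2 * wave p (2 * pi * z) (real (Suc l)))" for l
    unfolding eigfun_increment_square wave_def by (simp add: algebra_simps del: of_nat_Suc)
  ultimately show ?thesis by (simp only:)
qed

text \<open>
  Every heat sum contains the constant \<open>-1/2\<close>, but the five coefficients add up to zero. The coefficient at
  position 0 exceeds 2 by a quantity of second order (\<open>exp_symmetric_excess\<close>). The positions \<open>2 * z\<close> and \<open>2 * z + d\<close>, \<open>2 * z - d\<close> stay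
  away from 0 and 2 and contribute only errors of the order \<open>sqrt s\<close>. The positions \<open>0\<close> and \<open>d\<close> give the heat kernel gap.
\<close>

lemma bracket_expansion:
  assumes b: "0 < b" "b < 1 / 2" and th: "\<theta> > 0"
  obtains C where "C \<ge> 0"
    and "\<And>s z d. 0 < s \<Longrightarrow> s \<le> 1 \<Longrightarrow> 0 \<le> d \<Longrightarrow> b \<le> z - d / 2 \<Longrightarrow> z + d / 2 \<le> 1 - b \<Longrightarrow>
      \<bar>bracket \<kappa> (pi\<^sup>2 * \<theta> * s) z d - (1 - exp (- (d\<^sup>2 / (4 * \<theta> * s)))) / sqrt (pi * \<theta> * s)\<bar>
        \<le> C * (sqrt s + d\<^sup>2 / sqrt s)"
proof -
  define P0 where "P0 = pi\<^sup>2 * \<theta>"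
  (* c1 and c3 come from the trapezoid rule, c2 from the off-diagonal bound, c4 from the tilt,
     and c5 / sqrt s is the heat kernel on the diagonal. *)
  have P0: "P0 > 0" using th by (simp add: P0_def)
  define c1 where "c1 = 14 * P0 + 56 * sqrt P0"
  define c2 where "c2 = (15 * P0 + 56 * sqrt P0) / (2 * (1 - cos (2 * pi * b)))"
  define c3 where "c3 = 3 * pi\<^sup>2 * (1 + 4 / sqrt P0)"
  define c4 where "c4 = \<kappa>\<^sup>2 * exp (2 * \<bar>\<kappa>\<bar>)"
  define c5 where "c5 = 1 / (2 * sqrt (pi * \<theta>))"
  define K where "K = exp \<bar>\<kappa>\<bar>"
  have cb: "cos (2 * pi * b) < 1" using cos_interior_le(2)[of b b] b by simp
  have nn: "c1 \<ge> 0" "c2 \<ge> 0" "c3 \<ge> 0" "c4 \<ge> 0" "c5 \<ge> 0" "K \<ge> 0"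
    using P0 cb th by (auto simp: c1_def c2_def c3_def c4_def c5_def K_def)
  define C where "C = c4 * (c5 + c1) + 4 * c1 + 2 * c3 + 2 * K * c2 + 2 * c2"
  show ?thesis
  proof
    show "C \<ge> 0" using nn by (simp add: C_def)
    fix s z d :: real
    assume s: "0 < s" "s \<le> 1" and d: "0 \<le> d" and z: "b \<le> z - d / 2" "z + d / 2 \<le> 1 - b"
    let ?p = "pi\<^sup>2 * \<theta> * s" and ?r = "sqrt s"
    have r: "?r > 0" "?r \<le> 1" "s \<le> ?r" "1 \<le> 1 / ?r" "?r \<le> 1 / ?r"
    proof -
      show r0: "?r > 0" "?r \<le> 1" using s by auto
      have "?r * ?r \<le> ?r * 1" using r0 by (intro mult_left_mono) auto
      then show "s \<le> ?r" using s by simp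
      show "1 \<le> 1 / ?r" using r0 by simp
      then show "?r \<le> 1 / ?r" using r0 by linarith
    qed
    have p: "?p > 0" "?p = P0 * s" "sqrt ?p = sqrt P0 * ?r" using s th by (auto simp: P0_def real_sqrt_mult)
    have pr: "?p \<le> P0 * ?r" unfolding p(2) using r P0 by (intro mult_left_mono) auto
    have d1: "d \<le> 1" using z b by simp
    define Q where "Q = 1 / sqrt (pi * \<theta> * s)"
    have Q: "sqrt (pi / ?p) = Q" "Q / 2 = c5 / ?r" "Q \<ge> 0"
    proof -
      have "pi / ?p = 1 / (pi * \<theta> * s)" by (simp add: power2_eq_square)
      then show "sqrt (pi / ?p) = Q" by (simp add: Q_def real_sqrt_divide)
      show "Q / 2 = c5 / ?r" by (simp add: Q_def c5_def real_sqrt_mult)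
      show "Q \<ge> 0" using s th by (simp add: Q_def)
    qed
    define q where "q = exp (- (d\<^sup>2 / (4 * \<theta> * s)))"
    define R0 where "R0 = heat_sum ?p 0 + 1 / 2 - Q / 2"
    define Rd where "Rd = heat_sum ?p (pi * d) + 1 / 2 - Q * q / 2"
    define e1 e2 ez where "e1 = heat_sum ?p (2 * pi * (z + d / 2)) + 1 / 2"
      and "e2 = heat_sum ?p (2 * pi * (z - d / 2)) + 1 / 2" and "ez = heat_sum ?p (2 * pi * z) + 1 / 2"
    have base: "14 * ?p * (1 + 4 / sqrt ?p) \<le> c1 * ?r"
    proof -
      have "14 * ?p * (1 + 4 / sqrt ?p) = 14 * ?p + 56 * (?p / sqrt ?p)" by (simp add: algebra_simps)
      also have "\<dots> = 14 * ?p + 56 * (sqrt P0 * ?r)"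
        using real_div_sqrt[of ?p] p(1) p(3) by simp
      also have "14 * ?p + 56 * (sqrt P0 * ?r) \<le> c1 * ?r" using pr by (simp add: c1_def algebra_simps)
      finally show ?thesis .
    qed
    have R0: "\<bar>R0\<bar> \<le> c1 * ?r"
      using heat_sum_trapezoid[OF p(1), of 0] base by (simp add: R0_def Q)
    have Rd: "\<bar>Rd\<bar> \<le> c1 * ?r + c3 * (d\<^sup>2 / ?r)"
    proof -
      have "(pi * d)\<^sup>2 / (4 * ?p) = d\<^sup>2 / (4 * \<theta> * s)" using s th by (simp add: power_mult_distrib)
      then have "\<bar>Rd\<bar> \<le> (14 * ?p + 3 * (pi * d)\<^sup>2) * (1 + 4 / sqrt ?p)"
        using heat_sum_trapezoid[OF p(1), of "pi * d"] by (simp add: Rd_def Q q_def)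
      also have "\<dots> = 14 * ?p * (1 + 4 / sqrt ?p) + 3 * pi\<^sup>2 * d\<^sup>2 * (1 + 4 / sqrt ?p)"
        by (simp only: power_mult_distrib distrib_right mult.assoc)
      also have "\<dots> \<le> c1 * ?r + 3 * pi\<^sup>2 * d\<^sup>2 * ((1 + 4 / sqrt P0) * (1 / ?r))"
      proof (rule add_mono[OF base mult_left_mono])
        have "4 / sqrt ?p = 4 / sqrt P0 * (1 / ?r)" by (simp add: p(3))
        then show "1 + 4 / sqrt ?p \<le> (1 + 4 / sqrt P0) * (1 / ?r)" using r(4) by (simp only: distrib_right)
      qed simp
      finally show ?thesis by (simp add: c3_def mult_ac)
    qed
    have off: "\<bar>heat_sum ?p (2 * pi * y) + 1 / 2\<bar> \<le> c2 * ?r" if y: "b \<le> y" "y \<le> 1 - b" for y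
    proof -
      have cy: "cos (2 * pi * y) \<le> cos (2 * pi * b)" by (rule cos_interior_le(1)[OF b y])
      have "\<bar>heat_sum ?p (2 * pi * y) + 1 / 2\<bar> \<le> (15 * ?p + 56 * sqrt ?p) / (2 * (1 - cos (2 * pi * y)))"
        using cy cb by (intro heat_sum_off_diagonal p) auto
      also have "\<dots> \<le> ((15 * P0 + 56 * sqrt P0) * ?r) / (2 * (1 - cos (2 * pi * b)))"
        using cy cb pr P0 r p(3) by (intro frac_le) (auto simp: algebra_simps)
      finally show ?thesis by (simp add: c2_def)
    qed
    have E: "\<bar>e1\<bar> \<le> c2 * ?r" "\<bar>e2\<bar> \<le> c2 * ?r" "\<bar>ez\<bar> \<le> c2 * ?r"
      unfolding e1_def e2_def ez_def using z d by (intro off; simp)+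
    let ?x = "\<kappa> * d / 2"
    define ex where "ex = exp ?x + exp (- ?x) - 2"
    have ax: "\<bar>?x\<bar> \<le> \<bar>\<kappa>\<bar> / 2"
    proof -
      have "\<bar>\<kappa>\<bar> * d \<le> \<bar>\<kappa>\<bar> * 1" using d1 by (intro mult_left_mono) auto
      then show ?thesis using d by (simp add: abs_mult)
    qed
    have ex: "0 \<le> ex" "ex \<le> c4 * d\<^sup>2"
    proof -
      show "0 \<le> ex" unfolding ex_def by (rule exp_symmetric_excess)
      have "ex \<le> ?x\<^sup>2 * exp (3 * \<bar>?x\<bar>)" unfolding ex_def by (rule exp_symmetric_excess)
      also have "\<dots> \<le> (\<kappa>\<^sup>2 * d\<^sup>2) * exp (2 * \<bar>\<kappa>\<bar>)"
        using ax by (intro mult_mono) (auto simp: power_mult_distrib power_divide)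
      finally show "ex \<le> c4 * d\<^sup>2" by (simp add: c4_def mult_ac)
    qed
    have K: "exp ?x \<le> K" "exp (- ?x) \<le> K" using ax unfolding K_def by (auto simp: abs_le_iff)
    have eq: "bracket \<kappa> ?p z d - (1 - q) * Q = ex * (Q / 2 + R0) + 2 * R0 - 2 * Rd - exp (- ?x) * e1 - exp ?x * e2 + 2 * ez"
      unfolding bracket_def R0_def Rd_def e1_def e2_def ez_def ex_def by (simp add: algebra_simps)
    have "\<bar>ex * (Q / 2 + R0)\<bar> \<le> (c4 * d\<^sup>2) * ((c5 + c1) * (1 / ?r))"
    proof -
      have "\<bar>Q / 2 + R0\<bar> \<le> c5 / ?r + c1 * ?r" 
      proof -
        have "0 \<le> c5 / ?r" using nn r by simp
        then show ?thesis using R0 Q(2) by linarith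
      qed
      also have "\<dots> \<le> c5 * (1 / ?r) + c1 * (1 / ?r)" using r nn by (intro add_mono mult_left_mono) auto
      finally have "\<bar>Q / 2 + R0\<bar> \<le> (c5 + c1) * (1 / ?r)" by (simp only: distrib_right)
      then show ?thesis unfolding abs_mult using ex nn by (intro mult_mono) auto
    qed
    then have t1: "\<bar>ex * (Q / 2 + R0)\<bar> \<le> (c4 * (c5 + c1)) * (d\<^sup>2 / ?r)" by (simp add: mult_ac)
    have t2: "\<bar>exp (- ?x) * e1\<bar> \<le> K * (c2 * ?r)" "\<bar>exp ?x * e2\<bar> \<le> K * (c2 * ?r)"
      unfolding abs_mult using K E nn by (intro mult_mono; simp)+
    have gen: "\<bar>x1 + 2 * x2 - 2 * x3 - x4 - x5 + 2 * x6\<bar> \<le> y1 + 2 * y2 + 2 * y3 + y4 + y5 + 2 * y6"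
      if "\<bar>x1\<bar> \<le> y1" "\<bar>x2\<bar> \<le> y2" "\<bar>x3\<bar> \<le> y3" "\<bar>x4\<bar> \<le> y4" "\<bar>x5\<bar> \<le> y5" "\<bar>x6\<bar> \<le> y6"
      for x1 x2 x3 x4 x5 x6 y1 y2 y3 y4 y5 y6 :: real
      using that unfolding abs_le_iff by linarith
    have "\<bar>bracket \<kappa> ?p z d - (1 - q) * Q\<bar> \<le> (c4 * (c5 + c1)) * (d\<^sup>2 / ?r) + 2 * (c1 * ?r) + 2 * (c1 * ?r + c3 * (d\<^sup>2 / ?r))
       + K * (c2 * ?r) + K * (c2 * ?r) + 2 * (c2 * ?r)"
      unfolding eq using t1 R0 Rd t2 E(3) by (rule gen)
    also have "\<dots> = (4 * c1 + 2 * K * c2 + 2 * c2) * ?r + (c4 * (c5 + c1) + 2 * c3) * (d\<^sup>2 / ?r)"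
      by (simp add: algebra_simps add_divide_distrib)
    also have "\<dots> \<le> C * ?r + C * (d\<^sup>2 / ?r)"
      using nn r by (intro add_mono mult_right_mono) (auto simp: C_def)
    finally show "\<bar>bracket \<kappa> ?p z d - (1 - exp (- (d\<^sup>2 / (4 * \<theta> * s)))) / sqrt (pi * \<theta> * s)\<bar> \<le> C * (?r + d\<^sup>2 / ?r)"
      by (simp add: q_def Q_def distrib_left)
  qed
qed

lemma has_integral_exp_neg:
  assumes "a \<noteq> (0::real)" "0 \<le> u"
  shows "((\<lambda>s. exp (- a * s)) has_integral (1 - exp (- a * u)) / a) {0..u}"
proof -
  have "((\<lambda>s. exp (- a * s)) has_integral (- exp (- a * u) / a - (- exp (- a * 0) / a))) {0..u}"
    using assms by (intro has_integral_antiderivative) (auto intro!: derivative_eq_intros)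
  then show ?thesis by (simp add: diff_divide_distrib)
qed

text \<open>
  Monotone convergence for the partial sums. The value of \<open>g\<close> at 0, where the series may diverge, is irrelevant
  for the integral and normalised to 0.
\<close>

lemma integral_nonneg_series:
  fixes a E :: "nat \<Rightarrow> real"
  assumes u: "0 \<le> u" and a: "\<And>l. a l > 0" and E: "\<And>l. E l \<ge> 0"
    and S: "(\<lambda>l. (1 - exp (- a l * u)) / a l * E l) sums S"
    and g: "\<And>s. 0 < s \<Longrightarrow> s \<le> u \<Longrightarrow> (\<lambda>l. exp (- a l * s) * E l) sums g s" and g0: "g 0 = 0"
  shows "(g has_integral S) {0..u}"
proof -
  define f where "f n s = (if s = 0 then 0 else \<Sum>l<n. exp (- a l * s) * E l)" for n :: nat and s :: real
  have f: "(f n has_integral (\<Sum>l<n. (1 - exp (- a l * u)) / a l * E l)) {0..u}" for n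
  proof (rule has_integral_spike_finite[of "{0}"])
    show "((\<lambda>s. \<Sum>l<n. exp (- a l * s) * E l) has_integral (\<Sum>l<n. (1 - exp (- a l * u)) / a l * E l)) {0..u}"
      using a u by (intro has_integral_sum has_integral_mult_left has_integral_exp_neg) (auto simp: less_imp_neq[symmetric])
  qed (auto simp: f_def)
  have lim: "(\<lambda>n. integral {0..u} (f n)) \<longlonglongrightarrow> S"
    using S unfolding integral_unique[OF f] sums_def .
  have "g integrable_on {0..u} \<and> (\<lambda>n. integral {0..u} (f n)) \<longlonglongrightarrow> integral {0..u} g"
  proof (rule monotone_convergence_increasing)
    show "f n integrable_on {0..u}" for n using f by (rule has_integral_integrable)
    show "f n s \<le> f (Suc n) s" for n s using E by (simp add: f_def)
    show "(\<lambda>n. f n s) \<longlonglongrightarrow> g s" if "s \<in> {0..u}" for s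
    proof (cases "s = 0")
      case False
      then show ?thesis using g[of s] that by (simp add: f_def sums_def)
    qed (simp add: f_def g0)
    show "bounded (range (\<lambda>n. integral {0..u} (f n)))" using lim by (rule convergent_imp_bounded)
  qed
  then show ?thesis using LIMSEQ_unique[OF lim] by (auto simp: has_integral_integrable_integral)
qed

context spde
begin

text \<open>
  The weight \<open>(1 - exp (- \<lambda> * h^2)) / \<lambda>\<close> of a mode is the integral of \<open>exp (- \<lambda> * s)\<close> over \<open>[0, h^2]\<close>, so
  the series is the time integral of \<open>bracket\<close> times \<open>exp (- \<theta>2 * Gam * s)\<close>. The latter factor
  differs from 1 by \<open>O(s)\<close>. All errors are at most a multiple of \<open>h^2 / sqrt s\<close>, whose integral is of the order \<open>h^3\<close>.
\<close>

lemma spectral_energy_expansion: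
  assumes b: "0 < b" "b < 1 / 2" and r: "r > 0"
  obtains C where "C \<ge> 0"
    and "\<And>h z S. 0 < h \<Longrightarrow> h \<le> 1 \<Longrightarrow> b \<le> z - r * h / 2 \<Longrightarrow> z + r * h / 2 \<le> 1 - b \<Longrightarrow>
      (\<lambda>l. (1 - exp (- lam l * h\<^sup>2)) / lam l * (e l (z + r * h / 2) - e l (z - r * h / 2))\<^sup>2) sums S \<Longrightarrow>
      \<bar>S - exp (- \<kappa> * z) * (h * psi \<theta>2 r)\<bar> \<le> C * h ^ 3"
proof -
  obtain C0 where C0: "C0 \<ge> 0" and br: "\<And>s z d. 0 < s \<Longrightarrow> s \<le> 1 \<Longrightarrow> 0 \<le> d \<Longrightarrow> b \<le> z - d / 2 \<Longrightarrow> z + d / 2 \<le> 1 - b \<Longrightarrow>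
      \<bar>bracket \<kappa> (pi\<^sup>2 * \<theta>2 * s) z d - (1 - exp (- (d\<^sup>2 / (4 * \<theta>2 * s)))) / sqrt (pi * \<theta>2 * s)\<bar>
        \<le> C0 * (sqrt s + d\<^sup>2 / sqrt s)"
    using bracket_expansion[OF b \<theta>2, of \<kappa>] by blast
  define g0 where "g0 = \<theta>2 * Gam \<theta>2 \<theta>1 \<theta>0"
  define G K c6 where "G = exp \<bar>g0\<bar>" and "K = exp \<bar>\<kappa>\<bar>" and "c6 = 1 / sqrt (pi * \<theta>2)"
  have nn: "G \<ge> 0" "K \<ge> 0" "c6 \<ge> 0" using \<theta>2 by (auto simp: G_def K_def c6_def)
  define C where "C = K * (G * C0 * (1 + r\<^sup>2) + \<bar>g0\<bar> * G * c6)"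
  have C: "C \<ge> 0" using nn C0 by (simp add: C_def)
  show ?thesis
  proof
    show "2 * C \<ge> 0" using C by simp
    fix h z S
    assume h: "0 < h" "h \<le> 1" and z: "b \<le> z - r * h / 2" "z + r * h / 2 \<le> 1 - b"
      and S: "(\<lambda>l. (1 - exp (- lam l * h\<^sup>2)) / lam l * (e l (z + r * h / 2) - e l (z - r * h / 2))\<^sup>2) sums S"
    let ?d = "r * h"
    have d: "?d \<ge> 0" using r h by simp
    have h2: "h\<^sup>2 \<le> 1" using h by (simp add: power_le_one)
    define Y where "Y s = (1 - exp (- (?d\<^sup>2 / (4 * \<theta>2 * s)))) / sqrt (pi * \<theta>2 * s)" for s
    define g where "g s = (if s = 0 then 0 else exp (- g0 * s) * (exp (- \<kappa> * z) * bracket \<kappa> (pi\<^sup>2 * \<theta>2 * s) z ?d))" for s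
    have gs: "(\<lambda>l. exp (- lam l * s) * (e l (z + ?d / 2) - e l (z - ?d / 2))\<^sup>2) sums g s" if "0 < s" for s
    proof -
      have p: "pi\<^sup>2 * \<theta>2 * s > 0" using that \<theta>2 by simp
      have "exp (- lam l * s) = exp (- g0 * s) * exp (- (pi\<^sup>2 * \<theta>2 * s * (real (Suc l))\<^sup>2))" for l
        by (simp add: eigval_def g0_def algebra_simps flip: exp_add)
      moreover have "g s = exp (- g0 * s) * (exp (- \<kappa> * z) * bracket \<kappa> (pi\<^sup>2 * \<theta>2 * s) z ?d)"
        using that by (simp add: g_def)
      ultimately show ?thesis
        using sums_mult[OF bracket_sums[OF p, of \<kappa> z ?d], of "exp (- g0 * s)"] by (simp only: mult.assoc)
    qed
    have gi: "(g has_integral S) {0..h\<^sup>2}"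
      by (rule integral_nonneg_series[OF _ lam_pos _ S gs]) (simp_all add: g_def)
    have Yi: "((\<lambda>s. exp (- \<kappa> * z) * Y s) has_integral exp (- \<kappa> * z) * (h * psi \<theta>2 r)) {0..h\<^sup>2}"
      unfolding Y_def by (intro has_integral_mult_right has_integral_psi \<theta>2 h r)
    have Ri: "((\<lambda>s. C * h\<^sup>2 * (1 / sqrt s)) has_integral C * h\<^sup>2 * (2 * sqrt (h\<^sup>2))) {0..h\<^sup>2}"
      by (intro has_integral_mult_right has_integral_rsqrt) simp
    have pt: "norm (g s - exp (- \<kappa> * z) * Y s) \<le> C * h\<^sup>2 * (1 / sqrt s)" if s: "s \<in> {0..h\<^sup>2}" for s
    proof (cases "s = 0")
      case True
      then show ?thesis by (simp add: g_def Y_def)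
    next
      case False
      then have s: "0 < s" "s \<le> h\<^sup>2" "s \<le> 1" using s h2 by auto
      have sq: "sqrt s > 0" "sqrt s \<le> h\<^sup>2 * (1 / sqrt s)"
      proof -
        show "sqrt s > 0" using s by simp
        have "sqrt s = s / sqrt s" using s by (simp add: real_div_sqrt)
        also have "\<dots> \<le> h\<^sup>2 / sqrt s" using s by (intro divide_right_mono) auto
        finally show "sqrt s \<le> h\<^sup>2 * (1 / sqrt s)" by simp
      qed
      define B where "B = bracket \<kappa> (pi\<^sup>2 * \<theta>2 * s) z ?d"
      have BY: "\<bar>B - Y s\<bar> \<le> C0 * ((1 + r\<^sup>2) * (h\<^sup>2 * (1 / sqrt s)))"
      proof -
        have "\<bar>B - Y s\<bar> \<le> C0 * (sqrt s + ?d\<^sup>2 / sqrt s)"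
          unfolding B_def Y_def by (rule br[OF s(1,3) d z])
        also have "\<dots> \<le> C0 * (h\<^sup>2 * (1 / sqrt s) + r\<^sup>2 * (h\<^sup>2 * (1 / sqrt s)))"
          using C0 sq by (intro mult_left_mono add_mono) (auto simp: power_mult_distrib)
        finally show ?thesis by (simp only: distrib_right mult_1)
      qed
      have Yb: "\<bar>Y s\<bar> \<le> c6 * (1 / sqrt s)"
      proof -
        have "0 \<le> ?d\<^sup>2 / (4 * \<theta>2 * s)" using s \<theta>2 by simp
        then have "0 \<le> 1 - exp (- (?d\<^sup>2 / (4 * \<theta>2 * s)))" "1 - exp (- (?d\<^sup>2 / (4 * \<theta>2 * s))) \<le> 1" by auto
        then have "\<bar>Y s\<bar> \<le> 1 / sqrt (pi * \<theta>2 * s)"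
          unfolding Y_def using s \<theta>2 by (simp add: abs_div divide_right_mono)
        then show ?thesis by (simp add: c6_def real_sqrt_mult)
      qed
      have gs1: "\<bar>g0 * s\<bar> \<le> \<bar>g0\<bar>" using s by (simp add: abs_mult mult_left_le)
      have e1: "exp (- g0 * s) \<le> G" using gs1 unfolding G_def by (simp add: abs_le_iff)
      have e2: "\<bar>exp (- g0 * s) - 1\<bar> \<le> \<bar>g0\<bar> * s * G"
      proof -
        have "\<bar>exp (- g0 * s) - 1\<bar> \<le> \<bar>- g0 * s\<bar> * exp \<bar>- g0 * s\<bar>" by (rule abs_exp_minus_one_le)
        also have "\<dots> \<le> (\<bar>g0\<bar> * s) * G" using gs1 s nn by (intro mult_mono) (auto simp: abs_mult G_def)
        finally show ?thesis .
      qed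
      have ek: "exp (- \<kappa> * z) \<le> K" unfolding K_def using z d b by (intro exp_tilt_bounds) auto
      have "\<bar>exp (- g0 * s) * B - Y s\<bar> \<le> exp (- g0 * s) * \<bar>B - Y s\<bar> + \<bar>exp (- g0 * s) - 1\<bar> * \<bar>Y s\<bar>"
      proof -
        have "exp (- g0 * s) * B - Y s = exp (- g0 * s) * (B - Y s) + (exp (- g0 * s) - 1) * Y s"
          by (simp add: algebra_simps)
        then show ?thesis using abs_triangle_ineq[of "exp (- g0 * s) * (B - Y s)" "(exp (- g0 * s) - 1) * Y s"]
          by (simp only: abs_mult abs_exp_cancel)
      qed
      also have "\<dots> \<le> G * (C0 * ((1 + r\<^sup>2) * (h\<^sup>2 * (1 / sqrt s)))) + (\<bar>g0\<bar> * s * G) * (c6 * (1 / sqrt s))"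
        using BY Yb e1 e2 nn s by (intro add_mono mult_mono) auto
      also have "\<dots> \<le> G * (C0 * ((1 + r\<^sup>2) * (h\<^sup>2 * (1 / sqrt s)))) + (\<bar>g0\<bar> * h\<^sup>2 * G) * (c6 * (1 / sqrt s))"
        using nn s by (intro add_mono mult_right_mono mult_left_mono) auto
      finally have X: "\<bar>exp (- g0 * s) * B - Y s\<bar> \<le> \<dots>" .
      have "norm (g s - exp (- \<kappa> * z) * Y s) = exp (- \<kappa> * z) * \<bar>exp (- g0 * s) * B - Y s\<bar>"
      proof -
        have "g s - exp (- \<kappa> * z) * Y s = exp (- \<kappa> * z) * (exp (- g0 * s) * B - Y s)"
          using s by (simp add: g_def B_def right_diff_distrib)
        then show ?thesis by (simp only: real_norm_def abs_mult abs_exp_cancel)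
      qed
      also have "\<dots> \<le> K * (G * (C0 * ((1 + r\<^sup>2) * (h\<^sup>2 * (1 / sqrt s)))) + (\<bar>g0\<bar> * h\<^sup>2 * G) * (c6 * (1 / sqrt s)))"
        using ek X nn by (intro mult_mono) auto
      also have "\<dots> = C * h\<^sup>2 * (1 / sqrt s)" unfolding C_def by (simp only: distrib_left distrib_right mult_ac)
      finally show ?thesis .
    qed
    have "norm (integral {0..h\<^sup>2} (\<lambda>s. g s - exp (- \<kappa> * z) * Y s)) \<le> integral {0..h\<^sup>2} (\<lambda>s. C * h\<^sup>2 * (1 / sqrt s))"
      using has_integral_diff[OF gi Yi] Ri pt
      by (intro Henstock_Kurzweil_Integration.integral_norm_bound_integral) (auto intro: has_integral_integrable)
    then have "\<bar>S - exp (- \<kappa> * z) * (h * psi \<theta>2 r)\<bar> \<le> C * h\<^sup>2 * (2 * sqrt (h\<^sup>2))"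
      unfolding integral_unique[OF has_integral_diff[OF gi Yi]] integral_unique[OF Ri] by simp
    also have "\<dots> = 2 * C * h ^ 3" using h by (simp add: power2_eq_square power3_eq_cube)
    finally show "\<bar>S - exp (- \<kappa> * z) * (h * psi \<theta>2 r)\<bar> \<le> 2 * C * h ^ 3" .
  qed
qed

end

section \<open>Identifiability\<close>

lemma psi_elasticity_bounds: assumes "x > 0" shows "0 < psi_elasticity x" "psi_elasticity x \<le> 1"
proof -
  have "0 < x * gtail (x / 2)" using assms gtail_pos by simp
  moreover have "x * gtail (x / 2) \<le> psi_shape x" by (simp add: psi_shape_def)
  ultimately show "0 < psi_elasticity x" "psi_elasticity x \<le> 1"
    using psi_shape_pos[OF assms] by (auto simp: psi_elasticity_def)
qed

lemma isCont_psi_elasticity: "x > 0 \<Longrightarrow> isCont psi_elasticity x"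
  using DERIV_psi_elasticity DERIV_isCont by blast

lemma DERIV_ln_psi_shape:
  assumes r: "r > 0" and t: "t > 0"
  shows "((\<lambda>t. ln (psi_shape (r / sqrt t))) has_real_derivative - (psi_elasticity (r / sqrt t) / (2 * t))) (at t)"
proof -
  have x: "r / sqrt t > 0" using assms by simp
  have g: "((\<lambda>t. r / sqrt t) has_real_derivative - (r / (2 * t * sqrt t))) (at t)"
    using t by (auto intro!: derivative_eq_intros simp: field_simps)
  have "((\<lambda>t. ln (psi_shape (r / sqrt t))) has_real_derivative
     1 / psi_shape (r / sqrt t) * (gtail (r / sqrt t / 2) * - (r / (2 * t * sqrt t)))) (at t)"
    by (rule DERIV_chain2[OF DERIV_ln_divide[OF psi_shape_pos[OF x]] DERIV_psi_shape[OF g]])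
  then show ?thesis by (rule DERIV_cong) (simp add: psi_elasticity_def mult_ac)
qed

lemma DERIV_ln_psi:
  assumes r: "r > 0" and t: "t > 0"
  shows "((\<lambda>t. ln (psi t r)) has_real_derivative - ((1 + psi_elasticity (r / sqrt t)) / (2 * t))) (at t)"
proof -
  have 1: "((\<lambda>t. ln (2 / sqrt pi) - ln t / 2 + ln (psi_shape (r / sqrt t))) has_real_derivative
     (- ((1 + psi_elasticity (r / sqrt t)) / (2 * t)))) (at t)"
    by (rule DERIV_cong[OF DERIV_add[OF DERIV_diff[OF DERIV_const DERIV_cdivide[OF DERIV_ln_divide[OF t], of 2]]
          DERIV_ln_psi_shape[OF r t]]]) (simp add: add_divide_distrib)
  have 2: "eventually (\<lambda>t. ln (psi t r) = ln (2 / sqrt pi) - ln t / 2 + ln (psi_shape (r / sqrt t))) (nhds t)"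
  proof (rule eventually_mono[OF eventually_nhds_in_open[of "{0<..}" t]])
    fix u :: real assume "u \<in> {0<..}"
    then have u: "u > 0" by simp
    have "psi_shape (r / sqrt u) > 0" using r u by (intro psi_shape_pos) auto
    then show "ln (psi u r) = ln (2 / sqrt pi) - ln u / 2 + ln (psi_shape (r / sqrt u))"
      using u by (simp add: psi_scaling ln_mult ln_div ln_sqrt real_sqrt_mult)
  qed (use t in auto)
  show ?thesis unfolding DERIV_cong_ev[OF refl 2 refl] by (rule 1)
qed

lemma ln_psi_lipschitz:
  assumes r: "r > 0" and t0: "t0 > 0" and t: "t0 \<le> t" "t0 \<le> t'"
  shows "\<bar>ln (psi t' r) - ln (psi t r)\<bar> \<le> \<bar>t' - t\<bar> / t0"
proof -
  have "norm (ln (psi t' r) - ln (psi t r)) \<le> 1 / t0 * norm (t' - t)"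
  proof (rule field_differentiable_bound[where S = "{t0..}" and f' = "\<lambda>u. - ((1 + psi_elasticity (r / sqrt u)) / (2 * u))"])
    fix u assume "u \<in> {t0..}"
    then have u: "t0 \<le> u" "u > 0" using t0 by auto
    show "((\<lambda>t. ln (psi t r)) has_field_derivative - ((1 + psi_elasticity (r / sqrt u)) / (2 * u))) (at u within {t0..})"
      by (rule DERIV_subset[OF DERIV_ln_psi[OF r u(2)]]) simp
    have pe: "0 < psi_elasticity (r / sqrt u)" "psi_elasticity (r / sqrt u) \<le> 1"
      using psi_elasticity_bounds[of "r / sqrt u"] r u by auto
    then have "(1 + psi_elasticity (r / sqrt u)) / (2 * u) \<le> 2 / (2 * t0)"
      using u t0 by (intro frac_le) auto
    then show "norm (- ((1 + psi_elasticity (r / sqrt u)) / (2 * u))) \<le> 1 / t0" using pe u by simp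
  qed (use t in auto)
  then show ?thesis by simp
qed

text \<open>
  The derivative with respect to \<open>t\<close> is the difference of two values of the elasticity, divided by \<open>2 * t\<close>. It is
  positive because the elasticity is strictly decreasing, and bounded away from 0 by compactness.
\<close>

lemma ln_psi_ratio_expanding:
  assumes r: "r > 0" and t0: "0 < t0"
  obtains m where "m > 0" and
    "\<And>t t'. t \<in> {t0..t1} \<Longrightarrow> t' \<in> {t0..t1} \<Longrightarrow>
       m * \<bar>t' - t\<bar> \<le> \<bar>(ln (psi t' r) - ln (psi t' (r / sqrt 2))) - (ln (psi t r) - ln (psi t (r / sqrt 2)))\<bar>"
proof -
  define F where "F t = ln (psi t r) - ln (psi t (r / sqrt 2))" for t
  define F' where "F' t = (psi_elasticity (r / sqrt 2 / sqrt t) - psi_elasticity (r / sqrt t)) / (2 * t)" for t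
  have r2: "r / sqrt 2 > 0" using r by simp
  have dF: "(F has_real_derivative F' t) (at t)" if "t > 0" for t
    unfolding F_def[abs_def] by (rule DERIV_cong[OF DERIV_diff[OF DERIV_ln_psi[OF r that] DERIV_ln_psi[OF r2 that]]])
      (simp add: F'_def field_simps add_divide_distrib diff_divide_distrib)
  have F'pos: "F' t > 0" if "t > 0" for t
  proof -
    have "r / sqrt 2 / sqrt t < r / sqrt t"
      using r that by (intro divide_strict_right_mono) (auto simp: divide_less_eq)
    then show ?thesis using psi_elasticity_strict_antimono[of "r / sqrt 2 / sqrt t" "r / sqrt t"] r that
      by (simp add: F'_def)
  qed
  show ?thesis
  proof (cases "t0 \<le> t1")
    case False
    then show ?thesis by (intro that[of 1]) auto
  next
    case True
    have "continuous_on {t0..t1} F'"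
      unfolding F'_def[abs_def] continuous_on_eq_continuous_within
    proof
      fix t assume "t \<in> {t0..t1}"
      then have t: "t > 0" using t0 by simp
      have c: "isCont (\<lambda>t. psi_elasticity (a / sqrt t)) t" if "a > 0" for a
        using t that by (intro isCont_o2[OF _ isCont_psi_elasticity]) (auto intro!: continuous_intros)
      have "isCont (\<lambda>t. (psi_elasticity (r / sqrt 2 / sqrt t) - psi_elasticity (r / sqrt t)) / (2 * t)) t"
        using t by (intro continuous_intros c r r2) auto
      then show "continuous (at t within {t0..t1}) (\<lambda>t. (psi_elasticity (r / sqrt 2 / sqrt t) - psi_elasticity (r / sqrt t)) / (2 * t))"
        by (rule continuous_at_imp_continuous_at_within)
    qed
    then obtain u where u: "u \<in> {t0..t1}" "\<And>t. t \<in> {t0..t1} \<Longrightarrow> F' u \<le> F' t"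
      using continuous_attains_inf[of "{t0..t1}" F'] True by auto
    have main: "F' u * (t' - t) \<le> F t' - F t" if tt: "t < t'" "t0 \<le> t" "t' \<le> t1" for t t'
    proof -
      obtain x where x: "t < x" "x < t'" "F t' - F t = (t' - t) * F' x"
        using MVT2[OF tt(1), of F F'] dF tt t0 by force
      have "F' u \<le> F' x" using u(2) x tt by simp
      then have "(t' - t) * F' u \<le> (t' - t) * F' x" using tt by (intro mult_left_mono) auto
      then show ?thesis using x(3) by (simp add: mult.commute)
    qed
    show ?thesis
    proof (rule that[of "F' u"])
      show "F' u > 0" using u t0 by (intro F'pos) auto
      fix t t' assume t: "t \<in> {t0..t1}" "t' \<in> {t0..t1}"
      consider "t < t'" | "t' < t" | "t = t'" by linarith
      then show "F' u * \<bar>t' - t\<bar> \<le> \<bar>(ln (psi t' r) - ln (psi t' (r / sqrt 2))) - (ln (psi t r) - ln (psi t (r / sqrt 2)))\<bar>"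
        unfolding F_def[symmetric] by cases (use main[of t t'] main[of t' t] t in auto)
    qed
  qed
qed

lemma abs_diff_le_ln:
  fixes x y a :: real
  assumes "0 < x" "x \<le> a" "0 < y" "y \<le> a"
  shows "\<bar>x - y\<bar> \<le> a * \<bar>ln x - ln y\<bar>"
proof -
  have "norm (exp (ln x) - exp (ln y)) \<le> a * norm (ln x - ln y)"
  proof (rule field_differentiable_bound[where S = "{..ln a}" and f' = exp])
    fix u assume "u \<in> {..ln a}"
    then have "exp u \<le> exp (ln a)" by simp
    then show "norm (exp u) \<le> a" using assms by simp
    show "(exp has_field_derivative exp u) (at u within {..ln a})" by (rule DERIV_subset[OF DERIV_exp]) simp
  qed (use assms in auto)
  then show ?thesis using assms by simp
qed

lemma abs_ln_diff_le:
  fixes x y a :: real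
  assumes "0 < a" "a \<le> x" "a \<le> y"
  shows "\<bar>ln x - ln y\<bar> \<le> \<bar>x - y\<bar> / a"
proof -
  have "norm (ln x - ln y) \<le> 1 / a * norm (x - y)"
  proof (rule field_differentiable_bound[where S = "{a..}" and f' = "\<lambda>u. 1 / u"])
    fix u assume u: "u \<in> {a..}"
    then show "(ln has_field_derivative 1 / u) (at u within {a..})"
      using assms by (intro DERIV_subset[OF DERIV_ln_divide]) auto
    show "norm (1 / u) \<le> 1 / a" using u assms by (simp add: frac_le)
  qed (use assms in auto)
  then show ?thesis by simp
qed

text \<open>
  The logarithm of the factor by which the mean function at \<open>z = 0\<close> changes from \<open>\<eta>\<close> to \<open>\<eta>'\<close>.
\<close>

definition log_gain :: "real \<Rightarrow> real \<times> real \<times> real \<Rightarrow> real \<times> real \<times> real \<Rightarrow> real" where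
  "log_gain r \<eta> \<eta>' = ln (fst \<eta>') + ln (psi (fst (snd \<eta>')) r) - ln (fst \<eta>) - ln (psi (fst (snd \<eta>)) r)"

text \<open>
  The difference of the two log gains involves \<open>\<theta>\<close> only and expands distances; once \<open>\<theta>\<close> is
  controlled, either log gain controls \<open>\<sigma>^2\<close>. Compactness of \<open>H\<close> keeps all parameters in a region where the logarithm and
  \<open>psi\<close> have bounded distortion.
\<close>

lemma log_coordinates:
  assumes H: "compact H" "H \<subseteq> {0<..} \<times> {0<..} \<times> UNIV" and \<eta>: "\<eta> \<in> H" and r: "r > 0"
  obtains B C where "B \<ge> 0" "C \<ge> 0"
    and "\<And>\<eta>'. \<eta>' \<in> H \<Longrightarrow> \<bar>log_gain r \<eta> \<eta>'\<bar> \<le> B"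
    and "\<And>\<eta>'. \<eta>' \<in> H \<Longrightarrow> \<bar>log_gain (r / sqrt 2) \<eta> \<eta>'\<bar> \<le> B"
    and "\<And>\<eta>'. \<eta>' \<in> H \<Longrightarrow> \<bar>snd (snd \<eta>') - snd (snd \<eta>)\<bar> \<le> B"
    and "\<And>\<eta>'. \<eta>' \<in> H \<Longrightarrow> norm (\<eta>' - \<eta>) \<le>
       C * (\<bar>log_gain r \<eta> \<eta>'\<bar> + \<bar>log_gain (r / sqrt 2) \<eta> \<eta>'\<bar> + \<bar>snd (snd \<eta>') - snd (snd \<eta>)\<bar>)"
proof -
  have ne: "H \<noteq> {}" using \<eta> by auto
  have cf: "continuous_on H fst" "continuous_on H (\<lambda>x. fst (snd x))" "continuous_on H (\<lambda>x. snd (snd x))"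
    by (intro continuous_intros)+
  obtain pa where pa: "pa \<in> H" "\<And>x. x \<in> H \<Longrightarrow> fst pa \<le> fst x" using continuous_attains_inf[OF H(1) ne cf(1)] by auto
  obtain pb where pb: "pb \<in> H" "\<And>x. x \<in> H \<Longrightarrow> fst x \<le> fst pb" using continuous_attains_sup[OF H(1) ne cf(1)] by auto
  obtain ta where ta: "ta \<in> H" "\<And>x. x \<in> H \<Longrightarrow> fst (snd ta) \<le> fst (snd x)" using continuous_attains_inf[OF H(1) ne cf(2)] by auto
  obtain tb where tb: "tb \<in> H" "\<And>x. x \<in> H \<Longrightarrow> fst (snd x) \<le> fst (snd tb)" using continuous_attains_sup[OF H(1) ne cf(2)] by auto
  obtain D where D: "\<And>x. x \<in> H \<Longrightarrow> norm x \<le> D" using compact_imp_bounded[OF H(1)] by (auto simp: bounded_iff)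
  define a0 a1 t0 t1 where "a0 = fst pa" and "a1 = fst pb" and "t0 = fst (snd ta)" and "t1 = fst (snd tb)"
  have pos: "a0 > 0" "a1 > 0" "t0 > 0" using H(2) pa(1) pb(1) ta(1) by (auto simp: a0_def a1_def t0_def)
  have rng: "a0 \<le> fst x" "fst x \<le> a1" "t0 \<le> fst (snd x)" "fst (snd x) \<le> t1" if "x \<in> H" for x
    using pa pb ta tb that by (auto simp: a0_def a1_def t0_def t1_def)
  have r2: "r / sqrt 2 > 0" using r by simp
  have comp: "\<bar>fst x\<bar> \<le> norm x" "\<bar>fst (snd x)\<bar> \<le> norm x" "\<bar>snd (snd x)\<bar> \<le> norm x" for x :: "real \<times> real \<times> real"
    using norm_fst_le[of "fst x" "snd x"] norm_snd_le[of "snd x" "fst x"]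
      norm_fst_le[of "fst (snd x)" "snd (snd x)"] norm_snd_le[of "snd (snd x)" "fst (snd x)"] by auto
  have diff: "norm (x - \<eta>) \<le> 2 * D" if "x \<in> H" for x
    using D[OF that] D[OF \<eta>] norm_triangle_ineq4[of x \<eta>] by linarith
  obtain m where m: "m > 0" "\<And>t t'. t \<in> {t0..t1} \<Longrightarrow> t' \<in> {t0..t1} \<Longrightarrow>
       m * \<bar>t' - t\<bar> \<le> \<bar>(ln (psi t' r) - ln (psi t' (r / sqrt 2))) - (ln (psi t r) - ln (psi t (r / sqrt 2)))\<bar>"
    using ln_psi_ratio_expanding[OF r pos(3), of t1] by blast
  have lp: "\<bar>ln (psi (fst (snd x)) \<rho>) - ln (psi (fst (snd \<eta>)) \<rho>)\<bar> \<le> \<bar>fst (snd x) - fst (snd \<eta>)\<bar> / t0" if "x \<in> H" "\<rho> > 0" for x \<rho>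
    using rng[OF that(1)] rng[OF \<eta>] by (intro ln_psi_lipschitz that pos) auto
  define B where "B = 2 * D / a0 + 2 * D / t0 + 2 * D"
  define C where "C = a1 * (1 + 1 / (m * t0)) + 1 / m + 1"
  have D0: "D \<ge> 0" using D[OF \<eta>] norm_ge_zero order_trans by blast
  have gain: "\<bar>log_gain \<rho> \<eta> x\<bar> \<le> B" if "x \<in> H" "\<rho> > 0" for x \<rho>
  proof -
    have "\<bar>ln (fst x) - ln (fst \<eta>)\<bar> \<le> \<bar>fst x - fst \<eta>\<bar> / a0" using rng[OF that(1)] rng[OF \<eta>] pos by (intro abs_ln_diff_le) auto
    also have "\<dots> \<le> 2 * D / a0"
      using comp(1)[of "x - \<eta>"] diff[OF that(1)] pos by (intro divide_right_mono) auto
    finally have 1: "\<bar>ln (fst x) - ln (fst \<eta>)\<bar> \<le> 2 * D / a0" .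
    have "\<bar>fst (snd x) - fst (snd \<eta>)\<bar> / t0 \<le> 2 * D / t0"
      using comp(2)[of "x - \<eta>"] diff[OF that(1)] pos by (intro divide_right_mono) auto
    with lp[OF that] have 2: "\<bar>ln (psi (fst (snd x)) \<rho>) - ln (psi (fst (snd \<eta>)) \<rho>)\<bar> \<le> 2 * D / t0" by linarith
    show ?thesis using 1 2 D0 unfolding log_gain_def B_def by linarith
  qed
  show ?thesis
  proof (rule that[of B C])
    show "B \<ge> 0" using D0 pos by (simp add: B_def)
    show "C \<ge> 0" using pos m by (simp add: C_def)
    fix x assume x: "x \<in> H"
    show "\<bar>log_gain r \<eta> x\<bar> \<le> B" "\<bar>log_gain (r / sqrt 2) \<eta> x\<bar> \<le> B" using gain[OF x] r r2 by auto
    show "\<bar>snd (snd x) - snd (snd \<eta>)\<bar> \<le> B"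
    proof -
      have "\<bar>snd (snd x) - snd (snd \<eta>)\<bar> \<le> 2 * D" using comp(3)[of "x - \<eta>"] diff[OF x] by simp
      moreover have "0 \<le> 2 * D / a0" "0 \<le> 2 * D / t0" using D0 pos by auto
      ultimately show ?thesis unfolding B_def by linarith
    qed
    define A1 A2 where "A1 = log_gain r \<eta> x" and "A2 = log_gain (r / sqrt 2) \<eta> x"
    have "m * \<bar>fst (snd x) - fst (snd \<eta>)\<bar> \<le> \<bar>A1 - A2\<bar>"
      using m(2)[of "fst (snd \<eta>)" "fst (snd x)"] rng[OF x] rng[OF \<eta>] by (simp add: A1_def A2_def log_gain_def algebra_simps)
    then have "\<bar>fst (snd x) - fst (snd \<eta>)\<bar> * m \<le> \<bar>A1\<bar> + \<bar>A2\<bar>" by (simp add: mult.commute)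
    then have T: "\<bar>fst (snd x) - fst (snd \<eta>)\<bar> \<le> (\<bar>A1\<bar> + \<bar>A2\<bar>) / m" using m(1) by (simp add: pos_le_divide_eq)
    have "\<bar>ln (fst x) - ln (fst \<eta>)\<bar> \<le> \<bar>A1\<bar> + \<bar>fst (snd x) - fst (snd \<eta>)\<bar> / t0"
      using lp[OF x r] by (simp add: A1_def log_gain_def)
    also have "\<dots> \<le> \<bar>A1\<bar> + (\<bar>A1\<bar> + \<bar>A2\<bar>) / m / t0" using T pos by (intro add_left_mono divide_right_mono) auto
    also have "\<dots> \<le> (\<bar>A1\<bar> + \<bar>A2\<bar>) * (1 + 1 / (m * t0))" by (simp add: algebra_simps)
    finally have L: "\<bar>ln (fst x) - ln (fst \<eta>)\<bar> \<le> (\<bar>A1\<bar> + \<bar>A2\<bar>) * (1 + 1 / (m * t0))" .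
    have "\<bar>fst x - fst \<eta>\<bar> \<le> a1 * \<bar>ln (fst x) - ln (fst \<eta>)\<bar>"
      using rng[OF x] rng[OF \<eta>] pos by (intro abs_diff_le_ln) auto
    also have "\<dots> \<le> a1 * ((\<bar>A1\<bar> + \<bar>A2\<bar>) * (1 + 1 / (m * t0)))" using L pos by (intro mult_left_mono) auto
    finally have S: "\<bar>fst x - fst \<eta>\<bar> \<le> (\<bar>A1\<bar> + \<bar>A2\<bar>) * (a1 * (1 + 1 / (m * t0)))" by (simp only: mult_ac)
    have "norm (x - \<eta>) \<le> \<bar>fst x - fst \<eta>\<bar> + (\<bar>fst (snd x) - fst (snd \<eta>)\<bar> + \<bar>snd (snd x) - snd (snd \<eta>)\<bar>)"
    proof -
      have "norm y \<le> \<bar>fst y\<bar> + (\<bar>fst (snd y)\<bar> + \<bar>snd (snd y)\<bar>)" for y :: "real \<times> real \<times> real"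
      proof (cases y rule: prod_cases3)
        case (fields a b c)
        then show ?thesis using norm_Pair_le[of a "(b, c)"] norm_Pair_le[of b c] by simp
      qed
      from this[of "x - \<eta>"] show ?thesis by simp
    qed
    also have "\<dots> \<le> (\<bar>A1\<bar> + \<bar>A2\<bar>) * (a1 * (1 + 1 / (m * t0))) + ((\<bar>A1\<bar> + \<bar>A2\<bar>) * (1 / m) + \<bar>snd (snd x) - snd (snd \<eta>)\<bar>)"
      using S T by (intro add_mono) auto
    also have "\<dots> \<le> C * (\<bar>A1\<bar> + \<bar>A2\<bar> + \<bar>snd (snd x) - snd (snd \<eta>)\<bar>)"
    proof -
      have "0 \<le> a1 * (1 + 1 / (m * t0))" "0 \<le> 1 / m" using pos m by auto
      then have "0 \<le> (a1 * (1 + 1 / (m * t0)) + 1 / m) * \<bar>snd (snd x) - snd (snd \<eta>)\<bar>" by simp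
      then show ?thesis unfolding C_def by (simp only: distrib_left distrib_right mult_1 mult_1_right) (simp add: algebra_simps)
    qed
    finally show "norm (x - \<eta>) \<le> C * (\<bar>log_gain r \<eta> x\<bar> + \<bar>log_gain (r / sqrt 2) \<eta> x\<bar> + \<bar>snd (snd x) - snd (snd \<eta>)\<bar>)"
      unfolding A1_def A2_def .
  qed
qed

section \<open>Least squares along a grid\<close>

lemma sum_by_parts_le:
  fixes W u :: "nat \<Rightarrow> real"
  assumes L: "\<And>k. k < K \<Longrightarrow> \<bar>u k\<bar> \<le> A" "\<And>k. Suc k < K \<Longrightarrow> \<bar>u (Suc k) - u k\<bar> \<le> A'" and A': "0 \<le> A'" and K: "0 < K"
  shows "\<bar>\<Sum>k<K. W k * u k\<bar> \<le> A * \<bar>\<Sum>j<K. W j\<bar> + A' * (\<Sum>k<K. \<bar>\<Sum>j<Suc k. W j\<bar>)"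
proof -
  define S where "S k = (\<Sum>j<k. W j)" for k
  have parts: "(\<Sum>k<Suc n. W k * u k) = S (Suc n) * u n - (\<Sum>k<n. S (Suc k) * (u (Suc k) - u k))" for n
  proof (induction n)
    case (Suc n)
    have "(\<Sum>k<Suc (Suc n). W k * u k) = S (Suc n) * u n - (\<Sum>k<n. S (Suc k) * (u (Suc k) - u k)) + W (Suc n) * u (Suc n)"
      using Suc by simp
    also have "W (Suc n) = S (Suc (Suc n)) - S (Suc n)" by (simp add: S_def)
    finally show ?case by (simp add: algebra_simps)
  qed (simp add: S_def)
  obtain n where n: "K = Suc n" using K by (cases K) auto
  have "\<bar>\<Sum>k<K. W k * u k\<bar> \<le> \<bar>S K * u n\<bar> + \<bar>\<Sum>k<n. S (Suc k) * (u (Suc k) - u k)\<bar>"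
    unfolding n parts by (rule abs_triangle_ineq4)
  also have "\<bar>S K * u n\<bar> \<le> A * \<bar>S K\<bar>" using L(1)[of n] n by (simp add: abs_mult mult.commute mult_right_mono)
  also have "\<bar>\<Sum>k<n. S (Suc k) * (u (Suc k) - u k)\<bar> \<le> (\<Sum>k<n. A' * \<bar>S (Suc k)\<bar>)"
  proof (rule order_trans[OF sum_abs sum_mono])
    fix k assume "k \<in> {..<n}"
    then show "\<bar>S (Suc k) * (u (Suc k) - u k)\<bar> \<le> A' * \<bar>S (Suc k)\<bar>"
      using mult_right_mono[OF L(2)[of k], of "\<bar>S (Suc k)\<bar>"] n by (simp add: abs_mult mult.commute)
  qed
  also have "\<dots> \<le> A' * (\<Sum>k<K. \<bar>S (Suc k)\<bar>)"
    unfolding sum_distrib_left[symmetric] using A' n by (intro mult_left_mono sum_mono2) auto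
  finally show ?thesis by (simp add: S_def)
qed

lemma affine_sum_of_squares:
  fixes x y :: real
  shows "12 * (\<Sum>k<K. (x + real k * y)\<^sup>2) = 3 * real K * (2 * x + (real K - 1) * y)\<^sup>2 + y\<^sup>2 * real K * ((real K)\<^sup>2 - 1)"
proof (induction K)
  case (Suc K)
  have "12 * (\<Sum>k<Suc K. (x + real k * y)\<^sup>2) =
    3 * real K * (2 * x + (real K - 1) * y)\<^sup>2 + y\<^sup>2 * real K * ((real K)\<^sup>2 - 1) + 12 * (x + real K * y)\<^sup>2"
    using Suc by simp
  also have "\<dots> = 3 * (real K + 1) * (2 * x + (real K + 1 - 1) * y)\<^sup>2 + y\<^sup>2 * (real K + 1) * ((real K + 1)\<^sup>2 - 1)"
    by (simp add: power2_eq_square algebra_simps)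
  finally show ?case by (simp add: add.commute)
qed simp

text \<open>
  The mean square of an affine function over the grid is the square at the centre plus the squared slope
  times the variance of the grid points; the latter is bounded below as the grid has length at least about \<open>l0\<close>.
\<close>

lemma affine_sum_of_squares_ge:
  fixes \<alpha> \<beta> z0 \<delta> l0 :: real
  assumes K: "2 \<le> K" and z: "0 \<le> z0" "0 < \<delta>" "z0 + (real K - 1) * \<delta> \<le> 1" and l0: "0 < l0" "l0 \<le> real K * \<delta>"
  shows "real K * (\<alpha>\<^sup>2 + \<beta>\<^sup>2) \<le> (2 + 48 / l0\<^sup>2) * (\<Sum>k<K. (\<alpha> - \<beta> * (z0 + real k * \<delta>))\<^sup>2)"
proof -
  define zm where "zm = z0 + (real K - 1) / 2 * \<delta>"
  define v where "v = \<delta>\<^sup>2 * ((real K)\<^sup>2 - 1) / 12"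
  define g where "g = \<alpha> - \<beta> * zm"
  have K2: "real K \<ge> 2" using K by simp
  have zm: "0 \<le> zm" "zm \<le> 1"
  proof -
    have "0 \<le> (real K - 1) * \<delta>" using K2 z by simp
    moreover have "zm = z0 + ((real K - 1) * \<delta>) / 2" by (simp add: zm_def)
    ultimately show "0 \<le> zm" "zm \<le> 1" using z by linarith+
  qed
  have "4 \<le> (real K)\<^sup>2" using K2 power_mono[of 2 "real K" 2] by simp
  then have "(real K)\<^sup>2 * 3 / 4 \<le> (real K)\<^sup>2 - 1" by simp
  then have "\<delta>\<^sup>2 * ((real K)\<^sup>2 * 3 / 4) \<le> \<delta>\<^sup>2 * ((real K)\<^sup>2 - 1)" by (intro mult_left_mono) auto
  moreover have "l0\<^sup>2 \<le> (real K * \<delta>)\<^sup>2" using l0 by (intro power_mono) auto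
  ultimately have v: "l0\<^sup>2 / 16 \<le> v" by (simp add: v_def power_mult_distrib mult.commute)
  have sum: "(\<Sum>k<K. (\<alpha> - \<beta> * (z0 + real k * \<delta>))\<^sup>2) = real K * (g\<^sup>2 + \<beta>\<^sup>2 * v)"
  proof -
    have "(\<Sum>k<K. (\<alpha> - \<beta> * (z0 + real k * \<delta>))\<^sup>2) = (\<Sum>k<K. ((\<alpha> - \<beta> * z0) + real k * (- \<beta> * \<delta>))\<^sup>2)"
      by (simp add: algebra_simps)
    moreover have "2 * (\<alpha> - \<beta> * z0) + (real K - 1) * (- \<beta> * \<delta>) = 2 * g"
    proof -
      have zm2: "2 * zm = 2 * z0 + (real K - 1) * \<delta>" by (simp add: zm_def)
      have "2 * g = 2 * \<alpha> - \<beta> * (2 * zm)" by (simp add: g_def)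
      then show ?thesis unfolding zm2 by (simp add: algebra_simps)
    qed
    ultimately have "12 * (\<Sum>k<K. (\<alpha> - \<beta> * (z0 + real k * \<delta>))\<^sup>2) = 3 * real K * (2 * g)\<^sup>2 + (- \<beta> * \<delta>)\<^sup>2 * real K * ((real K)\<^sup>2 - 1)"
      using affine_sum_of_squares[of "\<alpha> - \<beta> * z0" "- \<beta> * \<delta>" K] by simp
    also have "\<dots> = 12 * (real K * (g\<^sup>2 + \<beta>\<^sup>2 * v))" by (simp add: v_def power_mult_distrib distrib_left mult_ac)
    finally show ?thesis by simp
  qed
  have "\<alpha>\<^sup>2 \<le> 2 * g\<^sup>2 + 2 * \<beta>\<^sup>2"
  proof -
    have "\<alpha> = g + \<beta> * zm" by (simp add: g_def)
    then have "\<alpha>\<^sup>2 \<le> 2 * g\<^sup>2 + 2 * (\<beta> * zm)\<^sup>2"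
      using sum_squares_bound[of g "\<beta> * zm"] by (simp add: power2_sum)
    moreover have "(\<beta> * zm)\<^sup>2 \<le> \<beta>\<^sup>2 * 1"
      unfolding power_mult_distrib using zm by (intro mult_left_mono power_le_one) auto
    ultimately show ?thesis by simp
  qed
  moreover have "\<beta>\<^sup>2 \<le> 16 / l0\<^sup>2 * (\<beta>\<^sup>2 * v)"
  proof -
    have "\<beta>\<^sup>2 * (l0\<^sup>2 / 16) \<le> \<beta>\<^sup>2 * v" using v by (intro mult_left_mono) auto
    then show ?thesis using l0 by (simp add: field_simps)
  qed
  moreover have "(2 + 48 / l0\<^sup>2) * (g\<^sup>2 + \<beta>\<^sup>2 * v) = 2 * g\<^sup>2 + 3 * (16 / l0\<^sup>2 * (\<beta>\<^sup>2 * v)) + (2 * (\<beta>\<^sup>2 * v) + 48 / l0\<^sup>2 * g\<^sup>2)"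
    by (simp add: algebra_simps add_divide_distrib)
  moreover have "0 \<le> 2 * (\<beta>\<^sup>2 * v) + 48 / l0\<^sup>2 * g\<^sup>2"
  proof -
    have "0 \<le> v" by (rule order_trans[OF _ v]) simp
    then show ?thesis by simp
  qed
  ultimately have "\<alpha>\<^sup>2 + \<beta>\<^sup>2 \<le> (2 + 48 / l0\<^sup>2) * (g\<^sup>2 + \<beta>\<^sup>2 * v)" by linarith
  then have "real K * (\<alpha>\<^sup>2 + \<beta>\<^sup>2) \<le> real K * ((2 + 48 / l0\<^sup>2) * (g\<^sup>2 + \<beta>\<^sup>2 * v))" by (intro mult_left_mono) auto
  then show ?thesis unfolding sum by (simp add: mult_ac)
qed

text \<open>
  With \<open>G * exp (- \<kappa> * z)\<close> as the true mean function, this is the difference between the mean function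
  of a candidate with log gain \<open>\<alpha>\<close> and tilt \<open>\<kappa> + \<beta>\<close> and the true one.
\<close>

definition perturb :: "real \<Rightarrow> real \<Rightarrow> real \<Rightarrow> real \<Rightarrow> real \<Rightarrow> real" where
  "perturb G \<kappa> \<alpha> \<beta> z = G * exp (- \<kappa> * z) * (exp (\<alpha> - \<beta> * z) - 1)"

definition unit_grid :: "nat \<Rightarrow> real \<Rightarrow> real \<Rightarrow> bool" where
  "unit_grid K z0 \<delta> \<longleftrightarrow> 2 \<le> K \<and> 0 \<le> z0 \<and> 0 < \<delta> \<and> z0 + (real K - 1) * \<delta> \<le> 1"

text \<open>
  All that summation by parts needs to know about the residuals \<open>W\<close>.
\<close>

definition residual_size :: "nat \<Rightarrow> real \<Rightarrow> (nat \<Rightarrow> real) \<Rightarrow> real" where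
  "residual_size K \<delta> W = \<bar>\<Sum>j<K. W j\<bar> + \<delta> * (\<Sum>k<K. \<bar>\<Sum>j<Suc k. W j\<bar>)"

lemma residual_size_nonneg: "0 \<le> \<delta> \<Longrightarrow> 0 \<le> residual_size K \<delta> W"
  unfolding residual_size_def by (intro add_nonneg_nonneg mult_nonneg_nonneg sum_nonneg) auto

lemma unit_grid_point:
  assumes "unit_grid K z0 \<delta>" "k < K"
  shows "0 \<le> z0 + real k * \<delta>" "z0 + real k * \<delta> \<le> 1"
proof -
  have "real k * \<delta> \<le> (real K - 1) * \<delta>" using assms by (intro mult_right_mono) (auto simp: unit_grid_def)
  then show "0 \<le> z0 + real k * \<delta>" "z0 + real k * \<delta> \<le> 1"
    using assms mult_nonneg_nonneg[of "real k" \<delta>] unfolding unit_grid_def by linarith+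
qed

text \<open>
  For bounded exponents \<open>exp x - 1\<close> is comparable to \<open>x\<close>, which here is affine in the grid point.
\<close>

lemma perturb_sum_of_squares_ge:
  assumes G: "G > 0" and g: "unit_grid K z0 \<delta>" and l0: "0 < l0" "l0 \<le> real K * \<delta>"
    and B: "\<bar>\<alpha>\<bar> \<le> B" "\<bar>\<beta>\<bar> \<le> B"
  shows "(G * exp (- \<bar>\<kappa>\<bar>) * exp (- (2 * B)))\<^sup>2 / (2 + 48 / l0\<^sup>2) * (real K * (\<alpha>\<^sup>2 + \<beta>\<^sup>2))
    \<le> (\<Sum>k<K. (perturb G \<kappa> \<alpha> \<beta> (z0 + real k * \<delta>))\<^sup>2)"
proof -
  \<comment> \<open>The exponent \<open>\<alpha> - \<beta> * z\<close> is at most \<open>2 * B\<close> in absolute value, whence the last factor.\<close>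
  define c0 where "c0 = G * exp (- \<bar>\<kappa>\<bar>) * exp (- (2 * B))"
  have c0: "c0 > 0" using G by (simp add: c0_def)
  have L: "2 + 48 / l0\<^sup>2 > 0" using l0 by (intro add_pos_nonneg) auto
  let ?z = "\<lambda>k. z0 + real k * \<delta>"
  have "(\<Sum>k<K. c0\<^sup>2 * (\<alpha> - \<beta> * ?z k)\<^sup>2) \<le> (\<Sum>k<K. (perturb G \<kappa> \<alpha> \<beta> (?z k))\<^sup>2)"
  proof (rule sum_mono)
    fix k assume "k \<in> {..<K}"
    then have zk: "0 \<le> ?z k" "?z k \<le> 1" using unit_grid_point[OF g] by auto
    let ?x = "\<alpha> - \<beta> * ?z k"
    have "\<bar>\<beta> * ?z k\<bar> \<le> B * 1" unfolding abs_mult using zk B by (intro mult_mono) auto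
    then have x: "\<bar>?x\<bar> \<le> 2 * B" using B abs_triangle_ineq4[of \<alpha> "\<beta> * ?z k"] by linarith
    have "exp (- (2 * B)) * \<bar>?x\<bar> \<le> exp (- \<bar>?x\<bar>) * \<bar>?x\<bar>" using x by (intro mult_right_mono) auto
    also have "\<dots> \<le> \<bar>exp ?x - 1\<bar>" using abs_exp_minus_one_ge[of ?x] by (simp only: mult.commute)
    finally have X: "exp (- (2 * B)) * \<bar>?x\<bar> \<le> \<bar>exp ?x - 1\<bar>" .
    have e3: "G * exp (- \<bar>\<kappa>\<bar>) \<le> G * exp (- \<kappa> * ?z k)" using G exp_tilt_bounds(2)[OF zk] by (intro mult_left_mono) auto
    have "(G * exp (- \<bar>\<kappa>\<bar>)) * (exp (- (2 * B)) * \<bar>?x\<bar>) \<le> (G * exp (- \<kappa> * ?z k)) * \<bar>exp ?x - 1\<bar>"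
      by (rule mult_mono[OF e3 X]) (use G in auto)
    then have "c0 * \<bar>?x\<bar> \<le> \<bar>perturb G \<kappa> \<alpha> \<beta> (?z k)\<bar>" using G by (simp add: c0_def perturb_def abs_mult mult.assoc)
    then have "(c0 * \<bar>?x\<bar>)\<^sup>2 \<le> \<bar>perturb G \<kappa> \<alpha> \<beta> (?z k)\<bar>\<^sup>2" using c0 by (intro power_mono) auto
    then show "c0\<^sup>2 * ?x\<^sup>2 \<le> (perturb G \<kappa> \<alpha> \<beta> (?z k))\<^sup>2" by (simp only: power2_abs power_mult_distrib)
  qed
  then have 1: "c0\<^sup>2 * (\<Sum>k<K. (\<alpha> - \<beta> * ?z k)\<^sup>2) \<le> (\<Sum>k<K. (perturb G \<kappa> \<alpha> \<beta> (?z k))\<^sup>2)"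
    by (simp only: sum_distrib_left)
  have "c0\<^sup>2 * (real K * (\<alpha>\<^sup>2 + \<beta>\<^sup>2)) \<le> c0\<^sup>2 * ((2 + 48 / l0\<^sup>2) * (\<Sum>k<K. (\<alpha> - \<beta> * ?z k)\<^sup>2))"
    using g l0 by (intro mult_left_mono affine_sum_of_squares_ge) (auto simp: unit_grid_def)
  then have "c0\<^sup>2 * (real K * (\<alpha>\<^sup>2 + \<beta>\<^sup>2)) \<le> (c0\<^sup>2 * (\<Sum>k<K. (\<alpha> - \<beta> * ?z k)\<^sup>2)) * (2 + 48 / l0\<^sup>2)" by (simp only: mult_ac)
  then have "c0\<^sup>2 / (2 + 48 / l0\<^sup>2) * (real K * (\<alpha>\<^sup>2 + \<beta>\<^sup>2)) \<le> c0\<^sup>2 * (\<Sum>k<K. (\<alpha> - \<beta> * ?z k)\<^sup>2)"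
    using L by (simp add: pos_divide_le_eq)
  then show ?thesis using 1 unfolding c0_def by linarith
qed

text \<open>
  Both \<open>perturb\<close> and its derivative are at most a constant times \<open>\<bar>\<alpha>\<bar> + \<bar>\<beta>\<bar>\<close> on the unit interval.
\<close>

lemma perturb_inner_product_le:
  assumes G: "G > 0" and g: "unit_grid K z0 \<delta>" and B: "\<bar>\<alpha>\<bar> \<le> B" "\<bar>\<beta>\<bar> \<le> B"
  shows "\<bar>\<Sum>k<K. W k * perturb G \<kappa> \<alpha> \<beta> (z0 + real k * \<delta>)\<bar>
     \<le> G * exp \<bar>\<kappa>\<bar> * exp (2 * B) * (\<bar>\<kappa>\<bar> + 1) * (\<bar>\<alpha>\<bar> + \<bar>\<beta>\<bar>) * residual_size K \<delta> W"
proof -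
  define C1 where "C1 = G * exp \<bar>\<kappa>\<bar> * exp (2 * B)"
  define C where "C = C1 * (\<bar>\<kappa>\<bar> + 1)"
  have C1: "C1 > 0" using G by (simp add: C1_def)
  have C: "C \<ge> C1" unfolding C_def using C1 by simp
  have \<delta>: "\<delta> > 0" and K: "K > 0" using g by (auto simp: unit_grid_def)
  define \<rho> where "\<rho> = \<bar>\<alpha>\<bar> + \<bar>\<beta>\<bar>"
  have \<rho>: "\<rho> \<ge> 0" by (simp add: \<rho>_def)
  let ?z = "\<lambda>k. z0 + real k * \<delta>"
  define u where "u = perturb G \<kappa> \<alpha> \<beta>"
  define u' where "u' y = - \<kappa> * u y + G * exp (- \<kappa> * y) * (exp (\<alpha> - \<beta> * y) * - \<beta>)" for y
  have du: "(u has_real_derivative u' y) (at y)" for y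
    unfolding u_def perturb_def[abs_def] u'_def by (auto intro!: derivative_eq_intros simp: algebra_simps)
  have bd: "\<bar>u y\<bar> \<le> C1 * \<rho>" "\<bar>u' y\<bar> \<le> C * \<rho>" if y: "0 \<le> y" "y \<le> 1" for y
  proof -
    let ?x = "\<alpha> - \<beta> * y"
    have "\<bar>\<beta> * y\<bar> \<le> \<bar>\<beta>\<bar> * 1" unfolding abs_mult using y by (intro mult_mono) auto
    then have x: "\<bar>?x\<bar> \<le> \<rho>" unfolding \<rho>_def using abs_triangle_ineq4[of \<alpha> "\<beta> * y"] by linarith
    then have xB: "\<bar>?x\<bar> \<le> 2 * B" using B by (simp add: \<rho>_def)
    have ek: "exp (- \<kappa> * y) \<le> exp \<bar>\<kappa>\<bar>" by (rule exp_tilt_bounds[OF y])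
    have "\<bar>exp ?x - 1\<bar> \<le> \<bar>?x\<bar> * exp \<bar>?x\<bar>" by (rule abs_exp_minus_one_le)
    also have "\<dots> \<le> \<rho> * exp (2 * B)" using x xB \<rho> by (intro mult_mono) auto
    finally have X: "\<bar>exp ?x - 1\<bar> \<le> \<rho> * exp (2 * B)" .
    have e3: "G * exp (- \<kappa> * y) \<le> G * exp \<bar>\<kappa>\<bar>" using G ek by (intro mult_left_mono) auto
    have "(G * exp (- \<kappa> * y)) * \<bar>exp ?x - 1\<bar> \<le> (G * exp \<bar>\<kappa>\<bar>) * (\<rho> * exp (2 * B))"
      by (rule mult_mono[OF e3 X]) (use G in auto)
    then show 1: "\<bar>u y\<bar> \<le> C1 * \<rho>" using G by (simp add: u_def perturb_def C1_def abs_mult mult_ac)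
    have X: "exp ?x * \<bar>\<beta>\<bar> \<le> exp (2 * B) * \<rho>" using xB by (intro mult_mono) (auto simp: \<rho>_def)
    have e3: "G * exp (- \<kappa> * y) \<le> G * exp \<bar>\<kappa>\<bar>" using G ek by (intro mult_left_mono) auto
    have "(G * exp (- \<kappa> * y)) * (exp ?x * \<bar>\<beta>\<bar>) \<le> (G * exp \<bar>\<kappa>\<bar>) * (exp (2 * B) * \<rho>)"
      by (rule mult_mono[OF e3 X]) (use G in auto)
    then have 2: "\<bar>G * exp (- \<kappa> * y) * (exp ?x * - \<beta>)\<bar> \<le> C1 * \<rho>" using G by (simp add: C1_def abs_mult mult_ac)
    have "\<bar>- \<kappa> * u y\<bar> \<le> \<bar>\<kappa>\<bar> * (C1 * \<rho>)" using 1 by (simp add: abs_mult mult_left_mono)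
    then have "\<bar>u' y\<bar> \<le> \<bar>\<kappa>\<bar> * (C1 * \<rho>) + C1 * \<rho>" unfolding u'_def using 2 by (intro order_trans[OF abs_triangle_ineq] add_mono)
    then show "\<bar>u' y\<bar> \<le> C * \<rho>" by (simp add: C_def algebra_simps)
  qed
  note zk = unit_grid_point[OF g]
  have "\<bar>\<Sum>k<K. W k * u (?z k)\<bar> \<le> (C * \<rho>) * \<bar>\<Sum>j<K. W j\<bar> + (C * \<rho> * \<delta>) * (\<Sum>k<K. \<bar>\<Sum>j<Suc k. W j\<bar>)"
  proof (rule sum_by_parts_le)
    show "\<bar>u (?z k)\<bar> \<le> C * \<rho>" if "k < K" for k
      using bd(1)[OF zk[OF that]] C \<rho> mult_right_mono[OF C \<rho>] by linarith
    show "0 \<le> C * \<rho> * \<delta>" using C C1 \<rho> \<delta> by simp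
    show "0 < K" by (rule K)
    show "\<bar>u (?z (Suc k)) - u (?z k)\<bar> \<le> C * \<rho> * \<delta>" if k: "Suc k < K" for k
    proof -
      have lt: "?z k < ?z (Suc k)" using \<delta> by (simp add: algebra_simps)
      obtain y where y: "?z k < y" "y < ?z (Suc k)" "u (?z (Suc k)) - u (?z k) = (?z (Suc k) - ?z k) * u' y"
        using MVT2[OF lt, of u u'] du by auto
      have "0 \<le> y" "y \<le> 1" using y(1,2) zk(1)[of k] zk(2)[OF k] k by linarith+
      then have "\<bar>u' y\<bar> \<le> C * \<rho>" by (rule bd)
      moreover have "?z (Suc k) - ?z k = \<delta>" by (simp add: algebra_simps)
      ultimately show ?thesis unfolding y(3) using \<delta> by (simp add: abs_mult mult.commute mult_right_mono)
    qed
  qed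
  also have "\<dots> = C * \<rho> * residual_size K \<delta> W"
    unfolding residual_size_def by (simp only: distrib_left mult_ac)
  finally show ?thesis by (simp only: u_def \<rho>_def C_def C1_def)
qed

text \<open>
  By minimality the squared perturbation is at most twice its inner product with the residuals. The left hand side is
  quadratic and the right hand side linear in the coordinates, so the coordinates are bounded
  by the partial sums of the residuals, in which the fluctuations at different positions cancel.
\<close>

lemma least_squares_bound:
  assumes G: "G1 > 0" "G2 > 0" and l0: "l0 > (0::real)"
  obtains C where "C \<ge> 0" and "\<And>K z0 \<delta> \<alpha>1 \<alpha>2 \<beta> W1 W2. unit_grid K z0 \<delta> \<Longrightarrow> l0 \<le> real K * \<delta> \<Longrightarrow>
    \<bar>\<alpha>1\<bar> \<le> B \<Longrightarrow> \<bar>\<alpha>2\<bar> \<le> B \<Longrightarrow> \<bar>\<beta>\<bar> \<le> B \<Longrightarrow>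
    (\<Sum>k<K. (W1 k - perturb G1 \<kappa> \<alpha>1 \<beta> (z0 + real k * \<delta>))\<^sup>2) + (\<Sum>k<K. (W2 k - perturb G2 \<kappa> \<alpha>2 \<beta> (z0 + real k * \<delta>))\<^sup>2)
      \<le> (\<Sum>k<K. (W1 k)\<^sup>2) + (\<Sum>k<K. (W2 k)\<^sup>2) \<Longrightarrow>
    real K * (\<bar>\<alpha>1\<bar> + \<bar>\<alpha>2\<bar> + \<bar>\<beta>\<bar>) \<le> C * (residual_size K \<delta> W1 + residual_size K \<delta> W2)"
proof -
  define lo up where "lo G = (G * exp (- \<bar>\<kappa>\<bar>) * exp (- (2 * B)))\<^sup>2 / (2 + 48 / l0\<^sup>2)"
    and "up G = G * exp \<bar>\<kappa>\<bar> * exp (2 * B) * (\<bar>\<kappa>\<bar> + 1)" for G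
  define c where "c = min (lo G1) (lo G2)"
  define D where "D = max (up G1) (up G2)"
  have "lo G > 0" "up G > 0" if "G > 0" for G
    using that by (auto simp: lo_def up_def intro!: divide_pos_pos add_pos_nonneg mult_pos_pos)
  from this[OF G(1)] this[OF G(2)] have c: "c > 0" "c \<le> lo G1" "c \<le> lo G2" and D: "D \<ge> 0" "up G1 \<le> D" "up G2 \<le> D"
    by (auto simp: c_def D_def)
  show ?thesis
  proof (rule that[of "6 * D / c"])
    show "6 * D / c \<ge> 0" using c D by simp
    fix K :: nat and z0 \<delta> \<alpha>1 \<alpha>2 \<beta> :: real and W1 W2 :: "nat \<Rightarrow> real"
    assume g: "unit_grid K z0 \<delta>" and l: "l0 \<le> real K * \<delta>" and B: "\<bar>\<alpha>1\<bar> \<le> B" "\<bar>\<alpha>2\<bar> \<le> B" "\<bar>\<beta>\<bar> \<le> B"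
    define u1 u2 where "u1 k = perturb G1 \<kappa> \<alpha>1 \<beta> (z0 + real k * \<delta>)" and "u2 k = perturb G2 \<kappa> \<alpha>2 \<beta> (z0 + real k * \<delta>)" for k
    assume "(\<Sum>k<K. (W1 k - perturb G1 \<kappa> \<alpha>1 \<beta> (z0 + real k * \<delta>))\<^sup>2) + (\<Sum>k<K. (W2 k - perturb G2 \<kappa> \<alpha>2 \<beta> (z0 + real k * \<delta>))\<^sup>2)
      \<le> (\<Sum>k<K. (W1 k)\<^sup>2) + (\<Sum>k<K. (W2 k)\<^sup>2)"
    then have opt: "(\<Sum>k<K. (W1 k - u1 k)\<^sup>2) + (\<Sum>k<K. (W2 k - u2 k)\<^sup>2) \<le> (\<Sum>k<K. (W1 k)\<^sup>2) + (\<Sum>k<K. (W2 k)\<^sup>2)"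
      by (simp only: u1_def u2_def)
    define R1 R2 where "R1 = residual_size K \<delta> W1" and "R2 = residual_size K \<delta> W2"
    have R: "R1 \<ge> 0" "R2 \<ge> 0" using g by (auto simp: R1_def R2_def unit_grid_def intro!: residual_size_nonneg)
    define \<rho> where "\<rho> = \<bar>\<alpha>1\<bar> + \<bar>\<alpha>2\<bar> + \<bar>\<beta>\<bar>"
    have \<rho>: "\<rho> \<ge> 0" by (simp add: \<rho>_def)
    have ex: "(\<Sum>k<K. (W k - u k)\<^sup>2) = (\<Sum>k<K. (W k)\<^sup>2) - 2 * (\<Sum>k<K. W k * u k) + (\<Sum>k<K. (u k)\<^sup>2)" for W u :: "nat \<Rightarrow> real"
      by (simp add: power2_diff sum.distrib sum_subtractf sum_distrib_left mult.assoc)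
    have 1: "(\<Sum>k<K. (u1 k)\<^sup>2) + (\<Sum>k<K. (u2 k)\<^sup>2) \<le> 2 * (\<Sum>k<K. W1 k * u1 k) + 2 * (\<Sum>k<K. W2 k * u2 k)"
      using opt unfolding ex by linarith
    have ip: "(\<Sum>k<K. W k * perturb G \<kappa> \<alpha> \<beta> (z0 + real k * \<delta>)) \<le> D * \<rho> * residual_size K \<delta> W"
      if "G > 0" "up G \<le> D" "\<bar>\<alpha>\<bar> \<le> B" "\<bar>\<alpha>\<bar> + \<bar>\<beta>\<bar> \<le> \<rho>" for G \<alpha> W
    proof -
      have "(\<Sum>k<K. W k * perturb G \<kappa> \<alpha> \<beta> (z0 + real k * \<delta>)) \<le> up G * (\<bar>\<alpha>\<bar> + \<bar>\<beta>\<bar>) * residual_size K \<delta> W"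
        unfolding up_def by (rule abs_le_D1[OF perturb_inner_product_le[OF that(1) g that(3) B(3)]])
      also have "\<dots> \<le> D * \<rho> * residual_size K \<delta> W"
        using D that g by (intro mult_mono mult_right_mono residual_size_nonneg) (auto simp: unit_grid_def)
      finally show ?thesis .
    qed
    have up1: "(\<Sum>k<K. W1 k * u1 k) \<le> D * \<rho> * R1"
      unfolding u1_def R1_def by (rule ip) (use G D B in \<open>auto simp: \<rho>_def\<close>)
    have up2: "(\<Sum>k<K. W2 k * u2 k) \<le> D * \<rho> * R2"
      unfolding u2_def R2_def by (rule ip) (use G D B in \<open>auto simp: \<rho>_def\<close>)
    have sq: "c * (real K * (\<alpha>\<^sup>2 + \<beta>\<^sup>2)) \<le> (\<Sum>k<K. (perturb G \<kappa> \<alpha> \<beta> (z0 + real k * \<delta>))\<^sup>2)"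
      if "G > 0" "c \<le> lo G" "\<bar>\<alpha>\<bar> \<le> B" for G \<alpha>
    proof -
      have "c * (real K * (\<alpha>\<^sup>2 + \<beta>\<^sup>2)) \<le> lo G * (real K * (\<alpha>\<^sup>2 + \<beta>\<^sup>2))" using that by (intro mult_right_mono) auto
      also have "\<dots> \<le> (\<Sum>k<K. (perturb G \<kappa> \<alpha> \<beta> (z0 + real k * \<delta>))\<^sup>2)"
        unfolding lo_def by (rule perturb_sum_of_squares_ge[OF that(1) g l0 l that(3) B(3)])
      finally show ?thesis .
    qed
    have lo1: "c * (real K * (\<alpha>1\<^sup>2 + \<beta>\<^sup>2)) \<le> (\<Sum>k<K. (u1 k)\<^sup>2)" and lo2: "c * (real K * (\<alpha>2\<^sup>2 + \<beta>\<^sup>2)) \<le> (\<Sum>k<K. (u2 k)\<^sup>2)"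
      unfolding u1_def u2_def using G c B by (auto intro!: sq)
    have \<rho>sq: "\<rho>\<^sup>2 \<le> 3 * ((\<alpha>1\<^sup>2 + \<beta>\<^sup>2) + (\<alpha>2\<^sup>2 + \<beta>\<^sup>2))"
    proof -
      have gen: "(x + y + z)\<^sup>2 \<le> 3 * (x\<^sup>2 + y\<^sup>2 + z\<^sup>2)" for x y z :: real
      proof -
        have "0 \<le> (x - y)\<^sup>2 + (x - z)\<^sup>2 + (y - z)\<^sup>2" by simp
        then show ?thesis by (simp add: power2_eq_square algebra_simps)
      qed
      have "\<rho>\<^sup>2 \<le> 3 * (\<bar>\<alpha>1\<bar>\<^sup>2 + \<bar>\<alpha>2\<bar>\<^sup>2 + \<bar>\<beta>\<bar>\<^sup>2)" unfolding \<rho>_def by (rule gen)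
      then have "\<rho>\<^sup>2 \<le> 3 * (\<alpha>1\<^sup>2 + \<alpha>2\<^sup>2 + \<beta>\<^sup>2)" by simp
      also have "\<dots> \<le> 3 * ((\<alpha>1\<^sup>2 + \<beta>\<^sup>2) + (\<alpha>2\<^sup>2 + \<beta>\<^sup>2))" by (intro mult_left_mono) auto
      finally show ?thesis .
    qed
    have "(c * real K) * \<rho>\<^sup>2 \<le> (c * real K) * (3 * ((\<alpha>1\<^sup>2 + \<beta>\<^sup>2) + (\<alpha>2\<^sup>2 + \<beta>\<^sup>2)))" using c \<rho>sq by (intro mult_left_mono) auto
    also have "\<dots> = 3 * (c * (real K * (\<alpha>1\<^sup>2 + \<beta>\<^sup>2)) + c * (real K * (\<alpha>2\<^sup>2 + \<beta>\<^sup>2)))" by (simp add: algebra_simps)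
    also have "\<dots> \<le> 3 * (2 * (D * \<rho> * R1) + 2 * (D * \<rho> * R2))"
    proof (rule mult_left_mono)
      show "c * (real K * (\<alpha>1\<^sup>2 + \<beta>\<^sup>2)) + c * (real K * (\<alpha>2\<^sup>2 + \<beta>\<^sup>2)) \<le> 2 * (D * \<rho> * R1) + 2 * (D * \<rho> * R2)"
        using add_mono[OF lo1 lo2] 1 up1 up2 by (meson add_mono mult_left_mono order_trans zero_le_numeral)
    qed simp
    finally have "(c * real K * \<rho>) * \<rho> \<le> (6 * D * (R1 + R2)) * \<rho>" by (simp add: power2_eq_square algebra_simps)
    then have "c * real K * \<rho> \<le> 6 * D * (R1 + R2)"
    proof (cases "\<rho> = 0")
      case True
      then show ?thesis using D R by simp
    next
      case False
      then have "0 < \<rho>" using \<rho> by simp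
      then show ?thesis by (rule mult_right_le_imp_le[rotated]) fact
    qed
    then have "real K * \<rho> \<le> 6 * D / c * (R1 + R2)" using c by (simp add: pos_le_divide_eq mult_ac)
    then show "real K * (\<bar>\<alpha>1\<bar> + \<bar>\<alpha>2\<bar> + \<bar>\<beta>\<bar>) \<le> 6 * D / c * (residual_size K \<delta> W1 + residual_size K \<delta> W2)"
      by (simp only: \<rho>_def R1_def R2_def)
  qed
qed

section \<open>Concentration of realised quadratic variations\<close>

text \<open>
  The non-asymptotic form of the conditions on the grid: the lags fit into the grid with room to spare in time,
  the time scale is at most 1, and the mesh ratio is \<open>r\<close>.
\<close>

definition fine_grid :: "real \<Rightarrow> real \<Rightarrow> real \<Rightarrow> nat \<Rightarrow> nat \<Rightarrow> nat \<Rightarrow> nat \<Rightarrow> bool" where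
  "fine_grid T b r M N v w \<longleftrightarrow> 1 \<le> M \<and> 1 \<le> v \<and> 1 \<le> w \<and> w \<le> M \<and> 2 * v \<le> N \<and>
     real v * tstep T N \<le> 1 \<and> mesh_ratio T b M N v w = r"

context spde_grid
begin

definition mid where "mid k = (ygrid b M k + ygrid b M (k + w)) / 2"

lemma mid_shift: "mid k + real w * \<delta> / 2 = ygrid b M (k + w)" "mid k - real w * \<delta> / 2 = ygrid b M k"
  by (simp_all add: mid_def ygrid_def field_simps)

text \<open>
  The normalisation is pulled out so that \<open>second_moment_square_sum\<close> applies to the \<open>n * m\<close> increments; the
  covariances are regrouped by pairs of times, as in \<open>covariance_square_sum\<close>.
\<close>

lemma quadratic_variation_second_moment:
  assumes m: "m + w \<le> Suc M" and n: "n > 0"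
  shows "integrable P (\<lambda>\<omega>. (\<Sum>k<m. 1 / (real n * h) * (\<Sum>i<n. (D i k \<omega>)\<^sup>2) - f k)\<^sup>2)" (is ?I)
    and "(\<integral>\<omega>. (\<Sum>k<m. 1 / (real n * h) * (\<Sum>i<n. (D i k \<omega>)\<^sup>2) - f k)\<^sup>2 \<partial>P) =
      (1 / (real n * h))\<^sup>2 * (2 * (\<Sum>i<n. \<Sum>j<n. \<Sum>k<m. \<Sum>k'<m. (\<integral>\<omega>. D i k \<omega> * D j k' \<omega> \<partial>P)\<^sup>2)
        + (\<Sum>i<n. \<Sum>k<m. (\<integral>\<omega>. (D i k \<omega>)\<^sup>2 \<partial>P) - h * f k)\<^sup>2)" (is ?E)
proof -
  let ?F = "{..<n} \<times> {..<m}" and ?D = "\<lambda>p. D (fst p) (snd p)" and ?a = "1 / (real n * h)"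
  define c where "c = real n * h * (\<Sum>k<m. f k)"
  have a: "real n * h \<noteq> 0" using n h_pos by simp
  have V: "?D p \<in> V" if "p \<in> ?F" for p using that m by (intro D_span) auto
  have F: "finite ?F" by simp
  have eq: "(\<lambda>\<omega>. (\<Sum>k<m. ?a * (\<Sum>i<n. (D i k \<omega>)\<^sup>2) - f k)\<^sup>2) = (\<lambda>\<omega>. ?a\<^sup>2 * ((\<Sum>p\<in>?F. (?D p \<omega>)\<^sup>2) - c)\<^sup>2)"
  proof (rule ext)
    fix \<omega>
    have "(\<Sum>k<m. ?a * (\<Sum>i<n. (D i k \<omega>)\<^sup>2) - f k) = ?a * ((\<Sum>k<m. \<Sum>i<n. (D i k \<omega>)\<^sup>2) - c)"
    proof -
      have "?a * c = (\<Sum>k<m. f k)" using a by (simp add: c_def)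
      then show ?thesis by (simp only: sum_subtractf sum_distrib_left right_diff_distrib)
    qed
    also have "(\<Sum>k<m. \<Sum>i<n. (D i k \<omega>)\<^sup>2) = (\<Sum>i<n. \<Sum>k<m. (D i k \<omega>)\<^sup>2)" by (rule sum.swap)
    also have "\<dots> = (\<Sum>p\<in>?F. (?D p \<omega>)\<^sup>2)" by (simp add: sum.cartesian_product case_prod_beta)
    finally show "(\<Sum>k<m. ?a * (\<Sum>i<n. (D i k \<omega>)\<^sup>2) - f k)\<^sup>2 = ?a\<^sup>2 * ((\<Sum>p\<in>?F. (?D p \<omega>)\<^sup>2) - c)\<^sup>2"
      by (simp only: power_mult_distrib)
  qed
  show ?I unfolding eq using second_moment_square_sum(1)[OF V F] by simp
  have sumF: "(\<Sum>p\<in>?F. g p) = (\<Sum>i<n. \<Sum>k<m. g (i, k))" for g :: "nat \<times> nat \<Rightarrow> real"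
    by (simp add: sum.cartesian_product)
  have cov: "(\<Sum>p\<in>?F. \<Sum>q\<in>?F. (\<integral>\<omega>. ?D p \<omega> * ?D q \<omega> \<partial>P)\<^sup>2)
     = (\<Sum>i<n. \<Sum>j<n. \<Sum>k<m. \<Sum>k'<m. (\<integral>\<omega>. D i k \<omega> * D j k' \<omega> \<partial>P)\<^sup>2)"
  proof -
    have "(\<Sum>p\<in>?F. \<Sum>q\<in>?F. (\<integral>\<omega>. ?D p \<omega> * ?D q \<omega> \<partial>P)\<^sup>2)
      = (\<Sum>i<n. \<Sum>k<m. \<Sum>j<n. \<Sum>k'<m. (\<integral>\<omega>. D i k \<omega> * D j k' \<omega> \<partial>P)\<^sup>2)"
      by (simp only: sumF fst_conv snd_conv)
    also have "\<dots> = (\<Sum>i<n. \<Sum>j<n. \<Sum>k<m. \<Sum>k'<m. (\<integral>\<omega>. D i k \<omega> * D j k' \<omega> \<partial>P)\<^sup>2)"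
      by (intro sum.cong refl sum.swap)
    finally show ?thesis .
  qed
  have mean: "(\<Sum>p\<in>?F. \<integral>\<omega>. (?D p \<omega>)\<^sup>2 \<partial>P) - c = (\<Sum>i<n. \<Sum>k<m. (\<integral>\<omega>. (D i k \<omega>)\<^sup>2 \<partial>P) - h * f k)"
  proof -
    have "(\<Sum>p\<in>?F. \<integral>\<omega>. (?D p \<omega>)\<^sup>2 \<partial>P) = (\<Sum>i<n. \<Sum>k<m. \<integral>\<omega>. (D i k \<omega>)\<^sup>2 \<partial>P)"
      by (simp add: sum.cartesian_product case_prod_beta)
    then show ?thesis by (simp add: sum_subtractf sum_distrib_left c_def mult.assoc)
  qed
  show ?E unfolding eq using second_moment_square_sum(2)[OF V F, of "\<lambda>p. p" c]
    by (simp add: second_moment_square_sum(2)[OF V F] cov mean)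
qed

end

context spde
begin

text \<open>
  The deviation of the normalised quadratic variation at position \<open>k\<close> from the true mean function.
\<close>

definition resid :: "real \<Rightarrow> real \<Rightarrow> nat \<Rightarrow> nat \<Rightarrow> nat \<Rightarrow> nat \<Rightarrow> real \<Rightarrow> nat \<Rightarrow> 'a \<Rightarrow> real" where
  "resid T b M N v w r k \<omega> =
     1 / (real (Suc (N - v)) * sqrt (real v * tstep T N)) * (\<Sum>i<Suc (N - v). (dincr X T b M N v w i k \<omega>)\<^sup>2)
       - \<sigma>\<^sup>2 * psi \<theta>2 r * exp (- \<kappa> * ((ygrid b M k + ygrid b M (k + w)) / 2))"

text \<open>
  With \<open>h = sqrt (v * tstep T N)\<close>, the variance part is at most a constant times
  \<open>1 / (n * h)^2 * (n * v * (h^2 * M) * M * h)\<close>, and \<open>v / n\<close> is of the order \<open>h^2\<close>. The bias part is of the order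
  \<open>M^2 * h^4\<close>, which is smaller as \<open>h \<le> 1\<close>.
\<close>

lemma quadratic_variation_concentration:
  assumes b: "0 < b" "b < 1 / 2" and T: "T > 0" and r: "r > 0"
  obtains C where "C \<ge> 0"
    and "\<And>M N v w m. fine_grid T b r M N v w \<Longrightarrow> m + w \<le> Suc M \<Longrightarrow>
      integrable P (\<lambda>\<omega>. (\<Sum>k<m. resid T b M N v w r k \<omega>)\<^sup>2) \<and>
      (\<integral>\<omega>. (\<Sum>k<m. resid T b M N v w r k \<omega>)\<^sup>2 \<partial>P) \<le> C * (real M)\<^sup>2 * sqrt (real v * tstep T N) ^ 3"
proof -
  obtain C0 where C0: "C0 \<ge> 0" "\<And>h z S. 0 < h \<Longrightarrow> h \<le> 1 \<Longrightarrow> b \<le> z - r * h / 2 \<Longrightarrow> z + r * h / 2 \<le> 1 - b \<Longrightarrow>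
      (\<lambda>l. (1 - exp (- lam l * h\<^sup>2)) / lam l * (e l (z + r * h / 2) - e l (z - r * h / 2))\<^sup>2) sums S \<Longrightarrow>
      \<bar>S - exp (- \<kappa> * z) * (h * psi \<theta>2 r)\<bar> \<le> C0 * h ^ 3"
    using spectral_energy_expansion[OF b r] by blast
  define K0 where "K0 = exp \<bar>\<kappa>\<bar>"
  define CB where "CB = (2 + pi\<^sup>2 * r\<^sup>2 / \<mu>) / (1 - 2 * b)"
  define CV where "CV = 2 * (\<sigma> ^ 4 * (3 * (8 * K0 * CB * (2 * (8 * K0)) * (4 / sqrt \<mu>)))) * (2 / T)"
  define C where "C = CV + 4 * (\<sigma>\<^sup>2 * C0)\<^sup>2"
  have nn: "K0 > 0" "CB \<ge> 0" "CV \<ge> 0" using b T \<mu>_pos by (auto simp: K0_def CB_def CV_def)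
  show ?thesis
  proof (rule that[of C])
    show "C \<ge> 0" using nn by (simp add: C_def)
    fix M N v w m :: nat
    assume "fine_grid T b r M N v w" and m: "m + w \<le> Suc M"
    then have M: "1 \<le> M" and v: "1 \<le> v" and w: "1 \<le> w" "w \<le> M" and N: "2 * v \<le> N"
      and h1: "real v * tstep T N \<le> 1" and mesh: "mesh_ratio T b M N v w = r" by (auto simp: fine_grid_def)
    interpret spde_grid P X \<sigma> \<theta>2 \<theta>1 \<theta>0 T b M N v w
      using T b M v w N by unfold_locales auto
    define n where "n = Suc (N - v)"
    have n: "n > 0" "real N \<le> 2 * real n" using N by (auto simp: n_def)
    have h: "0 < h" "h \<le> 1" using h_pos h1 by (auto simp: h_def)
    have "real w * \<delta> / h = r" using mesh by (simp add: mesh_ratio_def h_def)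
    then have d: "real w * \<delta> = r * h" using h by (simp add: field_simps)
    define f where "f k = \<sigma>\<^sup>2 * psi \<theta>2 r * exp (- \<kappa> * mid k)" for k
    have mM: "real m \<le> 2 * real M" using m w M by linarith
    have tilt_eq: "tilt = K0" by (simp add: tilt_def K0_def)
    let ?cov = "\<Sum>i<n. \<Sum>j<n. \<Sum>k<m. \<Sum>k'<m. (\<integral>\<omega>. D i k \<omega> * D j k' \<omega> \<partial>P)\<^sup>2"
    have BBle: "samp \<le> CB * (h\<^sup>2 * real M)"
    proof -
      \<comment> \<open>As \<open>w \<ge> 1\<close>, the mesh condition forces \<open>\<delta> \<le> r * h\<close>: the time scale cannot be finer than the spatial grid.\<close>
      have "1 * \<delta> \<le> real w * \<delta>" using w \<delta>_pos by (intro mult_right_mono) auto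
      then have "\<delta>\<^sup>2 \<le> (r * h)\<^sup>2" using \<delta>_pos d by (intro power_mono) auto
      then have "\<delta>\<^sup>2 * pi\<^sup>2 * (1 / \<mu>) \<le> (r * h)\<^sup>2 * pi\<^sup>2 * (1 / \<mu>)" using \<mu>_pos by (intro mult_right_mono) auto
      then have "\<delta> * samp \<le> (2 + pi\<^sup>2 * r\<^sup>2 / \<mu>) * h\<^sup>2"
        using \<delta>_pos by (simp add: samp_def power2_eq_square algebra_simps)
      then have "samp \<le> (2 + pi\<^sup>2 * r\<^sup>2 / \<mu>) * h\<^sup>2 / \<delta>" using \<delta>_pos by (simp add: pos_le_divide_eq mult.commute)
      also have "\<dots> = CB * (h\<^sup>2 * real M)" using M b by (simp add: ystep_def CB_def)
      finally show ?thesis .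
    qed
    have cov: "?cov \<le> \<sigma> ^ 4 * (3 * real n * real v * (8 * K0 * (CB * (h\<^sup>2 * real M)) * (2 * real M * (8 * K0)) * (4 * h / sqrt \<mu>)))"
    proof -
      have "?cov \<le> \<sigma> ^ 4 * (3 * real n * real v * (8 * K0 * samp * (real m * (8 * K0)) * (4 * h / sqrt \<mu>)))"
        using covariance_square_sum[OF m, of n] by (simp only: tilt_eq)
      also have "\<dots> \<le> \<sigma> ^ 4 * (3 * real n * real v * (8 * K0 * (CB * (h\<^sup>2 * real M)) * (2 * real M * (8 * K0)) * (4 * h / sqrt \<mu>)))"
        using nn h \<mu>_pos samp_nonneg by (intro mult_left_mono mult_right_mono mult_mono BBle mM mult_nonneg_nonneg) auto
      finally show ?thesis .
    qed
    have var: "(1 / (real n * h))\<^sup>2 * (2 * ?cov) \<le> CV * ((real M)\<^sup>2 * h ^ 3)"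
    proof -
      have vn: "real v / real n \<le> 2 / T * h\<^sup>2"
      proof -
        have "h\<^sup>2 = real v * T / real N" by (simp add: h_square tstep_def)
        moreover have "real v / real n \<le> 2 * real v / real N"
          using n v N by (simp add: field_simps mult_left_mono)
        ultimately show ?thesis using T by (simp add: field_simps)
      qed
      let ?K = "2 * (\<sigma> ^ 4 * (3 * (8 * K0 * CB * (2 * (8 * K0)) * (4 / sqrt \<mu>))))"
      have "(1 / (real n * h))\<^sup>2 * (2 * ?cov) \<le> (1 / (real n * h))\<^sup>2 * (2 * (\<sigma> ^ 4 * (3 * real n * real v * (8 * K0 * (CB * (h\<^sup>2 * real M)) * (2 * real M * (8 * K0)) * (4 * h / sqrt \<mu>)))))"
        using cov by (intro mult_left_mono) auto
      also have "\<dots> = ?K * ((real v / real n) * ((real M)\<^sup>2 * h))"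
        using n h by (simp add: power2_eq_square field_simps)
      also have "\<dots> \<le> ?K * ((2 / T * h\<^sup>2) * ((real M)\<^sup>2 * h))"
        using nn \<mu>_pos h by (intro mult_left_mono mult_right_mono vn) auto
      also have "\<dots> = CV * ((real M)\<^sup>2 * h ^ 3)" by (simp add: CV_def power2_eq_square power3_eq_cube)
      finally show ?thesis .
    qed
    have bias1: "\<bar>(\<integral>\<omega>. (D i k \<omega>)\<^sup>2 \<partial>P) - h * f k\<bar> \<le> \<sigma>\<^sup>2 * C0 * h ^ 3" if k: "k < m" for i k
    proof -
      have kM: "k + w \<le> M" using k m by simp
      define S where "S = (\<integral>\<omega>. (D i k \<omega>)\<^sup>2 \<partial>P) / \<sigma>\<^sup>2"
      have "(\<lambda>l. (\<sigma>\<^sup>2 * (tvar l * (de l k)\<^sup>2)) / \<sigma>\<^sup>2) sums S"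
        unfolding S_def by (intro sums_divide D_second_moment_sums kM)
      then have "(\<lambda>l. (1 - exp (- lam l * h\<^sup>2)) / lam l * (e l (mid k + r * h / 2) - e l (mid k - r * h / 2))\<^sup>2) sums S"
        using \<sigma> by (simp add: tvar_def de_def d[symmetric] mid_shift)
      then have "\<bar>S - exp (- \<kappa> * mid k) * (h * psi \<theta>2 r)\<bar> \<le> C0 * h ^ 3"
        using ygrid_bounds[of k] ygrid_bounds[of "k + w"] kM
        by (intro C0(2) h) (auto simp: d[symmetric] mid_shift)
      then have "\<sigma>\<^sup>2 * \<bar>S - exp (- \<kappa> * mid k) * (h * psi \<theta>2 r)\<bar> \<le> \<sigma>\<^sup>2 * (C0 * h ^ 3)" by (intro mult_left_mono) auto
      moreover have "\<sigma>\<^sup>2 * \<bar>S - exp (- \<kappa> * mid k) * (h * psi \<theta>2 r)\<bar> = \<bar>\<sigma>\<^sup>2 * (S - exp (- \<kappa> * mid k) * (h * psi \<theta>2 r))\<bar>"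
        by (simp add: abs_mult)
      moreover have "\<sigma>\<^sup>2 * (S - exp (- \<kappa> * mid k) * (h * psi \<theta>2 r)) = (\<integral>\<omega>. (D i k \<omega>)\<^sup>2 \<partial>P) - h * f k"
        using \<sigma> by (simp add: S_def f_def right_diff_distrib mult_ac)
      ultimately show ?thesis by (simp only: mult.assoc)
    qed
    have bias: "(1 / (real n * h))\<^sup>2 * (\<Sum>i<n. \<Sum>k<m. (\<integral>\<omega>. (D i k \<omega>)\<^sup>2 \<partial>P) - h * f k)\<^sup>2 \<le> 4 * (\<sigma>\<^sup>2 * C0)\<^sup>2 * ((real M)\<^sup>2 * h ^ 3)"
    proof -
      have "\<bar>\<Sum>i<n. \<Sum>k<m. (\<integral>\<omega>. (D i k \<omega>)\<^sup>2 \<partial>P) - h * f k\<bar> \<le> (\<Sum>i<n. \<Sum>k<m. \<sigma>\<^sup>2 * C0 * h ^ 3)"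
        by (intro order_trans[OF sum_abs] sum_mono) (auto intro!: bias1)
      also have "\<dots> = real n * (real m * (\<sigma>\<^sup>2 * C0 * h ^ 3))" by simp
      also have "\<dots> \<le> real n * ((2 * real M) * (\<sigma>\<^sup>2 * C0 * h ^ 3))"
        using mM C0 h by (intro mult_left_mono mult_right_mono) auto
      finally have "\<bar>1 / (real n * h)\<bar> * \<bar>\<Sum>i<n. \<Sum>k<m. (\<integral>\<omega>. (D i k \<omega>)\<^sup>2 \<partial>P) - h * f k\<bar>
         \<le> \<bar>1 / (real n * h)\<bar> * (real n * ((2 * real M) * (\<sigma>\<^sup>2 * C0 * h ^ 3)))" by (intro mult_left_mono) auto
      also have "\<dots> = 2 * real M * (\<sigma>\<^sup>2 * C0) * h\<^sup>2" using n h by (simp add: power2_eq_square power3_eq_cube)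
      finally have "(\<bar>1 / (real n * h)\<bar> * \<bar>\<Sum>i<n. \<Sum>k<m. (\<integral>\<omega>. (D i k \<omega>)\<^sup>2 \<partial>P) - h * f k\<bar>)\<^sup>2
         \<le> (2 * real M * (\<sigma>\<^sup>2 * C0) * h\<^sup>2)\<^sup>2" by (intro power_mono) auto
      also have "\<dots> = 4 * (\<sigma>\<^sup>2 * C0)\<^sup>2 * ((real M)\<^sup>2 * (h ^ 3 * h))" by (simp add: power_mult_distrib eval_nat_numeral)
      also have "\<dots> \<le> 4 * (\<sigma>\<^sup>2 * C0)\<^sup>2 * ((real M)\<^sup>2 * (h ^ 3 * 1))" using h by (intro mult_left_mono) auto
      finally show ?thesis by (simp only: power_mult_distrib power2_abs mult_1_right)
    qed
    have E: "integrable P (\<lambda>\<omega>. (\<Sum>k<m. 1 / (real n * h) * (\<Sum>i<n. (D i k \<omega>)\<^sup>2) - f k)\<^sup>2) \<and>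
       (\<integral>\<omega>. (\<Sum>k<m. 1 / (real n * h) * (\<Sum>i<n. (D i k \<omega>)\<^sup>2) - f k)\<^sup>2 \<partial>P) \<le> C * (real M)\<^sup>2 * h ^ 3"
      using quadratic_variation_second_moment[OF m n(1), of f] var bias
      by (simp add: C_def distrib_left distrib_right mult.assoc)
    then show "integrable P (\<lambda>\<omega>. (\<Sum>k<m. resid T b M N v w r k \<omega>)\<^sup>2) \<and>
      (\<integral>\<omega>. (\<Sum>k<m. resid T b M N v w r k \<omega>)\<^sup>2 \<partial>P) \<le> C * (real M)\<^sup>2 * sqrt (real v * tstep T N) ^ 3"
      by (simp only: resid_def n_def f_def mid_def h_def)
  qed
qed

end

section \<open>The minimum contrast estimator\<close>

definition joint_contrast ::
  "(real \<Rightarrow> real \<Rightarrow> 'a \<Rightarrow> real) \<Rightarrow> real \<Rightarrow> real \<Rightarrow> nat \<Rightarrow> nat \<Rightarrow> nat \<Rightarrow> nat \<Rightarrow> 'a \<Rightarrow> real \<times> real \<times> real \<Rightarrow> real" where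
  "joint_contrast X T b M N v w \<omega> \<eta>' = contrast X T b M N v w 1 \<omega> \<eta>' + contrast X T b M N v w 2 \<omega> \<eta>'"

lemma contrast_sum_of_squares:
  assumes "w \<le> M" "\<nu> * v \<le> N"
  shows "contrast X T b M N v w \<nu> \<omega> \<eta>' = 1 / real (Suc (M - w)) * (\<Sum>k<Suc (M - w).
     (1 / (real (Suc (N - \<nu> * v)) * sqrt (real (\<nu> * v) * tstep T N)) * (\<Sum>i<Suc (N - \<nu> * v). (dincr X T b M N (\<nu> * v) w i k \<omega>)\<^sup>2)
       - fmean (mesh_ratio T b M N v w) \<nu> \<eta>' ((ygrid b M k + ygrid b M (k + w)) / 2))\<^sup>2)"
proof -
  have "real M - real w + 1 = real (Suc (M - w))" "real N - real (\<nu> * v) + 1 = real (Suc (N - \<nu> * v))"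
    using assms by (simp_all only: of_nat_Suc of_nat_diff)
  then show ?thesis unfolding contrast_def by (simp only: atLeast0AtMost lessThan_Suc_atMost)
qed

text \<open>
  In log coordinates the mean functions of all candidates are exponential multiples of the true one.
\<close>

lemma fmean_ratio:
  assumes "s2 > 0" "\<theta> > 0" "fst \<eta>' > 0" "fst (snd \<eta>') > 0" "r > 0" "\<nu> > 0"
  shows "fmean r \<nu> \<eta>' z = s2 * psi \<theta> (r / sqrt (real \<nu>)) * exp (- \<kappa> * z)
     * exp (log_gain (r / sqrt (real \<nu>)) (s2, \<theta>, \<kappa>) \<eta>' - (snd (snd \<eta>') - \<kappa>) * z)"
proof -
  obtain s2' \<theta>' \<kappa>' where \<eta>': "\<eta>' = (s2', \<theta>', \<kappa>')" by (cases \<eta>' rule: prod_cases3)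
  have p: "psi \<theta> (r / sqrt (real \<nu>)) > 0" "psi \<theta>' (r / sqrt (real \<nu>)) > 0"
    using assms by (auto intro!: psi_pos simp: \<eta>')
  let ?\<rho> = "r / sqrt (real \<nu>)" and ?g = "log_gain (r / sqrt (real \<nu>)) (s2, \<theta>, \<kappa>) \<eta>'"
  have "exp ?g = s2' * psi \<theta>' ?\<rho> / (s2 * psi \<theta> ?\<rho>)"
    using assms p by (simp add: log_gain_def \<eta>' exp_diff exp_add)
  then have gain: "s2 * psi \<theta> ?\<rho> * exp ?g = s2' * psi \<theta>' ?\<rho>" using assms p by simp
  have split: "exp (?g - (\<kappa>' - \<kappa>) * z) = exp ?g * exp (- \<kappa>' * z) * exp (\<kappa> * z)"
    by (simp add: algebra_simps flip: exp_add)
  have cancel: "exp (- \<kappa> * z) * exp (\<kappa> * z) = 1" by (simp flip: exp_add)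
  have "s2 * psi \<theta> ?\<rho> * exp (- \<kappa> * z) * exp (?g - (\<kappa>' - \<kappa>) * z)
     = (s2 * psi \<theta> ?\<rho> * exp ?g) * exp (- \<kappa>' * z) * (exp (- \<kappa> * z) * exp (\<kappa> * z))"
    unfolding split by (simp only: mult_ac)
  also have "\<dots> = s2' * psi \<theta>' ?\<rho> * exp (- \<kappa>' * z)" unfolding gain cancel by simp
  finally show ?thesis by (simp add: \<eta>')
qed

text \<open>
  Integrate \<open>\<bar>x\<bar> \<le> x^2 / t + t\<close>.
\<close>

lemma (in prob_space) expectation_abs_le_second_moment:
  fixes S :: "'a \<Rightarrow> real"
  assumes m: "S \<in> borel_measurable M" and i: "integrable M (\<lambda>\<omega>. (S \<omega>)\<^sup>2)" and t: "t > 0"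
    and le: "(\<integral>\<omega>. (S \<omega>)\<^sup>2 \<partial>M) \<le> D * t\<^sup>2"
  shows "integrable M (\<lambda>\<omega>. \<bar>S \<omega>\<bar>)" "(\<integral>\<omega>. \<bar>S \<omega>\<bar> \<partial>M) \<le> (D + 1) * t"
proof -
  have pt: "\<bar>x\<bar> \<le> x\<^sup>2 / t + t" for x :: real
  proof -
    have "2 * \<bar>x\<bar> * t \<le> x\<^sup>2 + t\<^sup>2" using sum_squares_bound[of "\<bar>x\<bar>" t] by simp
    moreover have "0 \<le> \<bar>x\<bar> * t" using t by simp
    ultimately have "\<bar>x\<bar> * t \<le> x\<^sup>2 + t\<^sup>2" by linarith
    then have "\<bar>x\<bar> \<le> (x\<^sup>2 + t\<^sup>2) / t" using t by (simp add: pos_le_divide_eq)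
    also have "\<dots> = x\<^sup>2 / t + t" using t by (simp add: add_divide_distrib power2_eq_square)
    finally show ?thesis .
  qed
  have ib: "integrable M (\<lambda>\<omega>. (S \<omega>)\<^sup>2 / t + t)" using i by simp
  show ii: "integrable M (\<lambda>\<omega>. \<bar>S \<omega>\<bar>)"
    by (rule Bochner_Integration.integrable_bound[OF ib]) (use m pt t in \<open>auto intro!: AE_I2 simp: abs_of_nonneg add_nonneg_nonneg\<close>)
  have "(\<integral>\<omega>. \<bar>S \<omega>\<bar> \<partial>M) \<le> (\<integral>\<omega>. (S \<omega>)\<^sup>2 / t + t \<partial>M)" by (intro integral_mono ii ib pt)
  also have "\<dots> = (\<integral>\<omega>. (S \<omega>)\<^sup>2 \<partial>M) / t + t" using i by (simp add: prob_space)
  also have "\<dots> \<le> D * t\<^sup>2 / t + t" using le t by (intro add_right_mono divide_right_mono) auto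
  also have "\<dots> = (D + 1) * t" using t by (simp add: power2_eq_square algebra_simps)
  finally show "(\<integral>\<omega>. \<bar>S \<omega>\<bar> \<partial>M) \<le> (D + 1) * t" .
qed

lemma (in prob_space) expectation_residual_size:
  assumes d: "0 \<le> \<delta>" "\<delta> * real K \<le> 1" and D: "D \<ge> 0" and t: "t > 0"
    and W: "\<And>k. k < K \<Longrightarrow> W k \<in> borel_measurable M"
    and i: "\<And>m. m \<le> K \<Longrightarrow> integrable M (\<lambda>\<omega>. (\<Sum>k<m. W k \<omega>)\<^sup>2)"
    and le: "\<And>m. m \<le> K \<Longrightarrow> (\<integral>\<omega>. (\<Sum>k<m. W k \<omega>)\<^sup>2 \<partial>M) \<le> D * t\<^sup>2"
  shows "integrable M (\<lambda>\<omega>. residual_size K \<delta> (\<lambda>k. W k \<omega>))"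
    and "(\<integral>\<omega>. residual_size K \<delta> (\<lambda>k. W k \<omega>) \<partial>M) \<le> 2 * (D + 1) * t"
proof -
  have S: "(\<lambda>\<omega>. \<Sum>k<m. W k \<omega>) \<in> borel_measurable M" if "m \<le> K" for m
    using that by (intro borel_measurable_sum W) auto
  note A = expectation_abs_le_second_moment[OF S i t le]
  have ii: "integrable M (\<lambda>\<omega>. \<bar>\<Sum>j<Suc k. W j \<omega>\<bar>)" "(\<integral>\<omega>. \<bar>\<Sum>j<Suc k. W j \<omega>\<bar> \<partial>M) \<le> (D + 1) * t" if "k < K" for k
    using A[of "Suc k"] that by auto
  have iK: "integrable M (\<lambda>\<omega>. \<bar>\<Sum>j<K. W j \<omega>\<bar>)" "(\<integral>\<omega>. \<bar>\<Sum>j<K. W j \<omega>\<bar> \<partial>M) \<le> (D + 1) * t" using A[of K] by auto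
  have isum: "integrable M (\<lambda>\<omega>. \<delta> * (\<Sum>k<K. \<bar>\<Sum>j<Suc k. W j \<omega>\<bar>))"
    by (intro integrable_mult_right Bochner_Integration.integrable_sum ii) auto
  show "integrable M (\<lambda>\<omega>. residual_size K \<delta> (\<lambda>k. W k \<omega>))"
    unfolding residual_size_def by (intro Bochner_Integration.integrable_add iK isum)
  have "(\<integral>\<omega>. residual_size K \<delta> (\<lambda>k. W k \<omega>) \<partial>M)
     = (\<integral>\<omega>. \<bar>\<Sum>j<K. W j \<omega>\<bar> \<partial>M) + (\<integral>\<omega>. \<delta> * (\<Sum>k<K. \<bar>\<Sum>j<Suc k. W j \<omega>\<bar>) \<partial>M)"
    unfolding residual_size_def by (rule Bochner_Integration.integral_add[OF iK(1) isum])
  also have "(\<integral>\<omega>. \<delta> * (\<Sum>k<K. \<bar>\<Sum>j<Suc k. W j \<omega>\<bar>) \<partial>M) = \<delta> * (\<Sum>k<K. \<integral>\<omega>. \<bar>\<Sum>j<Suc k. W j \<omega>\<bar> \<partial>M)"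
    using ii by (subst integral_mult_right_zero, subst Bochner_Integration.integral_sum) auto
  also have "\<dots> \<le> \<delta> * (\<Sum>k<K. (D + 1) * t)" using d ii by (intro mult_left_mono sum_mono) auto
  also have "\<dots> = (\<delta> * real K) * ((D + 1) * t)" by simp
  also have "\<dots> \<le> 1 * ((D + 1) * t)" using d D t by (intro mult_right_mono) auto
  also have "(\<integral>\<omega>. \<bar>\<Sum>j<K. W j \<omega>\<bar> \<partial>M) + 1 * ((D + 1) * t) \<le> (D + 1) * t + 1 * ((D + 1) * t)"
    by (intro add_right_mono iK(2))
  also have "\<dots> = 2 * (D + 1) * t" by (simp add: algebra_simps)
  finally show "(\<integral>\<omega>. residual_size K \<delta> (\<lambda>k. W k \<omega>) \<partial>M) \<le> 2 * (D + 1) * t" by simp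
qed

context spde
begin

lemma dincr_measurable:
  assumes "0 < b" "b < 1 / 2" "T > 0" "1 \<le> M" "1 \<le> N" "1 \<le> v" "1 \<le> w" "k + w \<le> M"
  shows "dincr X T b M N v w i k \<in> borel_measurable P"
proof -
  interpret spde_grid P X \<sigma> \<theta>2 \<theta>1 \<theta>0 T b M N v w
    using assms by unfold_locales auto
  show ?thesis by (intro span_measurable D_span assms)
qed

lemma expectation_resid:
  assumes b: "0 < b" "b < 1 / 2" and T: "T > 0" and r: "r > 0"
  obtains C where "C \<ge> 0"
    and "\<And>M N v w. fine_grid T b r M N v w \<Longrightarrow>
      integrable P (\<lambda>\<omega>. residual_size (Suc (M - w)) (ystep b M) (\<lambda>k. resid T b M N v w r k \<omega>)) \<and>
      (\<integral>\<omega>. residual_size (Suc (M - w)) (ystep b M) (\<lambda>k. resid T b M N v w r k \<omega>) \<partial>P)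
        \<le> C * (real M * sqrt (sqrt (real v * tstep T N) ^ 3))"
proof -
  interpret prob_space P by (rule P)
  obtain D where D: "D \<ge> 0" "\<And>M N v w m. fine_grid T b r M N v w \<Longrightarrow> m + w \<le> Suc M \<Longrightarrow>
      integrable P (\<lambda>\<omega>. (\<Sum>k<m. resid T b M N v w r k \<omega>)\<^sup>2) \<and>
      (\<integral>\<omega>. (\<Sum>k<m. resid T b M N v w r k \<omega>)\<^sup>2 \<partial>P) \<le> D * (real M)\<^sup>2 * sqrt (real v * tstep T N) ^ 3"
    using quadratic_variation_concentration[OF b T r] by blast
  show ?thesis
  proof (rule that[of "2 * (D + 1)"])
    show "2 * (D + 1) \<ge> 0" using D by simp
    fix M N v w :: nat
    assume g: "fine_grid T b r M N v w"
    then have A: "1 \<le> M" "1 \<le> v" "1 \<le> w" "w \<le> M" "2 * v \<le> N" by (auto simp: fine_grid_def)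
    let ?K = "Suc (M - w)" and ?h = "sqrt (real v * tstep T N)"
    define t where "t = real M * sqrt (?h ^ 3)"
    have h: "?h > 0" using A T by (simp add: tstep_def)
    have t: "t > 0" "D * t\<^sup>2 = D * (real M)\<^sup>2 * ?h ^ 3" using A h by (auto simp: t_def power_mult_distrib)
    have m: "m + w \<le> Suc M" if "m \<le> ?K" for m using that A by linarith
    have d0: "0 \<le> ystep b M" using b by (simp add: ystep_def)
    have "ystep b M * real ?K \<le> ystep b M * real M" using d0 A by (intro mult_left_mono) auto
    also have "\<dots> \<le> 1" using b A by (simp add: ystep_def)
    finally have d: "ystep b M * real ?K \<le> 1" .
    have mW: "resid T b M N v w r k \<in> borel_measurable P" if "k < ?K" for k
    proof -
      have "dincr X T b M N v w i k \<in> borel_measurable P" for i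
        using that A b T by (intro dincr_measurable) auto
      then show ?thesis unfolding resid_def[abs_def] by (intro borel_measurable_diff borel_measurable_times borel_measurable_sum borel_measurable_power) auto
    qed
    have i: "integrable P (\<lambda>\<omega>. (\<Sum>k<m. resid T b M N v w r k \<omega>)\<^sup>2)"
      "(\<integral>\<omega>. (\<Sum>k<m. resid T b M N v w r k \<omega>)\<^sup>2 \<partial>P) \<le> D * t\<^sup>2" if "m \<le> ?K" for m
      using D(2)[OF g m[OF that]] unfolding t(2) by auto
    show "integrable P (\<lambda>\<omega>. residual_size ?K (ystep b M) (\<lambda>k. resid T b M N v w r k \<omega>)) \<and>
      (\<integral>\<omega>. residual_size ?K (ystep b M) (\<lambda>k. resid T b M N v w r k \<omega>) \<partial>P) \<le> 2 * (D + 1) * (real M * sqrt (?h ^ 3))"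
      using expectation_residual_size[OF d0 d D(1) t(1) mW i] unfolding t_def by auto
  qed
qed

text \<open>
  On every sufficiently fine grid, all candidates that are at least as good as the truth lie within a random
  distance \<open>Y\<close> of it, and the expectation of \<open>Y\<close> has the right size. The second contrast uses the lag \<open>2 * v\<close>, for which
  the mesh ratio is \<open>r / sqrt 2\<close>.
\<close>

lemma estimation_error_bound:
  assumes b: "0 < b" "b < 1 / 2" and T: "T > 0" and r: "r > 0"
    and H: "compact H" "H \<subseteq> {0<..} \<times> {0<..} \<times> UNIV" and \<eta>: "(\<sigma>\<^sup>2, \<theta>2, \<kappa>) \<in> H"
  obtains C where "C \<ge> 0"
    and "\<And>M N v w. 2 \<le> M \<Longrightarrow> 2 * w \<le> M \<Longrightarrow> fine_grid T b r M N v w \<Longrightarrow> fine_grid T b (r / sqrt 2) M N (2 * v) w \<Longrightarrow>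
      \<exists>Y. integrable P Y \<and> (\<forall>\<omega>. 0 \<le> Y \<omega>) \<and> (\<integral>\<omega>. Y \<omega> \<partial>P) \<le> C * sqrt (sqrt (real v * tstep T N) ^ 3) \<and>
        (\<forall>\<omega>. \<forall>\<eta>'\<in>H. joint_contrast X T b M N v w \<omega> \<eta>'
           \<le> joint_contrast X T b M N v w \<omega> (\<sigma>\<^sup>2, \<theta>2, \<kappa>)
           \<longrightarrow> norm (\<eta>' - (\<sigma>\<^sup>2, \<theta>2, \<kappa>)) \<le> Y \<omega>)"
proof -
  let ?\<eta> = "(\<sigma>\<^sup>2, \<theta>2, \<kappa>)" and ?r2 = "r / sqrt 2"
  define l0 where "l0 = (1 - 2 * b) / 2"
  have l0: "l0 > 0" using b by (simp add: l0_def)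
  have r2: "?r2 > 0" using r by simp
  define G1 G2 where "G1 = \<sigma>\<^sup>2 * psi \<theta>2 r" and "G2 = \<sigma>\<^sup>2 * psi \<theta>2 ?r2"
  have G: "G1 > 0" "G2 > 0" using \<sigma> psi_pos[OF \<theta>2 r] psi_pos[OF \<theta>2 r2] by (auto simp: G1_def G2_def)
  obtain B C1 where B: "B \<ge> 0" "C1 \<ge> 0" "\<And>\<eta>'. \<eta>' \<in> H \<Longrightarrow> \<bar>log_gain r ?\<eta> \<eta>'\<bar> \<le> B"
    "\<And>\<eta>'. \<eta>' \<in> H \<Longrightarrow> \<bar>log_gain ?r2 ?\<eta> \<eta>'\<bar> \<le> B" "\<And>\<eta>'. \<eta>' \<in> H \<Longrightarrow> \<bar>snd (snd \<eta>') - \<kappa>\<bar> \<le> B"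
    "\<And>\<eta>'. \<eta>' \<in> H \<Longrightarrow> norm (\<eta>' - ?\<eta>) \<le> C1 * (\<bar>log_gain r ?\<eta> \<eta>'\<bar> + \<bar>log_gain ?r2 ?\<eta> \<eta>'\<bar> + \<bar>snd (snd \<eta>') - \<kappa>\<bar>)"
    using log_coordinates[OF H \<eta> r] unfolding snd_conv by blast
  obtain C2 where C2: "C2 \<ge> 0" "\<And>K z0 \<delta> \<alpha>1 \<alpha>2 \<beta> W1 W2. unit_grid K z0 \<delta> \<Longrightarrow> l0 \<le> real K * \<delta> \<Longrightarrow>
    \<bar>\<alpha>1\<bar> \<le> B \<Longrightarrow> \<bar>\<alpha>2\<bar> \<le> B \<Longrightarrow> \<bar>\<beta>\<bar> \<le> B \<Longrightarrow>
    (\<Sum>k<K. (W1 k - perturb G1 \<kappa> \<alpha>1 \<beta> (z0 + real k * \<delta>))\<^sup>2) + (\<Sum>k<K. (W2 k - perturb G2 \<kappa> \<alpha>2 \<beta> (z0 + real k * \<delta>))\<^sup>2)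
      \<le> (\<Sum>k<K. (W1 k)\<^sup>2) + (\<Sum>k<K. (W2 k)\<^sup>2) \<Longrightarrow>
    real K * (\<bar>\<alpha>1\<bar> + \<bar>\<alpha>2\<bar> + \<bar>\<beta>\<bar>) \<le> C2 * (residual_size K \<delta> W1 + residual_size K \<delta> W2)"
    using least_squares_bound[OF G l0, of B \<kappa>] by blast
  obtain D1 where D1: "D1 \<ge> 0" "\<And>M N v w. fine_grid T b r M N v w \<Longrightarrow>
      integrable P (\<lambda>\<omega>. residual_size (Suc (M - w)) (ystep b M) (\<lambda>k. resid T b M N v w r k \<omega>)) \<and>
      (\<integral>\<omega>. residual_size (Suc (M - w)) (ystep b M) (\<lambda>k. resid T b M N v w r k \<omega>) \<partial>P)
        \<le> D1 * (real M * sqrt (sqrt (real v * tstep T N) ^ 3))"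
    using expectation_resid[OF b T r] by blast
  obtain D2 where D2: "D2 \<ge> 0" "\<And>M N v w. fine_grid T b ?r2 M N v w \<Longrightarrow>
      integrable P (\<lambda>\<omega>. residual_size (Suc (M - w)) (ystep b M) (\<lambda>k. resid T b M N v w ?r2 k \<omega>)) \<and>
      (\<integral>\<omega>. residual_size (Suc (M - w)) (ystep b M) (\<lambda>k. resid T b M N v w ?r2 k \<omega>) \<partial>P)
        \<le> D2 * (real M * sqrt (sqrt (real v * tstep T N) ^ 3))"
    using expectation_resid[OF b T r2] by blast
  show ?thesis
  proof (rule that[of "2 * (C1 * C2) * (D1 + 2 * D2)"])
    show "2 * (C1 * C2) * (D1 + 2 * D2) \<ge> 0" using B C2 D1 D2 by simp
    fix M N v w :: nat
    assume M: "2 \<le> M" and w: "2 * w \<le> M" and g1: "fine_grid T b r M N v w" and g2: "fine_grid T b ?r2 M N (2 * v) w"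
    then have v: "1 \<le> v" and N: "4 * v \<le> N" and mesh: "mesh_ratio T b M N v w = r" by (auto simp: fine_grid_def)
    define K \<delta> h where "K = Suc (M - w)" and "\<delta> = ystep b M" and "h = sqrt (real v * tstep T N)"
    have ts: "tstep T N > 0" using T N v by (simp add: tstep_def)
    have h: "h > 0" using v ts by (simp add: h_def)
    have \<delta>: "\<delta> > 0" using b M by (simp add: \<delta>_def ystep_def)
    have K: "2 \<le> K" "real M \<le> 2 * real K" using M w by (auto simp: K_def)
    define Z1 Z2 where "Z1 \<omega> = residual_size K \<delta> (\<lambda>k. resid T b M N v w r k \<omega>)"
      and "Z2 \<omega> = residual_size K \<delta> (\<lambda>k. resid T b M N (2 * v) w ?r2 k \<omega>)" for \<omega>
    have Zn: "Z1 \<omega> \<ge> 0" "Z2 \<omega> \<ge> 0" for \<omega>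
      using \<delta> unfolding Z1_def Z2_def by (auto intro!: residual_size_nonneg)
    have Z1: "integrable P Z1" "(\<integral>\<omega>. Z1 \<omega> \<partial>P) \<le> D1 * (real M * sqrt (h ^ 3))"
      using D1(2)[OF g1] unfolding Z1_def K_def \<delta>_def h_def by auto
    have Z2: "integrable P Z2" "(\<integral>\<omega>. Z2 \<omega> \<partial>P) \<le> D2 * (real M * (2 * sqrt (h ^ 3)))"
    proof -
      let ?h2 = "sqrt (real (2 * v) * tstep T N)"
      have *: "integrable P Z2" "(\<integral>\<omega>. Z2 \<omega> \<partial>P) \<le> D2 * (real M * sqrt (?h2 ^ 3))"
        using D2(2)[OF g2] unfolding Z2_def K_def \<delta>_def by auto
      have "?h2 = sqrt 2 * h" by (simp add: h_def real_sqrt_mult)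
      also have "\<dots> ^ 3 \<le> 4 * h ^ 3"
      proof -
        have "sqrt 2 ^ 3 = 2 * sqrt 2" by (simp add: power3_eq_cube)
        moreover have "sqrt 2 \<le> 2" by (simp add: real_le_lsqrt)
        ultimately have "sqrt 2 ^ 3 \<le> 4" by linarith
        then show ?thesis using h by (simp add: power_mult_distrib mult_right_mono)
      qed
      finally have "sqrt (?h2 ^ 3) \<le> sqrt (4 * h ^ 3)" by (rule real_sqrt_le_mono)
      also have "\<dots> = 2 * sqrt (h ^ 3)" by (simp add: real_sqrt_mult)
      finally have "D2 * (real M * sqrt (?h2 ^ 3)) \<le> D2 * (real M * (2 * sqrt (h ^ 3)))"
        using D2(1) by (intro mult_left_mono) auto
      then show "integrable P Z2" "(\<integral>\<omega>. Z2 \<omega> \<partial>P) \<le> D2 * (real M * (2 * sqrt (h ^ 3)))" using * by auto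
    qed
    define Y where "Y \<omega> = C1 * C2 / real K * (Z1 \<omega> + Z2 \<omega>)" for \<omega>
    show "\<exists>Y. integrable P Y \<and> (\<forall>\<omega>. 0 \<le> Y \<omega>) \<and> (\<integral>\<omega>. Y \<omega> \<partial>P) \<le> 2 * (C1 * C2) * (D1 + 2 * D2) * sqrt (sqrt (real v * tstep T N) ^ 3) \<and>
        (\<forall>\<omega>. \<forall>\<eta>'\<in>H. joint_contrast X T b M N v w \<omega> \<eta>'
           \<le> joint_contrast X T b M N v w \<omega> ?\<eta> \<longrightarrow> norm (\<eta>' - ?\<eta>) \<le> Y \<omega>)"
    proof (intro exI[of _ Y] conjI allI ballI impI)
      show "integrable P Y" unfolding Y_def by (intro integrable_mult_right Bochner_Integration.integrable_add Z1 Z2)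
      show "0 \<le> Y \<omega>" for \<omega> using B(2) C2(1) Zn[of \<omega>] by (simp add: Y_def)
      have "(\<integral>\<omega>. Y \<omega> \<partial>P) = C1 * C2 / real K * ((\<integral>\<omega>. Z1 \<omega> \<partial>P) + (\<integral>\<omega>. Z2 \<omega> \<partial>P))"
        unfolding Y_def using Z1(1) Z2(1) by simp
      also have "\<dots> \<le> C1 * C2 / real K * (D1 * (real M * sqrt (h ^ 3)) + D2 * (real M * (2 * sqrt (h ^ 3))))"
        using B(2) C2(1) Z1 Z2 by (intro mult_left_mono add_mono) auto
      also have "\<dots> = (C1 * C2) * (D1 + 2 * D2) * sqrt (h ^ 3) * (real M / real K)" by (simp add: algebra_simps add_divide_distrib)
      also have "\<dots> \<le> (C1 * C2) * (D1 + 2 * D2) * sqrt (h ^ 3) * 2"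
        using B(2) C2(1) D1(1) D2(1) h K by (intro mult_left_mono) (auto simp: divide_le_eq)
      finally show "(\<integral>\<omega>. Y \<omega> \<partial>P) \<le> 2 * (C1 * C2) * (D1 + 2 * D2) * sqrt (sqrt (real v * tstep T N) ^ 3)"
        unfolding h_def by (simp only: mult_ac)
      fix \<omega> \<eta>' assume \<eta>': "\<eta>' \<in> H"
        and le: "joint_contrast X T b M N v w \<omega> \<eta>'
           \<le> joint_contrast X T b M N v w \<omega> ?\<eta>"
      have pos: "fst \<eta>' > 0" "fst (snd \<eta>') > 0" using \<eta>' H(2) by auto
      define z0 where "z0 = b + real w * \<delta> / 2"
      have mid: "(ygrid b M k + ygrid b M (k + w)) / 2 = z0 + real k * \<delta>" for k
        by (simp add: z0_def \<delta>_def ygrid_def field_simps)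
      define \<alpha>1 \<alpha>2 \<beta> where "\<alpha>1 = log_gain r ?\<eta> \<eta>'" and "\<alpha>2 = log_gain ?r2 ?\<eta> \<eta>'" and "\<beta> = snd (snd \<eta>') - \<kappa>"
      have f1: "fmean r 1 \<eta>' z = G1 * exp (- \<kappa> * z) * exp (\<alpha>1 - \<beta> * z)" for z
        using fmean_ratio[of "\<sigma>\<^sup>2" \<theta>2 \<eta>' r 1 z \<kappa>] \<sigma> \<theta>2 pos r by (simp add: G1_def \<alpha>1_def \<beta>_def)
      have f2: "fmean r 2 \<eta>' z = G2 * exp (- \<kappa> * z) * exp (\<alpha>2 - \<beta> * z)" for z
        using fmean_ratio[of "\<sigma>\<^sup>2" \<theta>2 \<eta>' r 2 z \<kappa>] \<sigma> \<theta>2 pos r by (simp add: G2_def \<alpha>2_def \<beta>_def)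
      have g1: "fmean r 1 ?\<eta> z = G1 * exp (- \<kappa> * z)" and g2: "fmean r 2 ?\<eta> z = G2 * exp (- \<kappa> * z)" for z
        by (simp_all add: G1_def G2_def)
      let ?W1 = "\<lambda>k. resid T b M N v w r k \<omega>" and ?W2 = "\<lambda>k. resid T b M N (2 * v) w ?r2 k \<omega>"
      let ?u = "\<lambda>G \<alpha> k. perturb G \<kappa> \<alpha> \<beta> (z0 + real k * \<delta>)"
      have wM: "w \<le> M" "1 * v \<le> N" "2 * v \<le> N" using w M N by auto
      have c1: "contrast X T b M N v w 1 \<omega> ?\<eta> = 1 / real K * (\<Sum>k<K. (?W1 k)\<^sup>2)"
        unfolding contrast_sum_of_squares[OF wM(1,2)] mesh g1 resid_def K_def mid G1_def by (simp only: mult_1)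
      have c2: "contrast X T b M N v w 2 \<omega> ?\<eta> = 1 / real K * (\<Sum>k<K. (?W2 k)\<^sup>2)"
        unfolding contrast_sum_of_squares[OF wM(1,3)] mesh g2 resid_def K_def mid G2_def by (simp only: mult_1)
      have shift: "x - G * exp (- \<kappa> * z) * exp (\<alpha> - \<beta> * z) = (x - G * exp (- \<kappa> * z)) - perturb G \<kappa> \<alpha> \<beta> z" for x G \<alpha> z
        by (simp add: perturb_def algebra_simps)
      have d1: "contrast X T b M N v w 1 \<omega> \<eta>' = 1 / real K * (\<Sum>k<K. (?W1 k - ?u G1 \<alpha>1 k)\<^sup>2)"
        unfolding contrast_sum_of_squares[OF wM(1,2)] mesh f1 shift resid_def K_def mid G1_def by (simp only: mult_1)
      have d2: "contrast X T b M N v w 2 \<omega> \<eta>' = 1 / real K * (\<Sum>k<K. (?W2 k - ?u G2 \<alpha>2 k)\<^sup>2)"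
        unfolding contrast_sum_of_squares[OF wM(1,3)] mesh f2 shift resid_def K_def mid G2_def by (simp only: mult_1)
      have "1 / real K * ((\<Sum>k<K. (?W1 k - ?u G1 \<alpha>1 k)\<^sup>2) + (\<Sum>k<K. (?W2 k - ?u G2 \<alpha>2 k)\<^sup>2))
         \<le> 1 / real K * ((\<Sum>k<K. (?W1 k)\<^sup>2) + (\<Sum>k<K. (?W2 k)\<^sup>2))"
        using le unfolding joint_contrast_def c1 c2 d1 d2 by (simp only: distrib_left)
      then have opt: "(\<Sum>k<K. (?W1 k - ?u G1 \<alpha>1 k)\<^sup>2) + (\<Sum>k<K. (?W2 k - ?u G2 \<alpha>2 k)\<^sup>2)
         \<le> (\<Sum>k<K. (?W1 k)\<^sup>2) + (\<Sum>k<K. (?W2 k)\<^sup>2)"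
        by (rule mult_left_le_imp_le) (use K in simp)
      have Md: "real M * \<delta> = 1 - 2 * b" using M by (simp add: \<delta>_def ystep_def)
      have z: "0 \<le> z0" "z0 + (real K - 1) * \<delta> \<le> 1" "l0 \<le> real K * \<delta>"
      proof -
        show "0 \<le> z0" using b \<delta> by (simp add: z0_def)
        have "z0 + (real K - 1) * \<delta> = b + real M * \<delta> - real w * \<delta> / 2"
          using wM by (simp add: z0_def K_def of_nat_diff field_simps)
        then show "z0 + (real K - 1) * \<delta> \<le> 1" unfolding Md using b \<delta> mult_nonneg_nonneg[of "real w" \<delta>] by linarith
        have "real M * \<delta> \<le> 2 * real K * \<delta>" using K \<delta> by (intro mult_right_mono) auto
        then show "l0 \<le> real K * \<delta>" unfolding Md by (simp add: l0_def)
      qed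
      have "real K * (\<bar>\<alpha>1\<bar> + \<bar>\<alpha>2\<bar> + \<bar>\<beta>\<bar>) \<le> C2 * (Z1 \<omega> + Z2 \<omega>)"
        unfolding Z1_def Z2_def
        by (rule C2(2)[OF _ z(3) _ _ _ opt]) (use K(1) \<delta> z(1,2) B(3,4,5)[OF \<eta>'] in \<open>auto simp: \<alpha>1_def \<alpha>2_def \<beta>_def unit_grid_def\<close>)
      then have "\<bar>\<alpha>1\<bar> + \<bar>\<alpha>2\<bar> + \<bar>\<beta>\<bar> \<le> C2 * (Z1 \<omega> + Z2 \<omega>) / real K"
        using K by (simp add: pos_le_divide_eq mult.commute)
      then have "C1 * (\<bar>\<alpha>1\<bar> + \<bar>\<alpha>2\<bar> + \<bar>\<beta>\<bar>) \<le> C1 * (C2 * (Z1 \<omega> + Z2 \<omega>) / real K)"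
        using B(2) by (intro mult_left_mono)
      then show "norm (\<eta>' - ?\<eta>) \<le> Y \<omega>"
        using B(6)[OF \<eta>'] by (simp add: Y_def \<alpha>1_def \<alpha>2_def \<beta>_def)
    qed
  qed
qed

end

text \<open>
  Here \<open>x\<close> is the squared time scale \<open>v * tstep T N\<close>.
\<close>

lemma scale_le_rate:
  assumes MN: "1 \<le> M" "1 \<le> N" and A: "0 \<le> A" and x: "0 \<le> x" "x \<le> A * max (1 / real N) (1 / (real M)\<^sup>2)"
  shows "sqrt (sqrt x ^ 3) \<le> sqrt (sqrt A ^ 3) * (1 / sqrt (min (real M ^ 3) (real N powr (3 / 2))))"
proof -
  let ?m = "min (real M ^ 3) (real N powr (3 / 2))"
  have Np: "real N powr (3 / 2) = sqrt (real N) ^ 3"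
  proof -
    have "sqrt (real N) ^ 3 = (real N powr (1 / 2)) powr (real 3)"
      using MN by (simp only: powr_realpow powr_half_sqrt[symmetric] of_nat_0_le_iff) (simp add: powr_realpow)
    also have "\<dots> = real N powr (3 / 2)" by (simp add: powr_powr)
    finally show ?thesis by simp
  qed
  have m: "?m > 0" using MN by simp
  have "sqrt x ^ 3 \<le> sqrt A ^ 3 * (1 / ?m)"
  proof (cases "1 / real N \<le> 1 / (real M)\<^sup>2")
    case True
    then have "sqrt x \<le> sqrt (A * (1 / (real M)\<^sup>2))" using x by (intro real_sqrt_le_mono) (simp add: max_def)
    also have "\<dots> = sqrt A * (1 / real M)" by (simp add: real_sqrt_mult real_sqrt_divide)
    finally have "sqrt x ^ 3 \<le> (sqrt A * (1 / real M)) ^ 3" using x by (intro power_mono) auto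
    also have "\<dots> = sqrt A ^ 3 * (1 / real M ^ 3)" by (simp only: power_mult_distrib power_one_over)
    also have "\<dots> \<le> sqrt A ^ 3 * (1 / ?m)" using A m MN by (intro mult_left_mono divide_left_mono) auto
    finally show ?thesis .
  next
    case False
    then have "sqrt x \<le> sqrt (A * (1 / real N))" using x by (intro real_sqrt_le_mono) (simp add: max_def)
    also have "\<dots> = sqrt A * (1 / sqrt (real N))" by (simp add: real_sqrt_mult real_sqrt_divide)
    finally have "sqrt x ^ 3 \<le> (sqrt A * (1 / sqrt (real N))) ^ 3" using x by (intro power_mono) auto
    also have "\<dots> = sqrt A ^ 3 * (1 / sqrt (real N) ^ 3)" by (simp only: power_mult_distrib power_one_over)
    also have "\<dots> \<le> sqrt A ^ 3 * (1 / ?m)" using A m MN unfolding Np by (intro mult_left_mono divide_left_mono) auto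
    finally show ?thesis .
  qed
  then have "sqrt (sqrt x ^ 3) \<le> sqrt (sqrt A ^ 3 * (1 / ?m))" by (rule real_sqrt_le_mono)
  also have "\<dots> = sqrt (sqrt A ^ 3) * (1 / sqrt ?m)" by (simp only: real_sqrt_mult real_sqrt_divide real_sqrt_one)
  finally show ?thesis .
qed

text \<open>
  The growth conditions make \<open>v / N\<close> and \<open>w / M\<close> tend to 0, at a speed controlled by \<open>min M N\<close>.
\<close>

lemma admissible_eventually:
  fixes M N v w :: "nat \<Rightarrow> nat" and T cv cw :: real
  assumes MN: "\<And>n. M n \<ge> 1" "\<And>n. N n \<ge> 1" and T: "T > 0" and c: "cv > 0" "cw > 0"
    and lim: "filterlim (\<lambda>n. min (M n) (N n)) at_top sequentially"
    and v: "\<And>n. real (v n) \<le> cv * max 1 (real (N n) / (real (M n))\<^sup>2)"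
    and w: "\<And>n. real (w n) \<le> cw * max 1 (real (M n) / sqrt (real (N n)))"
  shows "\<forall>\<^sub>F n in sequentially. 2 \<le> M n \<and> 2 * w n \<le> M n \<and> 4 * v n \<le> N n \<and> real (2 * v n) * tstep T (N n) \<le> 1"
proof -
  \<comment> \<open>The entries of \<open>L\<close> serve, in this order, the four conditions \<open>2 \<le> M\<close>, \<open>4 * v \<le> N\<close>, \<open>2 * v * tstep T N \<le> 1\<close> and \<open>2 * w \<le> M\<close>.\<close>
  define L where "L = max (max 2 (4 * cv)) (max (2 * T * cv) (4 * cw\<^sup>2))"
  have L: "2 \<le> L" "4 * cv \<le> L" "2 * T * cv \<le> L" "4 * cw\<^sup>2 \<le> L" by (auto simp: L_def)
  have "\<forall>\<^sub>F n in sequentially. nat \<lceil>L\<rceil> \<le> min (M n) (N n)"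
    using lim unfolding filterlim_at_top by blast
  then show ?thesis
  proof eventually_elim
    case (elim n)
    let ?M = "real (M n)" and ?N = "real (N n)"
    have Mge: "L \<le> ?M" and Nge: "L \<le> ?N" using elim by linarith+
    have pos: "?M > 0" "?N > 0" using Mge Nge L(1) by linarith+
    have M1: "?M \<ge> 1" using MN(1)[of n] by simp
    have M2: "L \<le> ?M\<^sup>2"
    proof -
      have "?M * 1 \<le> ?M * ?M" using M1 by (intro mult_left_mono) auto
      then show ?thesis using Mge by (simp add: power2_eq_square)
    qed
    have vN: "real (v n) * L \<le> cv * ?N"
    proof -
      have "max 1 (?N / ?M\<^sup>2) * L \<le> ?N"
      proof (cases "1 \<le> ?N / ?M\<^sup>2")
        case True
        have "?N / ?M\<^sup>2 * L \<le> ?N / ?M\<^sup>2 * ?M\<^sup>2" using M2 by (intro mult_left_mono) auto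
        then show ?thesis using True pos by (simp add: max_def)
      next
        case False
        then show ?thesis using Nge by (simp add: max_def)
      qed
      then have "cv * (max 1 (?N / ?M\<^sup>2) * L) \<le> cv * ?N" using c by (intro mult_left_mono) auto
      moreover have "real (v n) * L \<le> cv * max 1 (?N / ?M\<^sup>2) * L" using v[of n] L(1) by (intro mult_right_mono) auto
      ultimately show ?thesis by (simp add: mult.assoc)
    qed
    have "real (v n) * (4 * cv) \<le> cv * ?N"
      using vN mult_left_mono[OF L(2), of "real (v n)"] by simp
    then have "cv * (4 * real (v n)) \<le> cv * ?N" by (simp add: mult_ac)
    then have v4: "4 * real (v n) \<le> ?N" using c(1) by simp
    have "real (v n) * (2 * T * cv) \<le> cv * ?N"
      using vN mult_left_mono[OF L(3), of "real (v n)"] by simp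
    then have "cv * (2 * real (v n) * T) \<le> cv * ?N" by (simp add: mult_ac)
    then have "2 * real (v n) * T \<le> ?N" using c(1) by simp
    then have vT: "real (2 * v n) * tstep T (N n) \<le> 1" using pos by (simp add: tstep_def divide_le_eq)
    have sL: "2 * cw \<le> sqrt L" using L(4) c by (intro real_le_rsqrt) (simp add: power_mult_distrib)
    have wM: "real (w n) * (2 * cw) \<le> cw * ?M"
    proof -
      have "max 1 (?M / sqrt ?N) * sqrt L \<le> ?M"
      proof (cases "1 \<le> ?M / sqrt ?N")
        case True
        have "?M / sqrt ?N * sqrt L \<le> ?M / sqrt ?N * sqrt ?N" using Nge by (intro mult_left_mono) auto
        then show ?thesis using True pos by (simp add: max_def)
      next
        case False
        have "sqrt L \<le> sqrt (?M\<^sup>2)" using M2 by (rule real_sqrt_le_mono)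
        then show ?thesis using False by (simp add: max_def)
      qed
      then have 1: "cw * (max 1 (?M / sqrt ?N) * sqrt L) \<le> cw * ?M" using c by (intro mult_left_mono) auto
      have "real (w n) * (2 * cw) \<le> real (w n) * sqrt L" using sL by (intro mult_left_mono) auto
      also have "\<dots> \<le> cw * max 1 (?M / sqrt ?N) * sqrt L" using w[of n] L(1) by (intro mult_right_mono) auto
      finally show ?thesis using 1 by (simp add: mult.assoc)
    qed
    then have "cw * (2 * real (w n)) \<le> cw * ?M" by (simp add: mult_ac)
    then have "2 * real (w n) \<le> ?M" using c(2) by simp
    then show ?case using v4 vT Mge L(1) by linarith
  qed
qed

theorem proposition4p5:
  fixes P :: "'a measure"
    and X :: "real \<Rightarrow> real \<Rightarrow> 'a \<Rightarrow> real"
    and \<sigma> \<theta>2 \<theta>1 \<theta>0 T b :: real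
    and H :: "(real \<times> real \<times> real) set"
    and M N v w :: "nat \<Rightarrow> nat"
    and \<eta>hat :: "nat \<Rightarrow> 'a \<Rightarrow> real \<times> real \<times> real"
  assumes "prob_space P"
    and "\<sigma>\<^sup>2 > 0" and "\<theta>2 > 0" and "Gam \<theta>2 \<theta>1 \<theta>0 + pi\<^sup>2 > 0"
    and "stationary_solution P \<sigma> \<theta>2 \<theta>1 \<theta>0 X"
    and "T > 0" and "0 < b" and "b < 1 / 2"
    and "compact H" and "H \<subseteq> {0<..} \<times> {0<..} \<times> UNIV"
    and "(\<sigma>\<^sup>2, \<theta>2, \<theta>1 / \<theta>2) \<in> interior H"
    and "\<And>n. M n \<ge> 1" and "\<And>n. N n \<ge> 1"
    and "filterlim (\<lambda>n. min (M n) (N n)) at_top sequentially"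
    and "eqsim (\<lambda>n. real (v n)) (\<lambda>n. max 1 (real (N n) / (real (M n))\<^sup>2))"
    and "eqsim (\<lambda>n. real (w n)) (\<lambda>n. max 1 (real (M n) / sqrt (real (N n))))"
    and "\<exists>r. \<forall>n. mesh_ratio T b (M n) (N n) (v n) (w n) = r"
    and "\<And>n. \<eta>hat n \<in> borel_measurable P"
    and "\<And>n \<omega>. \<omega> \<in> space P \<Longrightarrow>
           is_arg_min (\<lambda>\<eta>'. contrast X T b (M n) (N n) (v n) (w n) 1 \<omega> \<eta>'
                          + contrast X T b (M n) (N n) (v n) (w n) 2 \<omega> \<eta>')
             (\<lambda>\<eta>'. \<eta>' \<in> H) (\<eta>hat n \<omega>)"
  shows "bigO_prob P (\<lambda>n \<omega>. norm (\<eta>hat n \<omega> - (\<sigma>\<^sup>2, \<theta>2, \<theta>1 / \<theta>2)))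
           (\<lambda>n. 1 / sqrt (min (real (M n) ^ 3) (real (N n) powr (3 / 2))))"
proof -
  interpret spde P X \<sigma> \<theta>2 \<theta>1 \<theta>0
    by (rule spde.intro) (fact assms(1-5))+
  note MN = assms(12,13)
  let ?\<eta> = "(\<sigma>\<^sup>2, \<theta>2, \<theta>1 / \<theta>2)"
  have \<eta>H: "?\<eta> \<in> H" using assms(11) interior_subset by blast
  obtain r where r: "\<And>n. mesh_ratio T b (M n) (N n) (v n) (w n) = r" using assms(17) by blast
  obtain cv where cv: "cv > 0" "\<And>n. real (v n) \<le> cv * max 1 (real (N n) / (real (M n))\<^sup>2)"
    "\<And>n. max 1 (real (N n) / (real (M n))\<^sup>2) \<le> cv * real (v n)"
    using assms(15) unfolding eqsim_def by blast
  obtain cw where cw: "cw > 0" "\<And>n. real (w n) \<le> cw * max 1 (real (M n) / sqrt (real (N n)))"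
    "\<And>n. max 1 (real (M n) / sqrt (real (N n))) \<le> cw * real (w n)"
    using assms(16) unfolding eqsim_def by blast
  \<comment> \<open>The reference sequences are at least 1, so the equivalences exclude the lag 0.\<close>
  have v1: "1 \<le> v n" for n
  proof (rule ccontr)
    assume "\<not> 1 \<le> v n"
    then have "v n = 0" by simp
    then show False using cv(3)[of n] by simp
  qed
  have w1: "1 \<le> w n" for n
  proof (rule ccontr)
    assume "\<not> 1 \<le> w n"
    then have "w n = 0" by simp
    then show False using cw(3)[of n] by simp
  qed
  have rpos: "r > 0"
    unfolding r[of 0, symmetric] mesh_ratio_def ystep_def tstep_def
    using assms(6,8) v1[of 0] w1[of 0] MN(1)[of 0] MN(2)[of 0]
    by (intro divide_pos_pos mult_pos_pos real_sqrt_gt_zero) (simp_all)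
  obtain C where C: "C \<ge> 0" "\<And>M N v w. 2 \<le> M \<Longrightarrow> 2 * w \<le> M \<Longrightarrow> fine_grid T b r M N v w \<Longrightarrow> fine_grid T b (r / sqrt 2) M N (2 * v) w \<Longrightarrow>
      \<exists>Y. integrable P Y \<and> (\<forall>\<omega>. 0 \<le> Y \<omega>) \<and> (\<integral>\<omega>. Y \<omega> \<partial>P) \<le> C * sqrt (sqrt (real v * tstep T N) ^ 3) \<and>
        (\<forall>\<omega>. \<forall>\<eta>'\<in>H. joint_contrast X T b M N v w \<omega> \<eta>'
           \<le> joint_contrast X T b M N v w \<omega> ?\<eta>
           \<longrightarrow> norm (\<eta>' - ?\<eta>) \<le> Y \<omega>)"
    using estimation_error_bound[OF assms(7,8,6) rpos assms(9,10) \<eta>H] by blast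
  define C' where "C' = C * sqrt (sqrt (cv * T) ^ 3)"
  have C': "C' \<ge> 0" using C(1) cv(1) assms(6) by (simp add: C'_def)
  define rate where "rate n = 1 / sqrt (min (real (M n) ^ 3) (real (N n) powr (3 / 2)))" for n
  have rate: "rate n > 0" for n using MN(1)[of n] MN(2)[of n] by (simp add: rate_def)
  have ev: "\<forall>\<^sub>F n in sequentially. 2 \<le> M n \<and> 2 * w n \<le> M n \<and> 4 * v n \<le> N n \<and> real (2 * v n) * tstep T (N n) \<le> 1"
    by (rule admissible_eventually[OF MN assms(6) cv(1) cw(1) assms(14) cv(2) cw(2)])
  show ?thesis
    unfolding bigO_prob_def rate_def[symmetric]
  proof (intro allI impI)
    fix \<epsilon> :: real assume \<epsilon>: "0 < \<epsilon>"
    define Q where "Q = C' / \<epsilon> + 1"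
    have Q: "Q > 0" "C' \<le> \<epsilon> * Q" using C' \<epsilon> by (auto simp: Q_def add_nonneg_pos distrib_left)
    show "\<exists>C>0. \<forall>\<^sub>F n in sequentially. measure P {\<omega> \<in> space P. \<bar>norm (\<eta>hat n \<omega> - ?\<eta>)\<bar> > C * \<bar>rate n\<bar>} \<le> \<epsilon>"
    proof (intro exI[of _ Q] conjI Q(1))
      show "\<forall>\<^sub>F n in sequentially. measure P {\<omega> \<in> space P. \<bar>norm (\<eta>hat n \<omega> - ?\<eta>)\<bar> > Q * \<bar>rate n\<bar>} \<le> \<epsilon>"
        using ev
      proof eventually_elim
        case (elim n)
        have "real (v n) * tstep T (N n) \<le> real (2 * v n) * tstep T (N n)"
          using assms(6) by (intro mult_right_mono) (auto simp: tstep_def)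
        moreover have "mesh_ratio T b (M n) (N n) (2 * v n) (w n) = r / sqrt 2"
          unfolding r[of n, symmetric] mesh_ratio_def by (simp add: real_sqrt_mult mult.assoc)
        ultimately have g: "fine_grid T b r (M n) (N n) (v n) (w n)" "fine_grid T b (r / sqrt 2) (M n) (N n) (2 * v n) (w n)"
          using elim v1[of n] w1[of n] r[of n] MN[of n] unfolding fine_grid_def by linarith+
        obtain Y where Y: "integrable P Y" "\<And>\<omega>. 0 \<le> Y \<omega>" "(\<integral>\<omega>. Y \<omega> \<partial>P) \<le> C * sqrt (sqrt (real (v n) * tstep T (N n)) ^ 3)"
          "\<And>\<omega> \<eta>'. \<eta>' \<in> H \<Longrightarrow> joint_contrast X T b (M n) (N n) (v n) (w n) \<omega> \<eta>'
           \<le> joint_contrast X T b (M n) (N n) (v n) (w n) \<omega> ?\<eta>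
           \<Longrightarrow> norm (\<eta>' - ?\<eta>) \<le> Y \<omega>"
          using C(2)[OF _ _ g] elim by blast
        have "sqrt (sqrt (real (v n) * tstep T (N n)) ^ 3) \<le> sqrt (sqrt (cv * T) ^ 3) * rate n"
          unfolding rate_def
        proof (rule scale_le_rate[OF MN])
          show "0 \<le> cv * T" using cv(1) assms(6) by simp
          show "0 \<le> real (v n) * tstep T (N n)" using assms(6) by (simp add: tstep_def)
          have Np: "real (N n) > 0" using MN(2)[of n] by simp
          have "real (v n) * tstep T (N n) \<le> (cv * max 1 (real (N n) / (real (M n))\<^sup>2)) * tstep T (N n)"
            using assms(6) by (intro mult_right_mono cv(2)) (simp add: tstep_def)
          also have "\<dots> = cv * T * (max 1 (real (N n) / (real (M n))\<^sup>2) * (1 / real (N n)))" by (simp add: tstep_def)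
          also have "max 1 (real (N n) / (real (M n))\<^sup>2) * (1 / real (N n)) = max (1 / real (N n)) (1 / (real (M n))\<^sup>2)"
            using Np by (subst max_mult_distrib_right) simp
          finally show "real (v n) * tstep T (N n) \<le> cv * T * max (1 / real (N n)) (1 / (real (M n))\<^sup>2)" .
        qed
        then have EY: "(\<integral>\<omega>. Y \<omega> \<partial>P) \<le> C' * rate n"
          using Y(3) mult_left_mono[OF _ C(1)] unfolding C'_def by (metis mult.assoc order_trans)
        have "measure P {\<omega> \<in> space P. \<bar>norm (\<eta>hat n \<omega> - ?\<eta>)\<bar> > Q * \<bar>rate n\<bar>} \<le> measure P {\<omega> \<in> space P. Y \<omega> \<ge> Q * rate n}"
        proof (rule finite_measure_mono)
          show "{\<omega> \<in> space P. \<bar>norm (\<eta>hat n \<omega> - ?\<eta>)\<bar> > Q * \<bar>rate n\<bar>} \<subseteq> {\<omega> \<in> space P. Y \<omega> \<ge> Q * rate n}"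
          proof (intro subsetI CollectI, elim CollectE conjE, intro conjI)
            fix \<omega> assume \<omega>: "\<omega> \<in> space P" "\<bar>norm (\<eta>hat n \<omega> - ?\<eta>)\<bar> > Q * \<bar>rate n\<bar>"
            have am: "\<eta>hat n \<omega> \<in> H" "\<not> (joint_contrast X T b (M n) (N n) (v n) (w n) \<omega> ?\<eta>
               < joint_contrast X T b (M n) (N n) (v n) (w n) \<omega> (\<eta>hat n \<omega>))"
              using assms(19)[OF \<omega>(1), of n, folded joint_contrast_def] \<eta>H unfolding is_arg_min_def by blast+
            have "norm (\<eta>hat n \<omega> - ?\<eta>) \<le> Y \<omega>" by (rule Y(4)[OF am(1)]) (use am(2) in linarith)
            then show "Y \<omega> \<ge> Q * rate n" using \<omega>(2) rate[of n] by simp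
          qed
          show "{\<omega> \<in> space P. Y \<omega> \<ge> Q * rate n} \<in> sets P" using Y(1) by measurable
        qed
        also have "\<dots> \<le> (\<integral>\<omega>. Y \<omega> \<partial>P) / (Q * rate n)"
          using Y(2) Q(1) rate[of n] by (intro integral_Markov_inequality_measure[OF Y(1), of "{}"]) auto
        also have "\<dots> \<le> C' * rate n / (Q * rate n)" using EY Q(1) rate[of n] by (intro divide_right_mono) auto
        also have "\<dots> = C' / Q" using rate[of n] by simp
        also have "\<dots> \<le> \<epsilon>" using Q by (simp add: pos_divide_le_eq)
        finally show ?case .
      qed
    qed
  qed
qed

end
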